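(* For all integers $(k,l,d)$ such that $2\le k\le l\le d$ and $d\ge 3$, there exist $k$-stacked combinatorial $d$-spheres which are not $l$-stellated.
   Context: Simplicial complexes are finite and contain the empty set as a face. For a finite set $\alpha$, $\overline{\alpha}$ is the complex of all subsets of $\alpha$, $\partial\alpha$ the complex of all proper subsets, and $\dim(\alpha)=\#(\alpha)-1$; $\ast$ denotes join. The standard sphere $S^d_{d+2}$ is the boundary complex of a $(d+1)$-simplex. A combinatorial $d$-sphere is a simplicial complex that is piecewise-linearly homeomorphic to $S^d_{d+2}$. Bistellar moves: let $X$ be $d$-dimensional and $\alpha,\beta$ disjoint non-empty finite sets with $\dim(\alpha)+\dim(\beta)=d$ such that the induced subcomplex of $X$ on $\alpha\sqcup\beta$ is $\overline{\alpha}\ast\partial\beta$ (if $\beta$ is a single vertex this means $\beta$ is a new vertex not in $X$). The complex $(X\setminus(\overline{\alpha}\ast\partial\beta))\cup(\partial\alpha\ast\overline{\beta})$ is obtained from $X$ by the bistellar move $\alpha\mapsto\beta$, of index $\dim(\beta)$. For $0\le l\le d+1$, a $d$-dimensional complex is $l$-stellated if it is obtained from $S^d_{d+2}$ by a finite (possibly empty) sequence of bistellar moves each of index $<l$. A homology ball means an $\mathbb{F}$-homology ball for some field $\mathbb{F}$. An $\mathbb{F}$-homology $d$-sphere is a $d$-dimensional complex in which the link of every face $\sigma$ (including $\emptyset$) has the reduced $\mathbb{F}$-homology of a $(d-\dim(\sigma)-1)$-sphere. An $\mathbb{F}$-homology $d$-ball is a $d$-dimensional $\mathbb{F}$-acyclic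 complex in which the link of every non-empty face $\sigma$ has the reduced homology of a $(d-\dim(\sigma)-1)$-sphere or of a point, and whose faces with acyclic link form an $\mathbb{F}$-homology $(d-1)$-sphere (its boundary). A homology $(d+1)$-ball is $k$-stacked if all its faces of codimension at least $k+1$ (dimension $\le d-k$) lie in its boundary; a homology $d$-sphere is $k$-stacked if it is the boundary of a $k$-stacked homology $(d+1)$-ball. *)

theory Defs
  imports "HOL-Analysis.Analysis" "HOL-Analysis.Finite_Function_Topology" "HOL-Algebra.Ring"
begin

section \<open>Abstract simplicial complexes\<close>

definition abstract_complex :: "'a set set \<Rightarrow> bool" where
  "abstract_complex X \<longleftrightarrow>
     finite X \<and> {} \<in> X \<and> (\<forall>\<sigma>\<in>X. finite \<sigma>) \<and> (\<forall>\<sigma>\<in>X. \<forall>\<tau>. \<tau> \<subseteq> \<sigma> \<longrightarrow> \<tau> \<in> X)"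

text \<open>Dimensions are integers, so that the empty face has dimension -1.\<close>

definition face_dim :: "'a set \<Rightarrow> int" where
  "face_dim \<sigma> = int (card \<sigma>) - 1"

definition complex_dim :: "'a set set \<Rightarrow> int" where
  "complex_dim X = Max (face_dim ` X)"

definition full_simplex :: "'a set \<Rightarrow> 'a set set" where
  "full_simplex \<alpha> = {\<sigma>. \<sigma> \<subseteq> \<alpha>}"

definition simplex_boundary :: "'a set \<Rightarrow> 'a set set" where
  "simplex_boundary \<alpha> = {\<sigma>. \<sigma> \<subset> \<alpha>}"

definition join :: "'a set set \<Rightarrow> 'a set set \<Rightarrow> 'a set set" where
  "join X Y = {\<sigma> \<union> \<tau> |\<sigma> \<tau>. \<sigma> \<in> X \<and> \<tau> \<in> Y}"

definition induced_subcomplex :: "'a set set \<Rightarrow> 'a set \<Rightarrow> 'a set set" where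
  "induced_subcomplex X W = {\<sigma> \<in> X. \<sigma> \<subseteq> W}"

definition link :: "'a set set \<Rightarrow> 'a set \<Rightarrow> 'a set set" where
  "link X \<sigma> = {\<tau>. \<tau> \<inter> \<sigma> = {} \<and> \<tau> \<union> \<sigma> \<in> X}"

definition standard_sphere :: "int \<Rightarrow> 'a set set \<Rightarrow> bool" where
  "standard_sphere d S \<longleftrightarrow> (\<exists>A. finite A \<and> face_dim A = d + 1 \<and> S = simplex_boundary A)"


section \<open>Piecewise linear homeomorphism and combinatorial spheres\<close>

text \<open>A geometric simplicial complex is given by the vertex sets of its simplices.\<close>

definition geometric_complex :: "'v::real_vector set set \<Rightarrow> bool" where
  "geometric_complex K \<longleftrightarrow>
     abstract_complex K \<and>
     (\<forall>\<sigma>\<in>K. \<not> affine_dependent \<sigma>) \<and>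
     (\<forall>\<sigma>\<in>K. \<forall>\<tau>\<in>K. convex hull \<sigma> \<inter> convex hull \<tau> = convex hull (\<sigma> \<inter> \<tau>))"

definition underlying_space :: "'v::real_vector set set \<Rightarrow> 'v set" where
  "underlying_space K = (\<Union>\<sigma>\<in>K. convex hull \<sigma>)"

definition is_subdivision :: "'v::real_vector set set \<Rightarrow> 'v set set \<Rightarrow> bool" where
  "is_subdivision K' K \<longleftrightarrow>
     geometric_complex K' \<and>
     underlying_space K' = underlying_space K \<and>
     (\<forall>\<sigma>\<in>K'. \<exists>\<tau>\<in>K. convex hull \<sigma> \<subseteq> convex hull \<tau>)"

definition affine_map_on :: "'v::real_vector set \<Rightarrow> ('v \<Rightarrow> 'w::real_vector) \<Rightarrow> bool" where
  "affine_map_on S f \<longleftrightarrow>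
     (\<forall>x\<in>S. \<forall>y\<in>S. \<forall>u\<in>{0..1}.
        f ((1 - u) *\<^sub>R x + u *\<^sub>R y) = (1 - u) *\<^sub>R f x + u *\<^sub>R f y)"

definition piecewise_linear_on :: "'v::real_vector set set \<Rightarrow> ('v \<Rightarrow> 'w::real_vector) \<Rightarrow> bool" where
  "piecewise_linear_on K f \<longleftrightarrow>
     (\<exists>K'. is_subdivision K' K \<and> (\<forall>\<sigma>\<in>K'. affine_map_on (convex hull \<sigma>) f))"

text \<open>The vertex \<open>v\<close> is placed at the unit vector \<open>e\<^sub>v\<close> of the normed space of finitely
  supported real functions on the vertex type.\<close>

definition realization :: "'a set set \<Rightarrow> ('a \<Rightarrow>\<^sub>0 real) set set" where
  "realization X = (\<lambda>\<sigma>. (\<lambda>v. Poly_Mapping.single v 1) ` \<sigma>) ` X"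

definition PL_homeomorphic :: "'a set set \<Rightarrow> 'b set set \<Rightarrow> bool" where
  "PL_homeomorphic X Y \<longleftrightarrow>
     (\<exists>f g. homeomorphism (underlying_space (realization X)) (underlying_space (realization Y)) f g \<and>
            piecewise_linear_on (realization X) f \<and>
            piecewise_linear_on (realization Y) g)"

definition combinatorial_sphere :: "int \<Rightarrow> 'a set set \<Rightarrow> bool" where
  "combinatorial_sphere d X \<longleftrightarrow>
     abstract_complex X \<and> (\<exists>S :: 'a set set. standard_sphere d S \<and> PL_homeomorphic X S)"


section \<open>Bistellar moves and stellated complexes\<close>

definition bistellar_move :: "int \<Rightarrow> 'a set set \<Rightarrow> 'a set \<Rightarrow> 'a set \<Rightarrow> 'a set set \<Rightarrow> bool" where
  "bistellar_move d X \<alpha> \<beta> Y \<longleftrightarrow>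
     abstract_complex X \<and> complex_dim X = d \<and>
     finite \<alpha> \<and> finite \<beta> \<and> \<alpha> \<noteq> {} \<and> \<beta> \<noteq> {} \<and> \<alpha> \<inter> \<beta> = {} \<and>
     face_dim \<alpha> + face_dim \<beta> = d \<and>
     induced_subcomplex X (\<alpha> \<union> \<beta>) = join (full_simplex \<alpha>) (simplex_boundary \<beta>) \<and>
     Y = (X - join (full_simplex \<alpha>) (simplex_boundary \<beta>))
           \<union> join (simplex_boundary \<alpha>) (full_simplex \<beta>)"

text \<open>Every simplex boundary of the right dimension may serve as the initial sphere; for an
  infinite vertex type the resulting class is closed under isomorphism.\<close>

inductive stellated :: "int \<Rightarrow> int \<Rightarrow> 'a set set \<Rightarrow> bool" for l d :: int where
  sphere: "standard_sphere d S \<Longrightarrow> stellated l d S"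
| move: "stellated l d X \<Longrightarrow> bistellar_move d X \<alpha> \<beta> Y \<Longrightarrow> face_dim \<beta> < l \<Longrightarrow> stellated l d Y"


section \<open>Reduced simplicial homology over a field\<close>

text \<open>The linear order on the vertices orients the faces: the facet of \<open>\<sigma>\<close> opposite to \<open>v\<close>
  has incidence number (-1) to the number of vertices of \<open>\<sigma>\<close> below \<open>v\<close>. The empty face is
  included, in degree -1, so the chain complex is the augmented one.\<close>

definition chains :: "('c, 'm) ring_scheme \<Rightarrow> 'a set set \<Rightarrow> int \<Rightarrow> ('a set \<Rightarrow> 'c) set" where
  "chains F X j =
     {c. (\<forall>\<sigma>. c \<sigma> \<in> carrier F) \<and> (\<forall>\<sigma>. \<not> (\<sigma> \<in> X \<and> face_dim \<sigma> = j) \<longrightarrow> c \<sigma> = \<zero>\<^bsub>F\<^esub>)}"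

definition boundary_map ::
    "('c, 'm) ring_scheme \<Rightarrow> 'a::linorder set set \<Rightarrow> ('a set \<Rightarrow> 'c) \<Rightarrow> ('a set \<Rightarrow> 'c)" where
  "boundary_map F X c =
     (\<lambda>\<tau>. \<Oplus>\<^bsub>F\<^esub>v\<in>\<Union>X - \<tau>. ((\<ominus>\<^bsub>F\<^esub> \<one>\<^bsub>F\<^esub>) [^]\<^bsub>F\<^esub> card {u \<in> \<tau>. u < v}) \<otimes>\<^bsub>F\<^esub> c (insert v \<tau>))"

definition cycles ::
    "('c, 'm) ring_scheme \<Rightarrow> 'a::linorder set set \<Rightarrow> int \<Rightarrow> ('a set \<Rightarrow> 'c) set" where
  "cycles F X j = {c \<in> chains F X j. boundary_map F X c = (\<lambda>_. \<zero>\<^bsub>F\<^esub>)}"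

definition boundaries ::
    "('c, 'm) ring_scheme \<Rightarrow> 'a::linorder set set \<Rightarrow> int \<Rightarrow> ('a set \<Rightarrow> 'c) set" where
  "boundaries F X j = boundary_map F X ` chains F X (j + 1)"

text \<open>The dimension of cycles modulo boundaries, as the least size of a spanning set.\<close>

definition reduced_betti :: "('c, 'm) ring_scheme \<Rightarrow> 'a::linorder set set \<Rightarrow> int \<Rightarrow> nat" where
  "reduced_betti F X j =
     (LEAST n. \<exists>S. finite S \<and> card S = n \<and> S \<subseteq> cycles F X j \<and>
        (\<forall>z\<in>cycles F X j. \<exists>a\<in>S \<rightarrow> carrier F. \<exists>b\<in>boundaries F X j.
           \<forall>\<sigma>. z \<sigma> = (\<Oplus>\<^bsub>F\<^esub>s\<in>S. a s \<otimes>\<^bsub>F\<^esub> s \<sigma>) \<oplus>\<^bsub>F\<^esub> b \<sigma>))"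

definition has_homology_of_sphere :: "('c, 'm) ring_scheme \<Rightarrow> int \<Rightarrow> 'a::linorder set set \<Rightarrow> bool" where
  "has_homology_of_sphere F n X \<longleftrightarrow> (\<forall>j. reduced_betti F X j = (if j = n then 1 else 0))"

definition acyclic_complex :: "('c, 'm) ring_scheme \<Rightarrow> 'a::linorder set set \<Rightarrow> bool" where
  "acyclic_complex F X \<longleftrightarrow> (\<forall>j. reduced_betti F X j = 0)"


section \<open>Homology spheres, homology balls and stackedness\<close>

definition homology_sphere :: "('c, 'm) ring_scheme \<Rightarrow> int \<Rightarrow> 'a::linorder set set \<Rightarrow> bool" where
  "homology_sphere F d X \<longleftrightarrow>
     abstract_complex X \<and> complex_dim X = d \<and>
     (\<forall>\<sigma>\<in>X. has_homology_of_sphere F (d - face_dim \<sigma> - 1) (link X \<sigma>))"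

definition ball_boundary :: "('c, 'm) ring_scheme \<Rightarrow> 'a::linorder set set \<Rightarrow> 'a set set" where
  "ball_boundary F B = {\<sigma> \<in> B. acyclic_complex F (link B \<sigma>)}"

definition homology_ball :: "('c, 'm) ring_scheme \<Rightarrow> int \<Rightarrow> 'a::linorder set set \<Rightarrow> bool" where
  "homology_ball F d B \<longleftrightarrow>
     abstract_complex B \<and> complex_dim B = d \<and> acyclic_complex F B \<and>
     (\<forall>\<sigma>\<in>B. \<sigma> \<noteq> {} \<longrightarrow>
        has_homology_of_sphere F (d - face_dim \<sigma> - 1) (link B \<sigma>) \<or> acyclic_complex F (link B \<sigma>)) \<and>
     homology_sphere F (d - 1) (ball_boundary F B)"

text \<open>Here \<open>B\<close> has dimension \<open>d + 1\<close>, so codimension at least \<open>k + 1\<close> is dimension at most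
  \<open>d - k\<close>.\<close>

definition stacked_ball :: "('c, 'm) ring_scheme \<Rightarrow> int \<Rightarrow> int \<Rightarrow> 'a::linorder set set \<Rightarrow> bool" where
  "stacked_ball F k d B \<longleftrightarrow>
     homology_ball F (d + 1) B \<and> (\<forall>\<sigma>\<in>B. face_dim \<sigma> \<le> d - k \<longrightarrow> \<sigma> \<in> ball_boundary F B)"

text \<open>HOL cannot quantify over the types carrying a field, so \<open>F\<close> ranges over all fields whose
  carrier is a set of objects of type \<^typ>\<open>real\<close> with arbitrary operations (not only subfields
  of the reals). Up to isomorphism this includes every field of at most continuum cardinality,
  in particular all prime fields. As Betti numbers over a field are ranks of integer matrices
  and so depend only on its prime field, nothing is lost.\<close>

definition stacked_sphere :: "int \<Rightarrow> int \<Rightarrow> 'a::linorder set set \<Rightarrow> bool" where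
  "stacked_sphere k d X \<longleftrightarrow>
     (\<exists>(F :: real ring) B. field F \<and> stacked_ball F k d B \<and> X = ball_boundary F B)"

end

theory Submission
  imports Defs
begin

text \<open>It suffices to find, for every \<open>d \<ge> 3\<close>, a 2-stacked combinatorial \<open>d\<close>-sphere that is not
  \<open>d\<close>-stellated. Let \<open>S\<close> be a 3-sphere in which any two vertices are joined by an edge and every edge
  has degree at least 4, \<open>v\<close> a vertex of \<open>S\<close>, \<open>D\<close> its antistar and \<open>E\<close> its link, so that \<open>E\<close> is the
  boundary of the ball \<open>D\<close>. For a simplex \<open>\<Delta>\<close> with \<open>d - 2\<close> new vertices, the ball \<open>D * \<Delta>\<close> has the
  interior faces \<open>\<sigma> \<union> \<Delta>\<close> with \<open>\<sigma> \<in> D - E\<close>; since \<open>\<sigma>\<close> is not a single vertex, the ball is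
  2-stacked. A bistellar move of index less than \<open>d\<close> that produces its boundary \<open>X\<close> would leave a
  face of \<open>X\<close> whose link is the boundary of a non-face with at least two vertices, and the
  conditions on \<open>S\<close> exclude this. Such an \<open>S\<close> with 15 vertices exists; it is given by bistellar moves
  that lead to it from the boundary of a simplex. The join of \<open>S\<close> with the boundary of \<open>\<Delta>\<close>
  arises from \<open>X\<close> by starring \<open>\<Delta>\<close> with the new vertex \<open>v\<close>, and a bistellar move of \<open>S\<close> is a local
  exchange on this join, which is realized by an explicit piecewise linear homeomorphism.\<close>


section \<open>Homology over the field with two elements\<close>

definition F2 :: "real ring" where
  "F2 = \<lparr>carrier = {0, 1}, mult = (*), one = 1, zero = 0, add = (\<lambda>x y. if x = y then 0 else 1)\<rparr>"

lemma field_F2: "field F2"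
proof -
  have "abelian_group F2"
    by (rule abelian_groupI) (auto simp: F2_def)
  moreover have "Group.comm_monoid F2"
    by (rule comm_monoidI) (auto simp: F2_def)
  ultimately have "cring F2"
    by (intro cringI) (auto simp: F2_def)
  then show ?thesis
    by (rule cring.cring_fieldI2) (auto simp: F2_def)
qed

interpretation F2: field F2
  by (rule field_F2)

lemma F2_simps [simp]:
  "carrier F2 = {0, 1}" "\<zero>\<^bsub>F2\<^esub> = 0" "\<one>\<^bsub>F2\<^esub> = 1" "x \<otimes>\<^bsub>F2\<^esub> y = x * y"
  "x \<oplus>\<^bsub>F2\<^esub> y = (if x = y then 0 else 1)"
  by (auto simp: F2_def)

lemma F2_minus_one [simp]: "\<ominus>\<^bsub>F2\<^esub> 1 = 1"
  using F2.minus_equality[of 1 1] by simp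

lemma F2_one_pow [simp]: "1 [^]\<^bsub>F2\<^esub> (k::nat) = 1"
  using F2.nat_pow_one[of k] by simp

lemma F2_finsum:
  assumes "finite A" "\<And>x. x \<in> A \<Longrightarrow> f x \<in> {0, 1}"
  shows "finsum F2 f A = (if odd (card {x \<in> A. f x = 1}) then 1 else 0)"
  using assms
proof (induction A rule: finite_induct)
  case (insert a A)
  have "finsum F2 f (insert a A) = f a \<oplus>\<^bsub>F2\<^esub> finsum F2 f A"
    using insert by (intro F2.finsum_insert) auto
  moreover have "{x \<in> insert a A. f x = 1} = (if f a = 1 then insert a {x \<in> A. f x = 1} else {x \<in> A. f x = 1})"
    by auto
  moreover have "f a = 0 \<or> f a = 1" using insert.prems by auto
  ultimately show ?case
    using insert by auto
qed simp

definition sdiff :: "'a set \<Rightarrow> 'a set \<Rightarrow> 'a set" (infixl "\<triangle>" 65) where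
  "A \<triangle> B = (A - B) \<union> (B - A)"

lemma sdiff_iff [simp]: "x \<in> A \<triangle> B \<longleftrightarrow> (x \<in> A) \<noteq> (x \<in> B)"
  by (auto simp: sdiff_def)

lemma sdiff_simps [simp]: "A \<triangle> A = {}" "A \<triangle> {} = A" "{} \<triangle> A = A" "A \<triangle> (A \<triangle> B) = B"
  by (auto simp: sdiff_def)

lemma sdiff_eq_empty_iff [simp]: "A \<triangle> B = {} \<longleftrightarrow> A = B"
  by (auto simp: sdiff_def)

lemma finite_sdiff [simp]: "finite A \<Longrightarrow> finite B \<Longrightarrow> finite (A \<triangle> B)"
  by (simp add: sdiff_def)

lemma sdiff_subset: "A \<subseteq> S \<Longrightarrow> B \<subseteq> S \<Longrightarrow> A \<triangle> B \<subseteq> S"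
  by (auto simp: sdiff_def)

lemma sdiff_ac: "A \<triangle> B = B \<triangle> A" "A \<triangle> B \<triangle> C = A \<triangle> (B \<triangle> C)" "A \<triangle> (B \<triangle> C) = B \<triangle> (A \<triangle> C)"
  by (auto simp: set_eq_iff)

lemma odd_card_sdiff:
  assumes "finite A" "finite B"
  shows "odd (card (A \<triangle> B)) \<longleftrightarrow> odd (card A) \<noteq> odd (card B)"
proof -
  have "card A = card (A - B) + card (A \<inter> B)" "card B = card (B - A) + card (A \<inter> B)"
    using assms by (metis card_Diff_subset_Int card_Int_Diff finite_Int add.commute Int_commute)+
  moreover have "card (A \<triangle> B) = card (A - B) + card (B - A)"
    unfolding sdiff_def using assms by (intro card_Un_disjoint) auto
  ultimately show ?thesis by presburger
qed

definition bd :: "'a set set \<Rightarrow> 'a set set" where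
  "bd s = {\<tau>. odd (card {v. v \<notin> \<tau> \<and> insert v \<tau> \<in> s})}"

lemma finite_cofaces:
  assumes "finite s" shows "finite {v. v \<notin> \<tau> \<and> insert v \<tau> \<in> s}"
proof (rule inj_on_finite[OF _ _ assms])
  show "inj_on (\<lambda>v. insert v \<tau>) {v. v \<notin> \<tau> \<and> insert v \<tau> \<in> s}"
    by (auto simp: inj_on_def)
qed auto

lemma bd_empty [simp]: "bd {} = {}"
  by (simp add: bd_def)

lemma bd_sdiff:
  assumes "finite s" "finite t"
  shows "bd (s \<triangle> t) = bd s \<triangle> bd t"
proof -
  have "{v. v \<notin> \<tau> \<and> insert v \<tau> \<in> s \<triangle> t} = {v. v \<notin> \<tau> \<and> insert v \<tau> \<in> s} \<triangle> {v. v \<notin> \<tau> \<and> insert v \<tau> \<in> t}" for \<tau>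
    by (auto simp: sdiff_def)
  then have "\<tau> \<in> bd (s \<triangle> t) \<longleftrightarrow> \<tau> \<in> bd s \<triangle> bd t" for \<tau>
    using odd_card_sdiff[OF finite_cofaces[OF assms(1)] finite_cofaces[OF assms(2)]]
    by (auto simp: bd_def sdiff_def)
  then show ?thesis by blast
qed

lemma bd_singleton: "bd {\<sigma>} = {\<sigma> - {v} |v. v \<in> \<sigma>}"
proof -
  have "\<tau> \<in> bd {\<sigma>} \<longleftrightarrow> (\<exists>v\<in>\<sigma>. \<tau> = \<sigma> - {v})" for \<tau>
  proof (cases "\<exists>v\<in>\<sigma>. \<tau> = \<sigma> - {v}")
    case True
    then obtain v where "v \<in> \<sigma>" "\<tau> = \<sigma> - {v}" by blast
    then have "{v. v \<notin> \<tau> \<and> insert v \<tau> \<in> {\<sigma>}} = {v}" by auto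
    then show ?thesis using True unfolding bd_def by simp
  next
    case False
    then have "{v. v \<notin> \<tau> \<and> insert v \<tau> \<in> {\<sigma>}} = {}" by auto
    then show ?thesis using False unfolding bd_def by (metis (no_types, lifting) card.empty even_zero mem_Collect_eq)
  qed
  then show ?thesis by blast
qed

lemma bd_bd_singleton: "bd (bd {\<sigma>}) = {}"
proof -
  have "even (card {v. v \<notin> \<tau> \<and> insert v \<tau> \<in> bd {\<sigma>}})" for \<tau>
  proof (cases "\<exists>u w. u \<in> \<sigma> \<and> w \<in> \<sigma> \<and> u \<noteq> w \<and> \<tau> = \<sigma> - {u, w}")
    case True
    then obtain u w where "u \<in> \<sigma>" "w \<in> \<sigma>" "u \<noteq> w" "\<tau> = \<sigma> - {u, w}" by blast
    then have "{v. v \<notin> \<tau> \<and> insert v \<tau> \<in> bd {\<sigma>}} = {u, w}"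
      by (auto simp: bd_singleton)
    then show ?thesis using \<open>u \<noteq> w\<close> by simp
  next
    case False
    have "{v. v \<notin> \<tau> \<and> insert v \<tau> \<in> bd {\<sigma>}} = {}"
    proof (rule ccontr)
      assume "{v. v \<notin> \<tau> \<and> insert v \<tau> \<in> bd {\<sigma>}} \<noteq> {}"
      then obtain v u where *: "v \<notin> \<tau>" "u \<in> \<sigma>" "insert v \<tau> = \<sigma> - {u}"
        by (auto simp: bd_singleton)
      then have "v \<in> \<sigma>" "v \<noteq> u" "\<tau> = \<sigma> - {u, v}" by auto
      then show False using False * by blast
    qed
    then show ?thesis by (metis card.empty even_zero)
  qed
  then show ?thesis by (auto simp: bd_def)
qed

lemma finite_bd:
  assumes "finite s" "\<And>\<sigma>. \<sigma> \<in> s \<Longrightarrow> finite \<sigma>" shows "finite (bd s)"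
proof (rule finite_subset)
  show "bd s \<subseteq> Pow (\<Union>s)"
  proof
    fix \<tau> assume "\<tau> \<in> bd s"
    then have "{v. v \<notin> \<tau> \<and> insert v \<tau> \<in> s} \<noteq> {}"
      unfolding bd_def by (metis (no_types, lifting) card.empty even_zero mem_Collect_eq)
    then show "\<tau> \<in> Pow (\<Union>s)" by blast
  qed
qed (use assms in auto)

lemma bd_bd:
  assumes "finite s" "\<And>\<sigma>. \<sigma> \<in> s \<Longrightarrow> finite \<sigma>"
  shows "bd (bd s) = {}"
  using assms
proof (induction s rule: finite_induct)
  case (insert \<sigma> s)
  have "insert \<sigma> s = {\<sigma>} \<triangle> s" using insert by (auto simp: sdiff_def)
  then have "bd (insert \<sigma> s) = bd {\<sigma>} \<triangle> bd s"
    using insert by (simp add: bd_sdiff)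
  moreover have "finite (bd {\<sigma>})" "finite (bd s)" using insert by (auto intro!: finite_bd)
  ultimately show ?case
    using insert by (simp add: bd_sdiff bd_bd_singleton)
qed simp

text \<open>Chains are indexed by the number of vertices of their faces, one more than the degree.\<close>

definition kfaces :: "'a set set \<Rightarrow> nat \<Rightarrow> 'a set set" where
  "kfaces X n = {\<sigma> \<in> X. card \<sigma> = n}"

definition is_cycle :: "'a set set \<Rightarrow> nat \<Rightarrow> 'a set set \<Rightarrow> bool" where
  "is_cycle X n s \<longleftrightarrow> s \<subseteq> kfaces X n \<and> bd s = {}"

definition is_bdry :: "'a set set \<Rightarrow> nat \<Rightarrow> 'a set set \<Rightarrow> bool" where
  "is_bdry X n s \<longleftrightarrow> (\<exists>c \<subseteq> kfaces X (Suc n). s = bd c)"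

definition hom0 :: "'a set set \<Rightarrow> nat \<Rightarrow> bool" where
  "hom0 X n \<longleftrightarrow> (\<forall>s. is_cycle X n s \<longrightarrow> is_bdry X n s)"

definition hom1 :: "'a set set \<Rightarrow> nat \<Rightarrow> bool" where
  "hom1 X n \<longleftrightarrow> (\<exists>z. is_cycle X n z \<and> \<not> is_bdry X n z \<and>
     (\<forall>s. is_cycle X n s \<longrightarrow> is_bdry X n s \<or> is_bdry X n (s \<triangle> z)))"

definition acyc :: "'a set set \<Rightarrow> bool" where
  "acyc X \<longleftrightarrow> (\<forall>n. hom0 X n)"

definition sph :: "nat \<Rightarrow> 'a set set \<Rightarrow> bool" where
  "sph n X \<longleftrightarrow> hom1 X n \<and> (\<forall>m. m \<noteq> n \<longrightarrow> hom0 X m)"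

lemma abstract_complexD:
  assumes "abstract_complex X"
  shows "finite X" "{} \<in> X" "\<And>\<sigma>. \<sigma> \<in> X \<Longrightarrow> finite \<sigma>" "\<And>\<sigma> \<tau>. \<sigma> \<in> X \<Longrightarrow> \<tau> \<subseteq> \<sigma> \<Longrightarrow> \<tau> \<in> X"
  using assms by (auto simp: abstract_complex_def)

lemma bd_subset_kfaces:
  assumes X: "\<And>\<sigma> \<tau>. \<sigma> \<in> X \<Longrightarrow> \<tau> \<subseteq> \<sigma> \<Longrightarrow> \<tau> \<in> X" "\<And>\<sigma>. \<sigma> \<in> X \<Longrightarrow> finite \<sigma>"
    and "c \<subseteq> kfaces X (Suc n)"
  shows "bd c \<subseteq> kfaces X n"
proof
  fix \<tau> assume "\<tau> \<in> bd c"
  then have "{v. v \<notin> \<tau> \<and> insert v \<tau> \<in> c} \<noteq> {}"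
    unfolding bd_def by (metis (no_types, lifting) card.empty even_zero mem_Collect_eq)
  then obtain v where v: "v \<notin> \<tau>" "insert v \<tau> \<in> c" by blast
  then have *: "insert v \<tau> \<in> X" "card (insert v \<tau>) = Suc n" using assms(3) by (auto simp: kfaces_def)
  then have "\<tau> \<in> X" using X(1) by blast
  then show "\<tau> \<in> kfaces X n" using * v X(2) by (auto simp: kfaces_def)
qed

lemma acyc_cone:
  assumes X: "abstract_complex X" and v: "\<And>\<sigma>. \<sigma> \<in> X \<Longrightarrow> insert v \<sigma> \<in> X"
  shows "acyc X"
  unfolding acyc_def hom0_def
proof (intro allI impI)
  fix n s assume s: "is_cycle X n s"
  define c where "c = {insert v \<sigma> |\<sigma>. \<sigma> \<in> s \<and> v \<notin> \<sigma>}"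
  have sX: "s \<subseteq> X" using s by (auto simp: is_cycle_def kfaces_def)
  have fs: "finite s" using sX X by (auto simp: abstract_complex_def intro: finite_subset)
  have c: "c \<subseteq> kfaces X (Suc n)"
    using s v abstract_complexD[OF X] by (auto simp: c_def is_cycle_def kfaces_def subset_iff)
  have memc: "\<rho> \<in> c \<longleftrightarrow> v \<in> \<rho> \<and> \<rho> - {v} \<in> s" for \<rho>
  proof
    assume "v \<in> \<rho> \<and> \<rho> - {v} \<in> s"
    then show "\<rho> \<in> c" unfolding c_def by (intro CollectI exI[of _ "\<rho> - {v}"]) auto
  qed (auto simp: c_def)
  have "\<tau> \<in> bd c \<longleftrightarrow> \<tau> \<in> s" for \<tau>
  proof (cases "v \<in> \<tau>")
    case False
    then have "{u. u \<notin> \<tau> \<and> insert u \<tau> \<in> c} = (if \<tau> \<in> s then {v} else {})"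
      by (auto simp: memc insert_Diff_if)
    then show ?thesis unfolding bd_def by (simp split: if_splits)
  next
    case True
    define t where "t = \<tau> - {v}"
    define U where "U = {u. u \<notin> t \<and> insert u t \<in> s}"
    have \<tau>: "\<tau> = insert v t" "v \<notin> t" using True by (auto simp: t_def)
    have "t \<notin> bd s" using s by (simp add: is_cycle_def)
    then have ev: "even (card U)" unfolding bd_def U_def by blast
    have eq: "{u. u \<notin> \<tau> \<and> insert u \<tau> \<in> c} = U - {v}"
      using \<tau> by (auto simp: memc insert_Diff_if U_def)
    have vU: "v \<in> U \<longleftrightarrow> \<tau> \<in> s" using \<tau> by (simp add: U_def)
    have fU: "finite U" unfolding U_def using fs by (rule finite_cofaces)
    have "odd (card (U - {v})) \<longleftrightarrow> v \<in> U"
    proof (cases "v \<in> U")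
      case True
      then show ?thesis using ev card.remove[OF fU True] by (metis even_Suc)
    next
      case False
      then show ?thesis using ev by simp
    qed
    then have "odd (card {u. u \<notin> \<tau> \<and> insert u \<tau> \<in> c}) \<longleftrightarrow> \<tau> \<in> s"
      by (simp only: eq vU)
    then show ?thesis by (simp add: bd_def)
  qed
  then show "is_bdry X n s" using c unfolding is_bdry_def by (intro exI[of _ c]) auto
qed

lemma abstract_complex_Pow: "finite t \<Longrightarrow> abstract_complex (Pow t)"
  by (auto simp: abstract_complex_def intro: finite_subset)

lemma acyc_Pow:
  assumes "finite t" "t \<noteq> {}" shows "acyc (Pow t)"
  using acyc_cone[of "Pow t"] assms abstract_complex_Pow by blast

lemma sph_simplex_boundary:
  assumes "finite t" "card t = Suc n" shows "sph n {\<sigma>. \<sigma> \<subset> t}"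
proof -
  let ?X = "{\<sigma>. \<sigma> \<subset> t}"
  have t: "t \<noteq> {}" using assms by auto
  have fill: "\<exists>c \<subseteq> kfaces (Pow t) (Suc m). s = bd c" if "is_cycle ?X m s" for m s
  proof -
    have "is_cycle (Pow t) m s" using that by (auto simp: is_cycle_def kfaces_def)
    then show ?thesis using acyc_Pow[OF assms(1) t] by (auto simp: acyc_def hom0_def is_bdry_def)
  qed
  have top: "kfaces ?X (Suc m) = kfaces (Pow t) (Suc m)" if "m \<noteq> n" for m
    using that assms by (auto simp: kfaces_def)
  have none: "kfaces ?X (Suc n) = {}"
    unfolding kfaces_def using psubset_card_mono[OF assms(1)] assms(2) by (metis (mono_tags, lifting) Collect_empty_eq less_irrefl mem_Collect_eq)
  have "kfaces (Pow t) (Suc n) = {t}"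
    using assms card_subset_eq[OF assms(1)] by (auto simp: kfaces_def)
  then have c: "c = {} \<or> c = {t}" if "c \<subseteq> kfaces (Pow t) (Suc n)" for c
    using that by auto
  have "is_cycle ?X n (bd {t})"
    unfolding is_cycle_def bd_bd_singleton using assms by (auto simp: kfaces_def bd_singleton)
  moreover have "bd {t} \<noteq> {}" using t by (auto simp: bd_singleton)
  moreover have "is_bdry ?X n s \<longleftrightarrow> s = {}" for s
    unfolding is_bdry_def none by auto
  moreover have "s = {} \<or> s \<triangle> bd {t} = {}" if "is_cycle ?X n s" for s
    using fill[OF that] c by (metis bd_empty sdiff_simps(1))
  ultimately have "hom1 ?X n" unfolding hom1_def by blast
  moreover have "hom0 ?X m" if "m \<noteq> n" for m
    unfolding hom0_def is_bdry_def top[OF that] using fill by blast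
  ultimately show ?thesis by (simp add: sph_def)
qed

definition swap_rel :: "'a set set \<Rightarrow> 'a set set \<Rightarrow> 'a set set \<Rightarrow> nat \<Rightarrow> 'a set set \<Rightarrow> 'a set set \<Rightarrow> bool" where
  "swap_rel C A A' n z z' \<longleftrightarrow> is_cycle (C \<union> A) n z \<and> is_cycle (C \<union> A') n z' \<and>
     (\<exists>c a a'. c \<subseteq> kfaces C n \<and> a \<subseteq> kfaces A n \<and> a' \<subseteq> kfaces A' n \<and> z = c \<triangle> a \<and> z' = c \<triangle> a')"

locale acyclic_swap =
  fixes C A A' :: "'a set set"
  assumes fin: "finite C" "finite A" "finite A'"
    and down: "\<And>\<sigma> \<tau>. \<sigma> \<in> C \<Longrightarrow> \<tau> \<subseteq> \<sigma> \<Longrightarrow> \<tau> \<in> C" "\<And>\<sigma> \<tau>. \<sigma> \<in> A \<Longrightarrow> \<tau> \<subseteq> \<sigma> \<Longrightarrow> \<tau> \<in> A"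
       "\<And>\<sigma> \<tau>. \<sigma> \<in> A' \<Longrightarrow> \<tau> \<subseteq> \<sigma> \<Longrightarrow> \<tau> \<in> A'"
    and fins: "\<And>\<sigma>. \<sigma> \<in> C \<union> A \<union> A' \<Longrightarrow> finite \<sigma>"
    and acyc: "acyc A" "acyc A'"
    and inter: "C \<inter> A = C \<inter> A'"
begin

lemma finite_chain:
  "c \<subseteq> kfaces (C \<union> A) n \<Longrightarrow> finite c" "c \<subseteq> kfaces (C \<union> A') n \<Longrightarrow> finite c"
  "c \<subseteq> kfaces C n \<Longrightarrow> finite c" "c \<subseteq> kfaces A n \<Longrightarrow> finite c" "c \<subseteq> kfaces A' n \<Longrightarrow> finite c"
  using fin by (auto simp: kfaces_def intro: finite_subset)

lemma ex_related:
  assumes z: "is_cycle (C \<union> A) n z"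
  shows "\<exists>z'. swap_rel C A A' n z z'"
proof -
  define c where "c = z \<inter> C"
  define a where "a = z - C"
  have zca: "z = c \<triangle> a" by (auto simp: c_def a_def sdiff_def)
  have ck: "c \<subseteq> kfaces C n" and ak: "a \<subseteq> kfaces A n"
    using z by (auto simp: c_def a_def is_cycle_def kfaces_def)
  have "bd c \<triangle> bd a = {}"
    using z finite_chain(3)[OF ck] finite_chain(4)[OF ak] by (simp add: is_cycle_def zca bd_sdiff)
  then have eq: "bd c = bd a" by (auto simp: sdiff_def)
  have "\<exists>a' \<subseteq> kfaces A' n. bd a' = bd c"
  proof (cases n)
    case 0
    have "z \<subseteq> {{}}" using z 0 fins by (auto simp: is_cycle_def kfaces_def)
    then have "c = {} \<or> c = {{}}" by (auto simp: c_def)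
    then have "bd c = {}" by (auto simp: bd_singleton)
    then show ?thesis by (intro exI[of _ "{}"]) auto
  next
    case (Suc m)
    have "bd c \<subseteq> kfaces C m" using bd_subset_kfaces[of C c m] down(1) fins ck Suc by blast
    moreover have "bd a \<subseteq> kfaces A m" using bd_subset_kfaces[of A a m] down(2) fins ak Suc by blast
    ultimately have "bd c \<subseteq> kfaces A' m" using eq inter by (auto simp: kfaces_def)
    moreover have "bd (bd c) = {}" using finite_chain(3)[OF ck] ck fins by (intro bd_bd) (auto simp: kfaces_def)
    ultimately have "is_cycle A' m (bd c)" by (simp add: is_cycle_def)
    then show ?thesis using acyc(2) Suc unfolding acyc_def hom0_def is_bdry_def by metis
  qed
  then obtain a' where a': "a' \<subseteq> kfaces A' n" "bd a' = bd c" by blast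
  have "is_cycle (C \<union> A') n (c \<triangle> a')"
    using ck a' bd_sdiff[OF finite_chain(3)[OF ck] finite_chain(5)[OF a'(1)]]
    by (auto simp: is_cycle_def kfaces_def sdiff_def)
  then show ?thesis unfolding swap_rel_def using z ck ak a'(1) zca by blast
qed

lemma related_bdry:
  assumes r: "swap_rel C A A' n z z'" and b: "is_bdry (C \<union> A) n z"
  shows "is_bdry (C \<union> A') n z'"
proof -
  obtain c a a' where ca: "c \<subseteq> kfaces C n" "a \<subseteq> kfaces A n" "a' \<subseteq> kfaces A' n" "z = c \<triangle> a" "z' = c \<triangle> a'"
    and z': "is_cycle (C \<union> A') n z'"
    using r by (auto simp: swap_rel_def)
  obtain w where w: "w \<subseteq> kfaces (C \<union> A) (Suc n)" "z = bd w" using b by (auto simp: is_bdry_def)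
  define e where "e = w \<inter> C"
  define f where "f = w - C"
  have ek: "e \<subseteq> kfaces C (Suc n)" and fk: "f \<subseteq> kfaces A (Suc n)" and wef: "w = e \<triangle> f"
    using w by (auto simp: e_def f_def kfaces_def sdiff_def)
  have fe: "finite e" and ff: "finite f" using finite_chain ek fk by blast+
  have eq: "c \<triangle> a = bd e \<triangle> bd f" using ca w wef fe ff by (simp add: bd_sdiff)
  have be: "bd e \<subseteq> kfaces C n" using bd_subset_kfaces[of C e n] down(1) fins ek by blast
  have bf: "bd f \<subseteq> kfaces A n" using bd_subset_kfaces[of A f n] down(2) fins fk by blast
  have "c \<triangle> bd e = a \<triangle> bd f"
    using arg_cong[OF eq, of "\<lambda>x. x \<triangle> (a \<triangle> bd e)"] by (simp add: sdiff_ac)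
  moreover have "c \<triangle> bd e \<subseteq> kfaces C n" using ca be by (intro sdiff_subset)
  moreover have "a \<triangle> bd f \<subseteq> kfaces A n" using ca bf by (intro sdiff_subset)
  ultimately have "c \<triangle> bd e \<subseteq> kfaces A' n" using inter by (auto simp: kfaces_def)
  moreover have zz: "z' \<triangle> bd e = (c \<triangle> bd e) \<triangle> a'" using ca by (simp add: sdiff_ac)
  ultimately have "z' \<triangle> bd e \<subseteq> kfaces A' n" using ca by (simp add: sdiff_subset)
  moreover have "bd (z' \<triangle> bd e) = {}"
  proof -
    have "finite z'" using z' finite_chain by (auto simp: is_cycle_def)
    moreover have "bd (bd e) = {}" using fe ek fins by (intro bd_bd) (auto simp: kfaces_def)
    moreover have "finite (bd e)" using fe ek fins by (intro finite_bd) (auto simp: kfaces_def)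
    ultimately show ?thesis using z' by (simp add: bd_sdiff is_cycle_def)
  qed
  ultimately have "is_cycle A' n (z' \<triangle> bd e)" by (simp add: is_cycle_def)
  then obtain g where g: "g \<subseteq> kfaces A' (Suc n)" "z' \<triangle> bd e = bd g"
    using acyc(2) unfolding acyc_def hom0_def is_bdry_def by blast
  have "z' = bd (e \<triangle> g)"
    using arg_cong[OF g(2), of "\<lambda>x. x \<triangle> bd e"] bd_sdiff[OF fe finite_chain(5)[OF g(1)]] by (simp add: sdiff_ac)
  moreover have "e \<triangle> g \<subseteq> kfaces (C \<union> A') (Suc n)" using ek g(1) by (auto simp: kfaces_def sdiff_def)
  ultimately show ?thesis by (auto simp: is_bdry_def)
qed

lemma related_sdiff:
  assumes "swap_rel C A A' n z z'" "swap_rel C A A' n y y'"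
  shows "swap_rel C A A' n (z \<triangle> y) (z' \<triangle> y')"
proof -
  have fz: "finite z" "finite y" "finite z'" "finite y'"
    using assms finite_chain by (auto simp: swap_rel_def is_cycle_def)
  obtain c a a' where 1: "c \<subseteq> kfaces C n" "a \<subseteq> kfaces A n" "a' \<subseteq> kfaces A' n" "z = c \<triangle> a" "z' = c \<triangle> a'"
    using assms by (auto simp: swap_rel_def)
  obtain e b b' where 2: "e \<subseteq> kfaces C n" "b \<subseteq> kfaces A n" "b' \<subseteq> kfaces A' n" "y = e \<triangle> b" "y' = e \<triangle> b'"
    using assms by (auto simp: swap_rel_def)
  have "z \<triangle> y = (c \<triangle> e) \<triangle> (a \<triangle> b)" "z' \<triangle> y' = (c \<triangle> e) \<triangle> (a' \<triangle> b')"
    using 1(4,5) 2(4,5) by (simp_all add: sdiff_ac)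
  moreover have "c \<triangle> e \<subseteq> kfaces C n" "a \<triangle> b \<subseteq> kfaces A n" "a' \<triangle> b' \<subseteq> kfaces A' n"
    using 1 2 by (simp_all add: sdiff_subset)
  moreover have "is_cycle (C \<union> A) n (z \<triangle> y)" "is_cycle (C \<union> A') n (z' \<triangle> y')"
    using assms fz by (simp_all add: swap_rel_def is_cycle_def bd_sdiff sdiff_subset)
  ultimately show ?thesis unfolding swap_rel_def by blast
qed

end

lemma swap_rel_sym: "swap_rel C A A' n z z' \<Longrightarrow> swap_rel C A' A n z' z"
  unfolding swap_rel_def by blast

lemma acyclic_swap_sym:
  assumes "acyclic_swap C A A'" shows "acyclic_swap C A' A"
proof -
  interpret acyclic_swap C A A' by (rule assms)
  show ?thesis
  proof
    show "finite \<sigma>" if "\<sigma> \<in> C \<union> A' \<union> A" for \<sigma> using fins that by blast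
  qed (fact fin acyc inter[symmetric] | erule (1) down)+
qed

lemma acyclic_swap_hom0:
  assumes s: "acyclic_swap C A A'" and h: "hom0 (C \<union> A) n"
  shows "hom0 (C \<union> A') n"
  unfolding hom0_def
proof (intro allI impI)
  fix z' assume "is_cycle (C \<union> A') n z'"
  then obtain z where "swap_rel C A' A n z' z" using acyclic_swap.ex_related[OF acyclic_swap_sym[OF s]] by blast
  then have r: "swap_rel C A A' n z z'" by (rule swap_rel_sym)
  then have "is_bdry (C \<union> A) n z" using h by (auto simp: hom0_def swap_rel_def)
  then show "is_bdry (C \<union> A') n z'" using acyclic_swap.related_bdry[OF s r] by blast
qed

lemma acyclic_swap_hom1:
  assumes s: "acyclic_swap C A A'" and h: "hom1 (C \<union> A) n"
  shows "hom1 (C \<union> A') n"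
proof -
  note s' = acyclic_swap_sym[OF s]
  obtain z where z: "is_cycle (C \<union> A) n z" "\<not> is_bdry (C \<union> A) n z"
    "\<And>s. is_cycle (C \<union> A) n s \<Longrightarrow> is_bdry (C \<union> A) n s \<or> is_bdry (C \<union> A) n (s \<triangle> z)"
    using h by (auto simp: hom1_def)
  obtain z' where r: "swap_rel C A A' n z z'" using acyclic_swap.ex_related[OF s z(1)] by blast
  have "is_cycle (C \<union> A') n z'" using r by (simp add: swap_rel_def)
  moreover have "\<not> is_bdry (C \<union> A') n z'"
    using acyclic_swap.related_bdry[OF s' swap_rel_sym[OF r]] z(2) by blast
  moreover have "is_bdry (C \<union> A') n y' \<or> is_bdry (C \<union> A') n (y' \<triangle> z')" if y': "is_cycle (C \<union> A') n y'" for y'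
  proof -
    obtain y where "swap_rel C A' A n y' y" using acyclic_swap.ex_related[OF s' y'] by blast
    then have y: "swap_rel C A A' n y y'" by (rule swap_rel_sym)
    then have "is_cycle (C \<union> A) n y" by (simp add: swap_rel_def)
    then show ?thesis
      using z(3) acyclic_swap.related_bdry[OF s y] acyclic_swap.related_bdry[OF s acyclic_swap.related_sdiff[OF s y r]]
      by blast
  qed
  ultimately show ?thesis unfolding hom1_def by blast
qed

lemma acyclic_swap_sph: "acyclic_swap C A A' \<Longrightarrow> sph n (C \<union> A) \<Longrightarrow> sph n (C \<union> A')"
  unfolding sph_def using acyclic_swap_hom0 acyclic_swap_hom1 by blast

definition indic :: "'a set set \<Rightarrow> 'a set \<Rightarrow> real" where
  "indic s = (\<lambda>\<sigma>. if \<sigma> \<in> s then 1 else 0)"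

lemma indic_eq_iff [simp]: "indic s = indic t \<longleftrightarrow> s = t"
  by (auto simp: indic_def fun_eq_iff split: if_splits)

lemma chains_F2: "chains F2 X (int n - 1) = indic ` {s. s \<subseteq> kfaces X n}"
proof
  show "chains F2 X (int n - 1) \<subseteq> indic ` {s. s \<subseteq> kfaces X n}"
  proof
    fix c assume c: "c \<in> chains F2 X (int n - 1)"
    have "c = indic {\<sigma>. c \<sigma> = 1}"
      using c by (auto simp: chains_def indic_def fun_eq_iff)
    moreover have "{\<sigma>. c \<sigma> = 1} \<subseteq> kfaces X n"
      using c by (fastforce simp: chains_def kfaces_def face_dim_def)
    ultimately show "c \<in> indic ` {s. s \<subseteq> kfaces X n}" by blast
  qed
qed (auto simp: chains_def indic_def kfaces_def face_dim_def)

lemma boundary_map_indic: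
  assumes "abstract_complex X" "s \<subseteq> X"
  shows "boundary_map F2 X (indic s) = indic (bd s)"
proof
  fix \<tau>
  have fin: "finite (\<Union>X)" using assms by (auto simp: abstract_complex_def)
  have "boundary_map F2 X (indic s) \<tau> = (\<Oplus>\<^bsub>F2\<^esub>v\<in>\<Union>X - \<tau>. indic s (insert v \<tau>))"
    unfolding boundary_map_def by simp
  also have "\<dots> = (if odd (card {v \<in> \<Union>X - \<tau>. indic s (insert v \<tau>) = 1}) then 1 else 0)"
    using fin by (intro F2_finsum) (auto simp: indic_def)
  also have "{v \<in> \<Union>X - \<tau>. indic s (insert v \<tau>) = 1} = {v. v \<notin> \<tau> \<and> insert v \<tau> \<in> s}"
    using assms(2) by (auto simp: indic_def)
  finally show "boundary_map F2 X (indic s) \<tau> = indic (bd s) \<tau>"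
    by (simp add: bd_def indic_def)
qed

lemma cycles_F2:
  assumes "abstract_complex X"
  shows "cycles F2 X (int n - 1) = indic ` {s. is_cycle X n s}"
proof -
  have z: "(\<lambda>_. \<zero>\<^bsub>F2\<^esub>) = indic {}" by (auto simp: indic_def)
  have "boundary_map F2 X (indic s) = (\<lambda>_. \<zero>\<^bsub>F2\<^esub>) \<longleftrightarrow> bd s = {}" if "s \<subseteq> kfaces X n" for s
  proof -
    have "s \<subseteq> X" using that by (auto simp: kfaces_def)
    then show ?thesis unfolding z by (simp add: boundary_map_indic[OF assms])
  qed
  then show ?thesis unfolding cycles_def chains_F2 is_cycle_def by blast
qed

lemma boundaries_F2:
  assumes "abstract_complex X"
  shows "boundaries F2 X (int n - 1) = indic ` {s. is_bdry X n s}"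
proof -
  have "boundaries F2 X (int n - 1) = boundary_map F2 X ` chains F2 X (int (Suc n) - 1)"
    by (simp add: boundaries_def)
  also have "\<dots> = (\<lambda>s. boundary_map F2 X (indic s)) ` {s. s \<subseteq> kfaces X (Suc n)}"
    unfolding chains_F2 by (simp add: image_image)
  also have "\<dots> = (\<lambda>s. indic (bd s)) ` {s. s \<subseteq> kfaces X (Suc n)}"
    using boundary_map_indic[OF assms] by (intro image_cong) (auto simp: kfaces_def)
  also have "\<dots> = indic ` {s. is_bdry X n s}" by (auto simp: is_bdry_def)
  finally show ?thesis .
qed

definition spans :: "'a::linorder set set \<Rightarrow> int \<Rightarrow> ('a set \<Rightarrow> real) set \<Rightarrow> bool" where
  "spans X j S \<longleftrightarrow> S \<subseteq> cycles F2 X j \<and>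
        (\<forall>z\<in>cycles F2 X j. \<exists>a\<in>S \<rightarrow> carrier F2. \<exists>b\<in>boundaries F2 X j.
           \<forall>\<sigma>. z \<sigma> = (\<Oplus>\<^bsub>F2\<^esub>s\<in>S. a s \<otimes>\<^bsub>F2\<^esub> s \<sigma>) \<oplus>\<^bsub>F2\<^esub> b \<sigma>)"

lemma reduced_betti_F2: "reduced_betti F2 X j = (LEAST n. \<exists>S. finite S \<and> card S = n \<and> spans X j S)"
  unfolding reduced_betti_def spans_def by meson

lemma spans_empty_iff:
  "spans X j {} \<longleftrightarrow> cycles F2 X j \<subseteq> boundaries F2 X j" if "\<And>b. b \<in> boundaries F2 X j \<Longrightarrow> \<forall>\<sigma>. b \<sigma> \<in> {0, 1}"
proof -
  have "(\<forall>\<sigma>. z \<sigma> = 0 \<oplus>\<^bsub>F2\<^esub> b \<sigma>) \<longleftrightarrow> z = b" if "b \<in> boundaries F2 X j" for z b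
  proof -
    have "0 \<oplus>\<^bsub>F2\<^esub> b \<sigma> = b \<sigma>" for \<sigma>
      using \<open>\<And>b. b \<in> boundaries F2 X j \<Longrightarrow> \<forall>\<sigma>. b \<sigma> \<in> {0, 1}\<close>[OF that] by (auto dest: spec[of _ \<sigma>])
    then show ?thesis by (auto simp: fun_eq_iff)
  qed
  then show ?thesis unfolding spans_def by auto
qed

lemma indic_range [simp]: "indic s \<sigma> \<noteq> 1 \<longleftrightarrow> indic s \<sigma> = 0"
  by (simp add: indic_def)

lemma reduced_betti_hom0:
  assumes "abstract_complex X" "hom0 X n"
  shows "reduced_betti F2 X (int n - 1) = 0"
proof -
  have "spans X (int n - 1) {}"
    using assms(2) by (subst spans_empty_iff) (auto simp: boundaries_F2[OF assms(1)] cycles_F2[OF assms(1)] hom0_def)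
  then have "\<exists>S. finite S \<and> card S = 0 \<and> spans X (int n - 1) S" by force
  then show ?thesis unfolding reduced_betti_F2 by (intro Least_equality) auto
qed

lemma reduced_betti_negative:
  assumes "abstract_complex X" "j < -1"
  shows "reduced_betti F2 X j = 0"
proof -
  have "chains F2 X j = {\<lambda>_. 0}"
    using assms(2) by (auto simp: chains_def face_dim_def fun_eq_iff)
  moreover have z: "(\<lambda>_. 0) = indic {}" by (auto simp: indic_def)
  moreover have "(\<lambda>_. 0) \<in> chains F2 X (j + 1)" by (auto simp: chains_def)
  ultimately have sub: "cycles F2 X j \<subseteq> boundaries F2 X j"
    using boundary_map_indic[OF assms(1), of "{}"] unfolding cycles_def boundaries_def
    by (auto simp: image_iff intro!: bexI[of _ "\<lambda>_. 0"])
  have "spans X j {}"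
    unfolding spans_def
  proof (intro conjI ballI)
    fix c assume c: "c \<in> cycles F2 X j"
    then have "c = (\<lambda>_. 0)" using \<open>chains F2 X j = {\<lambda>_. 0}\<close> by (auto simp: cycles_def)
    then show "\<exists>a\<in>{} \<rightarrow> carrier F2. \<exists>b\<in>boundaries F2 X j.
           \<forall>\<sigma>. c \<sigma> = (\<Oplus>\<^bsub>F2\<^esub>s\<in>{}. a s \<otimes>\<^bsub>F2\<^esub> s \<sigma>) \<oplus>\<^bsub>F2\<^esub> b \<sigma>"
      using sub c by (intro bexI[of _ "\<lambda>_. 0"] bexI[of _ c]) auto
  qed auto
  then have "\<exists>S. finite S \<and> card S = 0 \<and> spans X j S" by force
  then show ?thesis unfolding reduced_betti_F2 by (intro Least_equality) auto
qed

lemma reduced_betti_hom1: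
  assumes X: "abstract_complex X" and h: "hom1 X n"
  shows "reduced_betti F2 X (int n - 1) = 1"
proof -
  obtain z where z: "is_cycle X n z" "\<not> is_bdry X n z"
    "\<And>s. is_cycle X n s \<Longrightarrow> is_bdry X n s \<or> is_bdry X n (s \<triangle> z)"
    using h by (auto simp: hom1_def)
  have "spans X (int n - 1) {indic z}"
    unfolding spans_def cycles_F2[OF X] boundaries_F2[OF X]
  proof (intro conjI ballI)
    fix c assume "c \<in> indic ` {s. is_cycle X n s}"
    then obtain s where s: "c = indic s" "is_cycle X n s" by blast
    have sum: "(\<Oplus>\<^bsub>F2\<^esub>s\<in>{indic z}. a s \<otimes>\<^bsub>F2\<^esub> s \<sigma>) = a (indic z) * indic z \<sigma>"
      if "a (indic z) \<in> {0, 1}" for a \<sigma>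
    proof -
      have "a (indic z) * indic z \<sigma> \<in> {0, 1}" using that by (auto simp: indic_def)
      then show ?thesis using F2.finsum_insert[of "{}" "indic z" "\<lambda>s. a s \<otimes>\<^bsub>F2\<^esub> s \<sigma>"] by auto
    qed
    show "\<exists>a\<in>{indic z} \<rightarrow> carrier F2. \<exists>b\<in>indic ` {s. is_bdry X n s}.
       \<forall>\<sigma>. c \<sigma> = (\<Oplus>\<^bsub>F2\<^esub>s\<in>{indic z}. a s \<otimes>\<^bsub>F2\<^esub> s \<sigma>) \<oplus>\<^bsub>F2\<^esub> b \<sigma>"
    proof (cases "is_bdry X n s")
      case True
      show ?thesis
        by (rule bexI[of _ "\<lambda>_. 0"], rule bexI[of _ "indic s"], intro allI, subst sum) (use True s in \<open>auto simp: indic_def\<close>)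
    next
      case False
      then have b: "is_bdry X n (s \<triangle> z)" using z(3) s by blast
      show ?thesis
      proof (intro bexI[of _ "indic (s \<triangle> z)"] bexI[of _ "\<lambda>_. 1"] allI)
        fix \<sigma>
        show "c \<sigma> = (\<Oplus>\<^bsub>F2\<^esub>s\<in>{indic z}. 1 \<otimes>\<^bsub>F2\<^esub> s \<sigma>) \<oplus>\<^bsub>F2\<^esub> indic (s \<triangle> z) \<sigma>"
          using sum[of "\<lambda>_. 1"] s by (auto simp: indic_def)
      qed (use b in auto)
    qed
  qed (use z in auto)
  then have "\<exists>S. finite S \<and> card S = 1 \<and> spans X (int n - 1) S" by (intro exI[of _ "{indic z}"]) auto
  moreover have "\<not> (\<exists>S. finite S \<and> card S = 0 \<and> spans X (int n - 1) S)"
  proof -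
    have "\<not> spans X (int n - 1) {}"
      using z by (subst spans_empty_iff) (auto simp: boundaries_F2[OF X] cycles_F2[OF X])
    then show ?thesis by auto
  qed
  ultimately show ?thesis
    unfolding reduced_betti_F2 by (intro Least_equality) (auto simp: Suc_le_eq intro!: Nat.gr0I)
qed

lemma acyclic_complex_F2:
  assumes "abstract_complex X" "acyc X"
  shows "acyclic_complex F2 X"
  unfolding acyclic_complex_def
proof
  fix j :: int
  show "reduced_betti F2 X j = 0"
  proof (cases "j < -1")
    case False
    then have "j = int (nat (j + 1)) - 1" by simp
    then show ?thesis using reduced_betti_hom0[OF assms(1)] assms(2) unfolding acyc_def by metis
  qed (use reduced_betti_negative assms in blast)
qed

lemma has_homology_of_sphere_F2:
  assumes "abstract_complex X" "sph n X"
  shows "has_homology_of_sphere F2 (int n - 1) X"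
  unfolding has_homology_of_sphere_def
proof
  fix j :: int
  show "reduced_betti F2 X j = (if j = int n - 1 then 1 else 0)"
  proof (cases "j < -1")
    case False
    define m where "m = nat (j + 1)"
    have j: "j = int m - 1" using False by (simp add: m_def)
    then show ?thesis using reduced_betti_hom0[OF assms(1)] reduced_betti_hom1[OF assms(1)] assms(2)
      unfolding sph_def by (cases "m = n") auto
  qed (use reduced_betti_negative assms in auto)
qed

lemma sphere_not_acyclic: "has_homology_of_sphere F n X \<Longrightarrow> \<not> acyclic_complex F X"
  by (auto simp: has_homology_of_sphere_def acyclic_complex_def)

lemma abstract_complexI:
  assumes "finite X" "{} \<in> X" "\<And>\<sigma>. \<sigma> \<in> X \<Longrightarrow> finite \<sigma>" "\<And>\<sigma> \<tau>. \<sigma> \<in> X \<Longrightarrow> \<tau> \<subseteq> \<sigma> \<Longrightarrow> \<tau> \<in> X"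
  shows "abstract_complex X"
  using assms unfolding abstract_complex_def by blast

lemma abstract_complex_avoiding:
  assumes "finite t" "\<not> A \<subseteq> \<sigma>"
  shows "abstract_complex {\<tau>. \<tau> \<subseteq> t \<and> \<not> A \<subseteq> \<tau> \<union> \<sigma>}"
proof (rule abstract_complexI)
  show "finite {\<tau>. \<tau> \<subseteq> t \<and> \<not> A \<subseteq> \<tau> \<union> \<sigma>}"
    by (rule finite_subset[of _ "Pow t"]) (use assms in auto)
qed (use assms in \<open>auto intro: finite_subset\<close>)

lemma acyc_avoiding:
  assumes "finite t" "\<not> A \<subseteq> \<sigma>" "v \<in> t" "v \<notin> A"
  shows "acyc {\<tau>. \<tau> \<subseteq> t \<and> \<not> A \<subseteq> \<tau> \<union> \<sigma>}"
  by (rule acyc_cone[of _ v]) (use assms abstract_complex_avoiding in auto)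

lemma abstract_complex_link:
  assumes "abstract_complex X" "\<sigma> \<in> X" shows "abstract_complex (link X \<sigma>)"
proof (rule abstract_complexI)
  note X = abstract_complexD[OF assms(1)]
  have sub: "link X \<sigma> \<subseteq> X" using X(4) unfolding link_def by blast
  then show "finite (link X \<sigma>)" using X(1) by (rule finite_subset)
  show "finite \<tau>" if "\<tau> \<in> link X \<sigma>" for \<tau> using that sub X(3) by blast
  show "\<rho> \<in> link X \<sigma>" if "\<tau> \<in> link X \<sigma>" "\<rho> \<subseteq> \<tau>" for \<tau> \<rho>
    using that X(4)[of "\<tau> \<union> \<sigma>" "\<rho> \<union> \<sigma>"] unfolding link_def by blast
qed (use assms in \<open>auto simp: link_def\<close>)

lemma complex_dim_eqI:
  assumes "finite X" "\<And>\<sigma>. \<sigma> \<in> X \<Longrightarrow> card \<sigma> \<le> n" "\<sigma> \<in> X" "card \<sigma> = n"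
  shows "complex_dim X = int n - 1"
  unfolding complex_dim_def
proof (rule Max_eqI)
  show "d \<le> int n - 1" if "d \<in> face_dim ` X" for d
  proof -
    obtain \<tau> where "\<tau> \<in> X" "d = int (card \<tau>) - 1" using \<open>d \<in> face_dim ` X\<close> by (auto simp: face_dim_def)
    then show ?thesis using assms(2)[of \<tau>] by simp
  qed
  show "int n - 1 \<in> face_dim ` X" using assms(3,4) by (auto simp: face_dim_def image_iff intro!: bexI[of _ \<sigma>])
qed (use assms(1) in simp)

subsection \<open>Links, antistars and suspensions\<close>

definition vlink :: "'a \<Rightarrow> 'a set set \<Rightarrow> 'a set set" where
  "vlink v c = {\<sigma>. v \<notin> \<sigma> \<and> insert v \<sigma> \<in> c}"

definition antistar :: "'a \<Rightarrow> 'a set set \<Rightarrow> 'a set set" where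
  "antistar v c = {\<sigma> \<in> c. v \<notin> \<sigma>}"

lemma vlink_empty [simp]: "vlink v {} = {}"
  by (simp add: vlink_def)

lemma vlink_sdiff: "vlink v (a \<triangle> b) = vlink v a \<triangle> vlink v b"
  by (auto simp: vlink_def)

lemma vlink_bd: "vlink v (bd c) = bd (vlink v c)"
proof -
  have "\<tau> \<in> vlink v (bd c) \<longleftrightarrow> \<tau> \<in> bd (vlink v c)" for \<tau>
  proof (cases "v \<in> \<tau>")
    case True
    then have "{u. u \<notin> \<tau> \<and> insert u \<tau> \<in> vlink v c} = {}" by (auto simp: vlink_def)
    then have "\<tau> \<notin> bd (vlink v c)" unfolding bd_def by (metis (no_types, lifting) card.empty even_zero mem_Collect_eq)
    then show ?thesis using True by (simp add: vlink_def)
  next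
    case False
    have "{u. u \<notin> insert v \<tau> \<and> insert u (insert v \<tau>) \<in> c} = {u. u \<notin> \<tau> \<and> insert u \<tau> \<in> vlink v c}"
      using False by (auto simp: vlink_def insert_commute)
    then show ?thesis using False unfolding bd_def by (simp add: vlink_def)
  qed
  then show ?thesis by blast
qed

lemma vlink_cone: "(\<And>\<sigma>. \<sigma> \<in> l \<Longrightarrow> v \<notin> \<sigma>) \<Longrightarrow> vlink v (insert v ` l) = l"
  by (auto simp: vlink_def image_iff) (metis Diff_insert_absorb insert_absorb2 insert_Diff_single)+

lemma vlink_kfaces:
  assumes "\<And>\<sigma>. \<sigma> \<in> X \<Longrightarrow> finite \<sigma>"
  shows "vlink v (kfaces X (Suc m)) = kfaces (vlink v X) m"
proof -
  have "finite \<sigma>" if "insert v \<sigma> \<in> X" for \<sigma> using assms[OF that] by simp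
  then show ?thesis by (auto simp: vlink_def kfaces_def)
qed

lemma vlink_mono: "a \<subseteq> b \<Longrightarrow> vlink v a \<subseteq> vlink v b"
  by (auto simp: vlink_def)

lemma cone_kfaces:
  assumes "\<And>\<sigma>. \<sigma> \<in> X \<Longrightarrow> finite \<sigma>" "l \<subseteq> kfaces (vlink v X) m"
  shows "insert v ` l \<subseteq> kfaces X (Suc m)"
proof
  fix \<rho> assume "\<rho> \<in> insert v ` l"
  then obtain \<sigma> where s: "\<sigma> \<in> l" "\<rho> = insert v \<sigma>" by blast
  then have "v \<notin> \<sigma>" "insert v \<sigma> \<in> X" "card \<sigma> = m" using assms(2) by (auto simp: kfaces_def vlink_def)
  moreover have "finite \<sigma>" using assms(1)[OF \<open>insert v \<sigma> \<in> X\<close>] by simp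
  ultimately show "\<rho> \<in> kfaces X (Suc m)" using s by (simp add: kfaces_def)
qed

lemma kfaces_antistar: "c \<subseteq> kfaces X m \<Longrightarrow> vlink v c = {} \<Longrightarrow> c \<subseteq> kfaces (antistar v X) m"
  by (auto simp: vlink_def kfaces_def antistar_def) (metis insert_absorb mk_disjoint_insert subsetD)

lemma vlink_antistar: "c \<subseteq> kfaces (antistar v X) m \<Longrightarrow> vlink v c = {}"
  by (auto simp: vlink_def kfaces_def antistar_def)

lemma abstract_complex_antistar: "abstract_complex X \<Longrightarrow> abstract_complex (antistar v X)"
  by (rule abstract_complexI) (auto simp: antistar_def abstract_complex_def)

lemma abstract_complex_vlink:
  assumes "abstract_complex X" "{v} \<in> X" shows "abstract_complex (vlink v X)"
proof -
  have "vlink v X = link X {v}" by (auto simp: vlink_def link_def)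
  then show ?thesis using abstract_complex_link[OF assms] by simp
qed

lemma finite_chain_kfaces:
  assumes "abstract_complex X" "c \<subseteq> kfaces X m"
  shows "finite c" "\<And>\<sigma>. \<sigma> \<in> c \<Longrightarrow> finite \<sigma>"
proof -
  have "c \<subseteq> X" using assms(2) by (auto simp: kfaces_def)
  then show "finite c" "\<And>\<sigma>. \<sigma> \<in> c \<Longrightarrow> finite \<sigma>"
    using abstract_complexD[OF assms(1)] by (auto intro: finite_subset)
qed

lemma is_cycle_vlink:
  assumes "abstract_complex X" "c \<subseteq> kfaces X (Suc m)" "vlink v (bd c) = {}"
  shows "is_cycle (vlink v X) m (vlink v c)"
  using assms vlink_mono[OF assms(2), of v] vlink_kfaces[of X v m] abstract_complexD(3)[OF assms(1)]
  unfolding is_cycle_def by (simp add: vlink_bd)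

text \<open>Subtracting the boundary of a cone with apex \<open>v\<close> moves a chain off \<open>v\<close>.\<close>

lemma push_off:
  assumes X: "abstract_complex X" and c: "c \<subseteq> kfaces X m" and g: "g \<subseteq> kfaces (vlink v X) m" "vlink v c = bd g"
  obtains w where "w \<subseteq> kfaces X (Suc m)" "c \<triangle> bd w \<subseteq> kfaces (antistar v X) m" "bd (c \<triangle> bd w) = bd c"
proof
  let ?w = "insert v ` g"
  note fin = abstract_complexD(3)[OF X]
  show w: "?w \<subseteq> kfaces X (Suc m)" using cone_kfaces[OF fin g(1)] .
  have av: "v \<notin> \<sigma>" if "\<sigma> \<in> g" for \<sigma> using that g(1) by (auto simp: kfaces_def vlink_def)
  have "vlink v (c \<triangle> bd ?w) = {}"
    using g(2) vlink_cone[of g v] av by (simp add: vlink_sdiff vlink_bd)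
  moreover have "bd ?w \<subseteq> kfaces X m"
    by (rule bd_subset_kfaces[OF _ _ w]) (use abstract_complexD[OF X] in blast)+
  then have "c \<triangle> bd ?w \<subseteq> kfaces X m" using c by (rule sdiff_subset[rotated])
  ultimately show "c \<triangle> bd ?w \<subseteq> kfaces (antistar v X) m" by (rule kfaces_antistar[rotated])
  note fc = finite_chain_kfaces[OF X c] finite_chain_kfaces[OF X w] finite_chain_kfaces[OF X \<open>bd ?w \<subseteq> kfaces X m\<close>]
  have "bd (c \<triangle> bd ?w) = bd c \<triangle> bd (bd ?w)" using fc by (intro bd_sdiff)
  also have "bd (bd ?w) = {}" using fc by (intro bd_bd)
  finally show "bd (c \<triangle> bd ?w) = bd c" by simp
qed

lemma is_bdry_of_vlink:
  assumes X: "abstract_complex X" and a: "acyc (antistar v X)"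
    and s: "is_cycle X m s" and g: "g \<subseteq> kfaces (vlink v X) m" "vlink v s = bd g"
  shows "is_bdry X m s"
proof -
  have sk: "s \<subseteq> kfaces X m" "bd s = {}" using s by (auto simp: is_cycle_def)
  obtain w where w: "w \<subseteq> kfaces X (Suc m)" "s \<triangle> bd w \<subseteq> kfaces (antistar v X) m" "bd (s \<triangle> bd w) = bd s"
    using push_off[OF X sk(1) g] by blast
  then obtain c where c: "c \<subseteq> kfaces (antistar v X) (Suc m)" "s \<triangle> bd w = bd c"
    using a sk(2) unfolding acyc_def hom0_def is_cycle_def is_bdry_def by metis
  have cX: "c \<subseteq> kfaces X (Suc m)" using c(1) by (auto simp: kfaces_def antistar_def)
  have "bd (c \<triangle> w) = bd c \<triangle> bd w"
    using finite_chain_kfaces[OF X cX] finite_chain_kfaces[OF X w(1)] by (intro bd_sdiff)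
  also have "\<dots> = s" unfolding c(2)[symmetric] by (simp add: sdiff_ac)
  finally show ?thesis unfolding is_bdry_def using cX w(1) by (intro exI[of _ "c \<triangle> w"]) (auto intro: sdiff_subset[THEN subsetD])
qed

lemma sph_of_vlink:
  assumes X: "abstract_complex X" and v: "{v} \<in> X" and a: "acyc (antistar v X)" and l: "sph n (vlink v X)"
  shows "sph (Suc n) X"
proof -
  let ?L = "vlink v X"
  have L: "abstract_complex ?L" by (rule abstract_complex_vlink[OF X v])
  have "hom0 X m" if m: "m \<noteq> Suc n" for m
    unfolding hom0_def
  proof (intro allI impI)
    fix s assume s: "is_cycle X m s"
    have "\<exists>g\<subseteq>kfaces ?L m. vlink v s = bd g"
    proof (cases m)
      case 0
      then have "vlink v s = {}"
        using s abstract_complexD(3)[OF X] by (fastforce simp: is_cycle_def kfaces_def vlink_def)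
      then show ?thesis by (intro exI[of _ "{}"]) auto
    next
      case (Suc k)
      then have "is_cycle ?L k (vlink v s)" using s by (intro is_cycle_vlink[OF X]) (auto simp: is_cycle_def)
      moreover have "hom0 ?L k" using l m Suc by (auto simp: sph_def)
      ultimately show ?thesis unfolding hom0_def is_bdry_def using Suc by blast
    qed
    then show "is_bdry X m s" using is_bdry_of_vlink[OF X a s] by blast
  qed
  moreover have "hom1 X (Suc n)"
  proof -
    obtain z where z: "is_cycle ?L n z" "\<not> is_bdry ?L n z"
      "\<And>s. is_cycle ?L n s \<Longrightarrow> is_bdry ?L n s \<or> is_bdry ?L n (s \<triangle> z)"
      using l by (auto simp: sph_def hom1_def)
    have zk: "z \<subseteq> kfaces ?L n" "bd z = {}" using z(1) by (auto simp: is_cycle_def)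
    have "\<sigma> \<in> antistar v X" if "\<sigma> \<in> ?L" for \<sigma>
      using that abstract_complexD(4)[OF X] by (auto simp: vlink_def antistar_def)
    then have "is_cycle (antistar v X) n z" using zk by (auto simp: is_cycle_def kfaces_def)
    then obtain c where c: "c \<subseteq> kfaces (antistar v X) (Suc n)" "z = bd c"
      using a unfolding acyc_def hom0_def is_bdry_def by blast
    have cX: "c \<subseteq> kfaces X (Suc n)" using c(1) by (auto simp: kfaces_def antistar_def)
    have wX: "insert v ` z \<subseteq> kfaces X (Suc n)" using cone_kfaces[OF abstract_complexD(3)[OF X] zk(1)] .
    have av: "v \<notin> \<sigma>" if "\<sigma> \<in> z" for \<sigma> using that zk by (auto simp: kfaces_def vlink_def)
    define Z where "Z = c \<triangle> insert v ` z"
    have ZX: "Z \<subseteq> kfaces X (Suc n)" unfolding Z_def using cX wX by (rule sdiff_subset)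
    have lZ: "vlink v Z = z"
      unfolding Z_def using vlink_antistar[OF c(1)] vlink_cone[of z v] av by (simp add: vlink_sdiff)
    have "bd (insert v ` z) = z"
    proof -
      have "bd (insert v ` z) \<subseteq> kfaces X n"
        by (rule bd_subset_kfaces[OF _ _ wX]) (use abstract_complexD[OF X] in blast)+
      moreover have "vlink v (bd (insert v ` z)) = {}" using vlink_cone[of z v] av zk(2) by (simp add: vlink_bd)
      ultimately have avoid: "v \<notin> \<tau>" if "\<tau> \<in> bd (insert v ` z)" for \<tau>
        using kfaces_antistar[of "bd (insert v ` z)" X n v] that by (auto simp: kfaces_def antistar_def)
      have "\<tau> \<in> bd (insert v ` z) \<longleftrightarrow> \<tau> \<in> z" if "v \<notin> \<tau>" for \<tau>
      proof -
        have "u \<notin> \<tau> \<and> insert u \<tau> \<in> insert v ` z \<longleftrightarrow> u = v \<and> \<tau> \<in> z" for u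
        proof
          assume *: "u \<notin> \<tau> \<and> insert u \<tau> \<in> insert v ` z"
          then obtain \<sigma> where \<sigma>: "\<sigma> \<in> z" "insert u \<tau> = insert v \<sigma>" by blast
          then have "v \<in> insert u \<tau>" by simp
          then have "u = v" using \<open>v \<notin> \<tau>\<close> by simp
          then have "\<tau> = \<sigma>" using insert_ident[OF \<open>v \<notin> \<tau>\<close> av[OF \<sigma>(1)]] \<sigma>(2) by simp
          then show "u = v \<and> \<tau> \<in> z" using \<sigma> \<open>u = v\<close> by simp
        qed (use \<open>v \<notin> \<tau>\<close> in simp)
        then have eq: "{u. u \<notin> \<tau> \<and> insert u \<tau> \<in> insert v ` z} = (if \<tau> \<in> z then {v} else {})" by auto
        show ?thesis unfolding bd_def mem_Collect_eq eq by simp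
      qed
      then show ?thesis using avoid av by blast
    qed
    then have bZ: "bd Z = {}" unfolding Z_def
      using finite_chain_kfaces[OF X cX] finite_chain_kfaces[OF X wX] c(2) by (simp add: bd_sdiff)
    have "is_cycle X (Suc n) Z" using ZX bZ by (simp add: is_cycle_def)
    moreover have "\<not> is_bdry X (Suc n) Z"
    proof
      assume "is_bdry X (Suc n) Z"
      then obtain e where e: "e \<subseteq> kfaces X (Suc (Suc n))" "Z = bd e" by (auto simp: is_bdry_def)
      then have "z = bd (vlink v e)" using lZ by (simp add: vlink_bd)
      moreover have "vlink v e \<subseteq> kfaces ?L (Suc n)"
        using vlink_mono[OF e(1), of v] vlink_kfaces[of X v "Suc n"] abstract_complexD(3)[OF X] by simp
      ultimately show False using z(2) by (auto simp: is_bdry_def)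
    qed
    moreover have "is_bdry X (Suc n) s \<or> is_bdry X (Suc n) (s \<triangle> Z)" if s: "is_cycle X (Suc n) s" for s
    proof -
      have "is_cycle ?L n (vlink v s)" using s by (intro is_cycle_vlink[OF X]) (auto simp: is_cycle_def)
      then consider "is_bdry ?L n (vlink v s)" | "is_bdry ?L n (vlink v s \<triangle> z)" using z(3) by blast
      then show ?thesis
      proof cases
        case 1
        then show ?thesis using is_bdry_of_vlink[OF X a s] by (auto simp: is_bdry_def)
      next
        case 2
        have sk: "s \<subseteq> kfaces X (Suc n)" "bd s = {}" using s by (auto simp: is_cycle_def)
        have "is_cycle X (Suc n) (s \<triangle> Z)"
          using sk ZX bZ finite_chain_kfaces(1)[OF X sk(1)] finite_chain_kfaces(1)[OF X ZX]
          by (simp add: is_cycle_def bd_sdiff sdiff_subset)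
        moreover have "vlink v (s \<triangle> Z) = vlink v s \<triangle> z" by (simp add: vlink_sdiff lZ)
        ultimately show ?thesis using is_bdry_of_vlink[OF X a, of "Suc n" "s \<triangle> Z"] 2 by (auto simp: is_bdry_def)
      qed
    qed
    ultimately show ?thesis unfolding hom1_def by blast
  qed
  ultimately show ?thesis by (auto simp: sph_def)
qed

lemma top_cycle_cases:
  assumes "hom1 X n" "kfaces X (Suc n) = {}" "is_cycle X n s" "is_cycle X n t" "t \<noteq> {}"
  shows "s = {} \<or> s = t"
proof -
  have b: "is_bdry X n u \<longleftrightarrow> u = {}" for u using assms(2) by (auto simp: is_bdry_def)
  then show ?thesis using assms(1,3-5) unfolding hom1_def by (metis sdiff_eq_empty_iff)
qed

lemma acyc_antistar:
  assumes X: "abstract_complex X" and v: "{v} \<in> X" and s: "sph (Suc n) X" and l: "sph n (vlink v X)"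
    and dim: "\<And>\<sigma>. \<sigma> \<in> X \<Longrightarrow> card \<sigma> \<le> Suc n" and F: "bd (kfaces X (Suc n)) = {}"
  shows "acyc (antistar v X)"
proof -
  let ?L = "vlink v X"
  let ?F = "kfaces X (Suc n)"
  have L: "abstract_complex ?L" by (rule abstract_complex_vlink[OF X v])
  note fX = abstract_complexD(3)[OF X]
  have noX: "kfaces X (Suc (Suc n)) = {}" using dim by (fastforce simp: kfaces_def)
  then have noL: "kfaces ?L (Suc n) = {}" using vlink_kfaces[of X v "Suc n"] fX by simp
  have cF: "is_cycle X (Suc n) ?F" using F by (simp add: is_cycle_def)
  have lF: "is_cycle ?L n (vlink v ?F)" using F by (intro is_cycle_vlink[OF X]) auto
  have lF0: "vlink v ?F \<noteq> {}"
  proof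
    assume "vlink v ?F = {}"
    then have "kfaces ?L n = {}" using vlink_kfaces[of X v n] fX by simp
    then have "is_bdry ?L n z" if "is_cycle ?L n z" for z
      using that by (auto simp: is_cycle_def is_bdry_def)
    then show False using l by (auto simp: sph_def hom1_def)
  qed
  then have F0: "?F \<noteq> {}" by auto
  show ?thesis
    unfolding acyc_def hom0_def
  proof (intro allI impI)
    fix m s' assume s': "is_cycle (antistar v X) m s'"
    have sk: "s' \<subseteq> kfaces (antistar v X) m" "bd s' = {}" using s' by (auto simp: is_cycle_def)
    have sX: "is_cycle X m s'" using sk by (auto simp: is_cycle_def kfaces_def antistar_def)
    have sv: "vlink v s' = {}" using vlink_antistar[OF sk(1)] .
    show "is_bdry (antistar v X) m s'"
    proof (cases "m = Suc n")
      case True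
      have "s' = {} \<or> s' = ?F"
        using top_cycle_cases[OF _ noX _ cF F0] s sX True by (auto simp: sph_def)
      then have "s' = {}" using sv lF0 by auto
      then show ?thesis by (auto simp: is_bdry_def)
    next
      case False
      then obtain c where c: "c \<subseteq> kfaces X (Suc m)" "s' = bd c"
        using s sX unfolding sph_def hom0_def is_bdry_def by blast
      have lc: "is_cycle ?L m (vlink v c)" using c sv by (intro is_cycle_vlink[OF X]) auto
      obtain c' g where c': "c' \<subseteq> kfaces X (Suc m)" "s' = bd c'" "g \<subseteq> kfaces ?L (Suc m)" "vlink v c' = bd g"
      proof (cases "m = n")
        case True
        have "vlink v c = {} \<or> vlink v c = vlink v ?F"
          using top_cycle_cases[OF _ noL _ lF lF0] l lc True by (auto simp: sph_def)
        then show ?thesis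
        proof
          assume "vlink v c = {}"
          then show ?thesis using that[of c "{}"] c by simp
        next
          assume e: "vlink v c = vlink v ?F"
          have "bd (c \<triangle> ?F) = bd c"
            using finite_chain_kfaces[OF X c(1)] finite_chain_kfaces[OF X, of ?F "Suc n"] F by (simp add: bd_sdiff)
          moreover have "c \<triangle> ?F \<subseteq> kfaces X (Suc m)" using c(1) True by (intro sdiff_subset) auto
          ultimately show ?thesis using that[of "c \<triangle> ?F" "{}"] c e by (simp add: vlink_sdiff)
        qed
      next
        case False
        then have "is_bdry ?L m (vlink v c)" using l lc by (auto simp: sph_def hom0_def)
        then show ?thesis using that[of c] c by (auto simp: is_bdry_def)
      qed
      obtain w where w: "c' \<triangle> bd w \<subseteq> kfaces (antistar v X) (Suc m)" "bd (c' \<triangle> bd w) = bd c'"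
        by (rule push_off[OF X c'(1,3,4)])
      show ?thesis unfolding is_bdry_def using w c'(2) by (intro exI[of _ "c' \<triangle> bd w"]) simp
    qed
  qed
qed


section \<open>Bistellar moves on spheres\<close>

definition flip_cond :: "'a set set \<Rightarrow> 'a set \<Rightarrow> 'a set \<Rightarrow> bool" where
  "flip_cond S \<alpha> \<beta> \<longleftrightarrow> finite \<alpha> \<and> finite \<beta> \<and> \<alpha> \<noteq> {} \<and> \<beta> \<noteq> {} \<and> \<alpha> \<inter> \<beta> = {} \<and> \<beta> \<notin> S \<and>
     (\<forall>b\<in>\<beta>. \<alpha> \<union> \<beta> - {b} \<in> S) \<and> (\<forall>\<sigma>\<in>S. \<alpha> \<subseteq> \<sigma> \<longrightarrow> \<sigma> \<subseteq> \<alpha> \<union> \<beta>)"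

definition flip :: "'a set set \<Rightarrow> 'a set \<Rightarrow> 'a set \<Rightarrow> 'a set set" where
  "flip S \<alpha> \<beta> = S - {\<sigma>. \<alpha> \<subseteq> \<sigma>} \<union> {\<sigma>. \<sigma> \<subseteq> \<alpha> \<union> \<beta> \<and> \<not> \<alpha> \<subseteq> \<sigma>}"

inductive flips :: "nat \<Rightarrow> 'a set set \<Rightarrow> bool" for n where
  simplex: "finite A \<Longrightarrow> card A = Suc n \<Longrightarrow> flips n {\<sigma>. \<sigma> \<subset> A}"
| flip: "flips n S \<Longrightarrow> flip_cond S \<alpha> \<beta> \<Longrightarrow> card \<alpha> + card \<beta> = Suc n \<Longrightarrow> flips n (flip S \<alpha> \<beta>)"

lemma flip_cond_mem_iff:
  assumes S: "abstract_complex S" and c: "flip_cond S \<alpha> \<beta>" and s: "\<sigma> \<subseteq> \<alpha> \<union> \<beta>"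
  shows "\<sigma> \<in> S \<longleftrightarrow> \<not> \<beta> \<subseteq> \<sigma>"
proof
  show "\<not> \<beta> \<subseteq> \<sigma>" if "\<sigma> \<in> S" using that c abstract_complexD(4)[OF S] by (auto simp: flip_cond_def)
  assume "\<not> \<beta> \<subseteq> \<sigma>"
  then obtain b where b: "b \<in> \<beta>" "b \<notin> \<sigma>" by blast
  then have "\<alpha> \<union> \<beta> - {b} \<in> S" using c by (simp add: flip_cond_def)
  moreover have "\<sigma> \<subseteq> \<alpha> \<union> \<beta> - {b}" using s b by blast
  ultimately show "\<sigma> \<in> S" by (rule abstract_complexD(4)[OF S])
qed

lemma flip_mem_iff: "\<sigma> \<in> flip S \<alpha> \<beta> \<longleftrightarrow> \<not> \<alpha> \<subseteq> \<sigma> \<and> (\<sigma> \<in> S \<or> \<sigma> \<subseteq> \<alpha> \<union> \<beta>)"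
  by (auto simp: flip_def)

lemma abstract_complex_flip:
  assumes S: "abstract_complex S" and c: "flip_cond S \<alpha> \<beta>"
  shows "abstract_complex (flip S \<alpha> \<beta>)"
proof (rule abstract_complexI)
  have fin: "finite (\<alpha> \<union> \<beta>)" using c by (simp add: flip_cond_def)
  have "flip S \<alpha> \<beta> \<subseteq> S \<union> Pow (\<alpha> \<union> \<beta>)" by (auto simp: flip_def)
  then show "finite (flip S \<alpha> \<beta>)" by (rule finite_subset) (use abstract_complexD(1)[OF S] fin in simp)
  show "{} \<in> flip S \<alpha> \<beta>" using c by (simp add: flip_mem_iff flip_cond_def)
  show "finite \<sigma>" if "\<sigma> \<in> flip S \<alpha> \<beta>" for \<sigma>
    using that abstract_complexD(3)[OF S] finite_subset[OF _ fin] by (auto simp: flip_mem_iff)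
  show "\<tau> \<in> flip S \<alpha> \<beta>" if "\<sigma> \<in> flip S \<alpha> \<beta>" "\<tau> \<subseteq> \<sigma>" for \<sigma> \<tau>
    using that abstract_complexD(4)[OF S, of \<sigma> \<tau>] unfolding flip_mem_iff by blast
qed

lemma flip_card_le:
  assumes "flip_cond S \<alpha> \<beta>" "card \<alpha> + card \<beta> = Suc n" "\<And>\<sigma>. \<sigma> \<in> S \<Longrightarrow> card \<sigma> \<le> n" "\<sigma> \<in> flip S \<alpha> \<beta>"
  shows "card \<sigma> \<le> n"
proof (cases "\<sigma> \<in> S")
  case False
  then have "\<sigma> \<subset> \<alpha> \<union> \<beta>" using assms(4) by (auto simp: flip_mem_iff)
  moreover have "finite (\<alpha> \<union> \<beta>)" "card (\<alpha> \<union> \<beta>) = Suc n"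
    using assms(1,2) by (auto simp: flip_cond_def card_Un_disjoint)
  ultimately show ?thesis using psubset_card_mono by (metis less_Suc_eq_le)
qed (rule assms(3))

lemma kfaces_flip:
  assumes S: "abstract_complex S" and c: "flip_cond S \<alpha> \<beta>" and n: "card \<alpha> + card \<beta> = Suc n"
  shows "kfaces (flip S \<alpha> \<beta>) n = kfaces S n \<triangle> bd {\<alpha> \<union> \<beta>}"
proof -
  let ?t = "\<alpha> \<union> \<beta>"
  have fin: "finite ?t" and ct: "card ?t = Suc n" and disj: "\<alpha> \<inter> \<beta> = {}"
    using c n by (auto simp: flip_cond_def card_Un_disjoint)
  have facet: "\<sigma> \<in> bd {?t} \<longleftrightarrow> \<sigma> \<subseteq> ?t \<and> card \<sigma> = n" for \<sigma>
  proof
    assume "\<sigma> \<in> bd {?t}"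
    then show "\<sigma> \<subseteq> ?t \<and> card \<sigma> = n" using ct fin by (auto simp: bd_singleton)
  next
    assume s: "\<sigma> \<subseteq> ?t \<and> card \<sigma> = n"
    then have "card (?t - \<sigma>) = 1" using ct finite_subset[OF _ fin, of \<sigma>] by (simp add: card_Diff_subset)
    then obtain x where "?t - \<sigma> = {x}" by (auto simp: card_1_singleton_iff)
    then have "x \<in> ?t" "\<sigma> = ?t - {x}" using s by auto
    then show "\<sigma> \<in> bd {?t}" unfolding bd_singleton by blast
  qed
  have "\<sigma> \<in> kfaces (flip S \<alpha> \<beta>) n \<longleftrightarrow> \<sigma> \<in> kfaces S n \<triangle> bd {?t}" for \<sigma>
  proof (cases "card \<sigma> = n")
    case True
    show ?thesis
    proof (cases "\<sigma> \<subseteq> ?t")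
      case st: True
      have "\<not> (\<alpha> \<subseteq> \<sigma> \<and> \<beta> \<subseteq> \<sigma>)"
      proof
        assume "\<alpha> \<subseteq> \<sigma> \<and> \<beta> \<subseteq> \<sigma>"
        then have "\<sigma> = ?t" using st by blast
        then show False using True ct by simp
      qed
      moreover have "\<alpha> \<subseteq> \<sigma> \<or> \<beta> \<subseteq> \<sigma>"
      proof (rule ccontr)
        assume "\<not> (\<alpha> \<subseteq> \<sigma> \<or> \<beta> \<subseteq> \<sigma>)"
        then obtain a b where ab: "a \<in> \<alpha>" "a \<notin> \<sigma>" "b \<in> \<beta>" "b \<notin> \<sigma>" by blast
        then have "\<sigma> \<subseteq> ?t - {a, b}" "a \<noteq> b" using st disj by auto
        then have "card \<sigma> \<le> card (?t - {a, b})" using fin by (intro card_mono) auto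
        also have "\<dots> = Suc n - 2" using ab \<open>a \<noteq> b\<close> fin ct by (subst card_Diff_subset) auto
        finally have "n \<le> n - 1" using True by simp
        then have "n = 0" by simp
        then have "card \<alpha> = 0 \<or> card \<beta> = 0" using n by linarith
        then show False using c by (auto simp: flip_cond_def)
      qed
      ultimately have "\<not> \<alpha> \<subseteq> \<sigma> \<longleftrightarrow> \<beta> \<subseteq> \<sigma>" by blast
      then show ?thesis using st True flip_cond_mem_iff[OF S c st] facet[of \<sigma>]
        by (simp add: kfaces_def flip_mem_iff)
    next
      case False
      then have "\<sigma> \<in> S \<Longrightarrow> \<not> \<alpha> \<subseteq> \<sigma>" using c by (auto simp: flip_cond_def)
      then show ?thesis using False facet[of \<sigma>] by (auto simp: kfaces_def flip_mem_iff)
    qed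
  qed (use facet[of \<sigma>] in \<open>auto simp: kfaces_def\<close>)
  then show ?thesis by blast
qed

lemma flip_links:
  fixes S :: "'a set set"
  assumes S: "abstract_complex S" and c: "flip_cond S \<alpha> \<beta>" and n: "card \<alpha> + card \<beta> = Suc n"
    and l: "\<And>\<sigma>. \<sigma> \<in> S \<Longrightarrow> sph (n - card \<sigma>) (link S \<sigma>)" and \<sigma>: "\<sigma> \<in> flip S \<alpha> \<beta>"
  shows "sph (n - card \<sigma>) (link (flip S \<alpha> \<beta>) \<sigma>)"
proof -
  let ?t = "\<alpha> \<union> \<beta>"
  let ?E = "flip S \<alpha> \<beta>"
  have fin: "finite ?t" and ct: "card ?t = Suc n" and disj: "\<alpha> \<inter> \<beta> = {}"
    using c n by (auto simp: flip_cond_def card_Un_disjoint)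
  note mem = flip_cond_mem_iff[OF S c]
  have star: "\<tau> \<subseteq> ?t" if "\<tau> \<in> S" "\<alpha> \<subseteq> \<tau>" for \<tau> using c that by (auto simp: flip_cond_def)
  have a: "\<not> \<alpha> \<subseteq> \<sigma>" using \<sigma> by (simp add: flip_mem_iff)
  show ?thesis
  proof (cases "\<sigma> \<subseteq> ?t")
    case False
    have "\<tau> \<in> ?E \<longleftrightarrow> \<tau> \<in> S" if "\<sigma> \<subseteq> \<tau>" for \<tau> using False star that by (auto simp: flip_mem_iff)
    then have "\<tau> \<union> \<sigma> \<in> ?E \<longleftrightarrow> \<tau> \<union> \<sigma> \<in> S" for \<tau> by blast
    then have "link ?E \<sigma> = link S \<sigma>" by (simp only: link_def)
    moreover have "\<sigma> \<in> S" using \<sigma> False by (auto simp: flip_mem_iff)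
    ultimately show ?thesis using l by simp
  next
    case st: True
    show ?thesis
    proof (cases "\<beta> \<subseteq> \<sigma>")
      case b: True
      have "\<tau> \<union> \<sigma> \<notin> S" for \<tau> using b c abstract_complexD(4)[OF S, of "\<tau> \<union> \<sigma>" \<beta>] by (auto simp: flip_cond_def)
      then have "link ?E \<sigma> = {\<tau>. \<tau> \<inter> \<sigma> = {} \<and> \<not> \<alpha> \<subseteq> \<tau> \<union> \<sigma> \<and> \<tau> \<union> \<sigma> \<subseteq> ?t}"
        by (simp add: link_def flip_mem_iff)
      also have "\<dots> = {\<tau>. \<tau> \<subset> ?t - \<sigma>}" using b st a by blast
      finally have "link ?E \<sigma> = {\<tau>. \<tau> \<subset> ?t - \<sigma>}" .
      moreover have "card (?t - \<sigma>) = Suc (n - card \<sigma>)"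
      proof -
        have "\<sigma> \<subset> ?t" using st a by blast
        then have "card \<sigma> < Suc n" using psubset_card_mono[OF fin] ct by metis
        moreover have "card (?t - \<sigma>) = Suc n - card \<sigma>"
          using st ct finite_subset[OF st fin] by (simp add: card_Diff_subset)
        ultimately show ?thesis by simp
      qed
      ultimately show ?thesis using sph_simplex_boundary fin by (metis finite_Diff)
    next
      case b: False
      have sS: "\<sigma> \<in> S" using mem[OF st] b by blast
      have lS: "abstract_complex (link S \<sigma>)" by (rule abstract_complex_link[OF S sS])
      obtain x where x: "x \<in> \<alpha>" "x \<notin> \<sigma>" using a by blast
      obtain y where y: "y \<in> \<beta>" "y \<notin> \<sigma>" using b by blast
      have xb: "x \<notin> \<beta>" and ya: "y \<notin> \<alpha>" using disj x y by auto
      let ?B = "{\<tau>. \<tau> \<subseteq> ?t - \<sigma> \<and> \<not> \<beta> \<subseteq> \<tau> \<union> \<sigma>}"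
      let ?B' = "{\<tau>. \<tau> \<subseteq> ?t - \<sigma> \<and> \<not> \<alpha> \<subseteq> \<tau> \<union> \<sigma>}"
      let ?C = "{\<tau> \<in> link S \<sigma>. \<not> \<alpha> \<subseteq> \<tau> \<union> \<sigma>}"
      have B: "acyc ?B" "abstract_complex ?B"
        using acyc_avoiding[of "?t - \<sigma>" \<beta> \<sigma> x] abstract_complex_avoiding[of "?t - \<sigma>" \<beta> \<sigma>] fin b x xb by auto
      have B': "acyc ?B'" "abstract_complex ?B'"
        using acyc_avoiding[of "?t - \<sigma>" \<alpha> \<sigma> y] abstract_complex_avoiding[of "?t - \<sigma>" \<alpha> \<sigma>] fin a y ya by auto
      have memS: "\<tau> \<union> \<sigma> \<in> S \<longleftrightarrow> \<not> \<beta> \<subseteq> \<tau> \<union> \<sigma>" if "\<tau> \<subseteq> ?t - \<sigma>" for \<tau>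
        by (rule mem) (use that st in blast)
      have e1: "?C \<union> ?B = link S \<sigma>"
      proof (intro Set.set_eqI iffI)
        fix \<tau> assume "\<tau> \<in> ?C \<union> ?B"
        then show "\<tau> \<in> link S \<sigma>" using memS by (auto simp: link_def)
      next
        fix \<tau> assume \<tau>: "\<tau> \<in> link S \<sigma>"
        show "\<tau> \<in> ?C \<union> ?B"
        proof (cases "\<alpha> \<subseteq> \<tau> \<union> \<sigma>")
          case True
          then have "\<tau> \<union> \<sigma> \<subseteq> ?t" using star \<tau> by (auto simp: link_def)
          then have "\<tau> \<subseteq> ?t - \<sigma>" using \<tau> by (auto simp: link_def)
          then show ?thesis using memS \<tau> by (auto simp: link_def)
        qed (use \<tau> in blast)
      qed
      have e2: "link ?E \<sigma> = ?C \<union> ?B'"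
        using st by (auto simp: link_def flip_mem_iff)
      have sw: "acyclic_swap ?C ?B ?B'"
      proof
        show "?C \<inter> ?B = ?C \<inter> ?B'" using memS by (auto simp: link_def)
        show "finite ?C" using abstract_complexD(1)[OF lS] by simp
        show "\<tau> \<in> ?C" if "\<rho> \<in> ?C" "\<tau> \<subseteq> \<rho>" for \<rho> \<tau>
          using that abstract_complexD(4)[OF lS] by blast
        show "finite \<rho>" if "\<rho> \<in> ?C \<union> ?B \<union> ?B'" for \<rho>
          using that abstract_complexD(3)[OF lS] abstract_complexD(3)[OF B(2)] abstract_complexD(3)[OF B'(2)] by blast
        show "\<tau> \<in> ?B" if "\<rho> \<in> ?B" "\<tau> \<subseteq> \<rho>" for \<rho> \<tau>
          using that by blast
        show "\<tau> \<in> ?B'" if "\<rho> \<in> ?B'" "\<tau> \<subseteq> \<rho>" for \<rho> \<tau>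
          using that by blast
      qed (use abstract_complexD(1)[OF B(2)] abstract_complexD(1)[OF B'(2)] B B' in blast)+
      have "sph (n - card \<sigma>) (?C \<union> ?B)" using l[OF sS] by (simp only: e1)
      then show ?thesis unfolding e2 by (rule acyclic_swap_sph[OF sw])
    qed
  qed
qed

lemma flips_invariants:
  assumes "flips n S"
  shows "abstract_complex S \<and> (\<forall>\<sigma>\<in>S. card \<sigma> \<le> n) \<and> bd (kfaces S n) = {} \<and> (\<forall>\<sigma>\<in>S. sph (n - card \<sigma>) (link S \<sigma>))"
  using assms
proof induction
  case (simplex A)
  have lt: "card \<sigma> \<le> n" if "\<sigma> \<subset> A" for \<sigma> using psubset_card_mono[OF simplex(1) that] simplex(2) by simp
  have A: "A \<noteq> {}" using simplex by auto
  have "abstract_complex {\<sigma>. \<sigma> \<subset> A}"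
  proof (rule abstract_complexI)
    show "finite {\<sigma>. \<sigma> \<subset> A}" by (rule finite_subset[of _ "Pow A"]) (use simplex in auto)
  qed (use simplex A in \<open>auto intro: finite_subset\<close>)
  moreover have "kfaces {\<sigma>. \<sigma> \<subset> A} n = bd {A}"
  proof (intro Set.set_eqI iffI)
    fix \<sigma> assume "\<sigma> \<in> kfaces {\<sigma>. \<sigma> \<subset> A} n"
    then have s: "\<sigma> \<subset> A" "card \<sigma> = n" by (auto simp: kfaces_def)
    then have "\<sigma> \<subseteq> A" "finite \<sigma>" using finite_subset[OF _ simplex(1)] by auto
    then have "card (A - \<sigma>) = 1" using simplex s by (simp add: card_Diff_subset)
    then obtain x where "A - \<sigma> = {x}" by (auto simp: card_1_singleton_iff)
    then have "x \<in> A" "\<sigma> = A - {x}" using s by auto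
    then show "\<sigma> \<in> bd {A}" unfolding bd_singleton by blast
  qed (use simplex in \<open>auto simp: kfaces_def bd_singleton\<close>)
  moreover have "sph (n - card \<sigma>) (link {\<sigma>. \<sigma> \<subset> A} \<sigma>)" if s: "\<sigma> \<subset> A" for \<sigma>
  proof -
    have "link {\<sigma>. \<sigma> \<subset> A} \<sigma> = {\<tau>. \<tau> \<subset> A - \<sigma>}" using s by (auto simp: link_def)
    moreover have "card (A - \<sigma>) = Suc (n - card \<sigma>)"
      using s simplex lt[OF s] by (subst card_Diff_subset) (auto intro: finite_subset)
    ultimately show ?thesis using simplex by (simp add: sph_simplex_boundary)
  qed
  ultimately show ?case using lt by (simp add: bd_bd_singleton)
next
  case (flip S \<alpha> \<beta>)
  have S: "abstract_complex S" using flip by blast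
  have fk: "kfaces S n \<subseteq> kfaces S n" "finite {\<alpha> \<union> \<beta>}" "finite (\<alpha> \<union> \<beta>)" using flip by (auto simp: flip_cond_def)
  have "bd (kfaces (flip S \<alpha> \<beta>) n) = {}"
    using finite_chain_kfaces(1)[OF S fk(1)] finite_bd[OF fk(2)] fk(3) flip
    by (simp add: kfaces_flip[OF S flip.hyps(2,3)] bd_sdiff bd_bd_singleton)
  then show ?case
    using abstract_complex_flip[OF S flip.hyps(2)] flip_card_le[OF flip.hyps(2,3)]
      flip_links[OF S flip.hyps(2,3)] flip.IH by blast
qed


section \<open>Homology balls with their boundaries\<close>

definition ball_pair :: "nat \<Rightarrow> 'a set set \<Rightarrow> 'a set set \<Rightarrow> bool" where
  "ball_pair n D E \<longleftrightarrow> abstract_complex D \<and> abstract_complex E \<and> E \<subseteq> D \<and>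
     (\<forall>\<sigma>\<in>D. card \<sigma> \<le> n) \<and> (\<forall>\<sigma>\<in>E. card \<sigma> < n) \<and> (\<exists>\<sigma>\<in>D. card \<sigma> = n) \<and> (\<exists>\<sigma>\<in>E. Suc (card \<sigma>) = n) \<and>
     (\<forall>\<sigma>\<in>E. acyc (link D \<sigma>) \<and> sph (n - 1 - card \<sigma>) (link E \<sigma>)) \<and>
     (\<forall>\<sigma>\<in>D - E. sph (n - card \<sigma>) (link D \<sigma>))"

lemma ball_pair_complex_dim:
  assumes "ball_pair n D E" shows "complex_dim D = int n - 1" "complex_dim E = int n - 2"
proof -
  obtain \<sigma> where \<sigma>: "\<sigma> \<in> D" "card \<sigma> = n" using assms by (auto simp: ball_pair_def)
  show "complex_dim D = int n - 1"
    by (rule complex_dim_eqI[OF _ _ \<sigma>]) (use assms in \<open>auto simp: ball_pair_def abstract_complex_def\<close>)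
  obtain \<tau> where \<tau>: "\<tau> \<in> E" "Suc (card \<tau>) = n" using assms by (auto simp: ball_pair_def)
  have le: "card \<rho> \<le> card \<tau>" if "\<rho> \<in> E" for \<rho>
  proof -
    have "card \<rho> < n" using assms that by (auto simp: ball_pair_def)
    then show ?thesis using \<tau>(2) by simp
  qed
  have "complex_dim E = int (card \<tau>) - 1"
    by (rule complex_dim_eqI[OF _ le \<tau>(1) refl]) (use assms in \<open>auto simp: ball_pair_def abstract_complex_def\<close>)
  then show "complex_dim E = int n - 2" using \<tau> by auto
qed

lemma ball_pair_homology_ball:
  fixes D E :: "'a::linorder set set"
  assumes bp: "ball_pair n D E"
  shows "homology_ball F2 (int n - 1) D" "ball_boundary F2 D = E"
proof -
  have D: "abstract_complex D" and E: "abstract_complex E" "E \<subseteq> D"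
    and cD: "\<And>\<sigma>. \<sigma> \<in> D \<Longrightarrow> card \<sigma> \<le> n" and cE: "\<And>\<sigma>. \<sigma> \<in> E \<Longrightarrow> card \<sigma> < n"
    and lD: "\<And>\<sigma>. \<sigma> \<in> E \<Longrightarrow> acyc (link D \<sigma>)" and lE: "\<And>\<sigma>. \<sigma> \<in> E \<Longrightarrow> sph (n - 1 - card \<sigma>) (link E \<sigma>)"
    and li: "\<And>\<sigma>. \<sigma> \<in> D - E \<Longrightarrow> sph (n - card \<sigma>) (link D \<sigma>)"
    using bp by (auto simp: ball_pair_def)
  have b: "acyclic_complex F2 (link D \<sigma>)" if "\<sigma> \<in> E" for \<sigma>
    using lD[OF that] abstract_complex_link[OF D, of \<sigma>] that E(2) by (intro acyclic_complex_F2) auto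
  have i: "has_homology_of_sphere F2 (int n - 1 - face_dim \<sigma> - 1) (link D \<sigma>)" if "\<sigma> \<in> D" "\<sigma> \<notin> E" for \<sigma>
  proof -
    have "has_homology_of_sphere F2 (int (n - card \<sigma>) - 1) (link D \<sigma>)"
      using li[of \<sigma>] abstract_complex_link[OF D, of \<sigma>] that by (intro has_homology_of_sphere_F2) auto
    then show ?thesis using cD[OF that(1)] by (simp add: face_dim_def of_nat_diff)
  qed
  have "\<not> acyclic_complex F2 (link D \<sigma>)" if "\<sigma> \<in> D" "\<sigma> \<notin> E" for \<sigma>
    using i[OF that] by (rule sphere_not_acyclic)
  then show bE: "ball_boundary F2 D = E" unfolding ball_boundary_def using b E by blast
  have "homology_sphere F2 (int n - 1 - 1) E"
    unfolding homology_sphere_def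
  proof (intro conjI ballI)
    show "complex_dim E = int n - 1 - 1" using ball_pair_complex_dim[OF bp] by simp
    fix \<sigma> assume s: "\<sigma> \<in> E"
    have "has_homology_of_sphere F2 (int (n - 1 - card \<sigma>) - 1) (link E \<sigma>)"
      using lE[OF s] abstract_complex_link[OF E(1) s] by (intro has_homology_of_sphere_F2)
    then show "has_homology_of_sphere F2 (int n - 1 - 1 - face_dim \<sigma> - 1) (link E \<sigma>)"
      using cE[OF s] by (simp add: face_dim_def of_nat_diff)
  qed (rule E(1))
  moreover have "acyclic_complex F2 D"
    using b[of "{}"] abstract_complexD(2)[OF E(1)] by (simp add: link_def)
  ultimately show "homology_ball F2 (int n - 1) D"
    unfolding homology_ball_def bE using D ball_pair_complex_dim[OF bp] i b by blast
qed

lemma bd_kfaces_link: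
  assumes S: "abstract_complex S" and \<sigma>: "\<sigma> \<in> S" "card \<sigma> \<le> n" and F: "bd (kfaces S n) = {}"
  shows "bd (kfaces (link S \<sigma>) (n - card \<sigma>)) = {}"
proof -
  have "even (card {u. u \<notin> \<tau> \<and> insert u \<tau> \<in> kfaces (link S \<sigma>) (n - card \<sigma>)})" for \<tau>
  proof (cases "\<tau> \<inter> \<sigma> = {}")
    case False
    then have "{u. u \<notin> \<tau> \<and> insert u \<tau> \<in> kfaces (link S \<sigma>) (n - card \<sigma>)} = {}"
      by (auto simp: kfaces_def link_def)
    then show ?thesis by (simp only: card.empty even_zero)
  next
    case True
    have "u \<notin> \<tau> \<and> insert u \<tau> \<in> kfaces (link S \<sigma>) (n - card \<sigma>) \<longleftrightarrow>
          u \<notin> \<tau> \<union> \<sigma> \<and> insert u (\<tau> \<union> \<sigma>) \<in> kfaces S n" for u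
    proof (cases "u \<in> \<sigma> \<or> insert u (\<tau> \<union> \<sigma>) \<notin> S")
      case True
      then show ?thesis by (auto simp: kfaces_def link_def)
    next
      case False
      then have "finite (insert u (\<tau> \<union> \<sigma>))" by (intro abstract_complexD(3)[OF S]) simp
      then have "finite \<tau>" "finite \<sigma>" by auto
      moreover have "insert u \<tau> \<inter> \<sigma> = {}" using False True \<open>\<tau> \<inter> \<sigma> = {}\<close> by auto
      ultimately have "card (insert u (\<tau> \<union> \<sigma>)) = card (insert u \<tau>) + card \<sigma>"
        by (metis Un_insert_left card_Un_disjoint finite_insert)
      then show ?thesis using False True \<open>insert u \<tau> \<inter> \<sigma> = {}\<close> \<sigma>(2) by (auto simp: kfaces_def link_def)
    qed
    then have eq: "{u. u \<notin> \<tau> \<and> insert u \<tau> \<in> kfaces (link S \<sigma>) (n - card \<sigma>)} =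
          {u. u \<notin> \<tau> \<union> \<sigma> \<and> insert u (\<tau> \<union> \<sigma>) \<in> kfaces S n}" by (rule Collect_cong)
    have "\<tau> \<union> \<sigma> \<notin> bd (kfaces S n)" using F by blast
    then show ?thesis unfolding eq bd_def by blast
  qed
  then show ?thesis unfolding bd_def by blast
qed

lemma ball_pair_antistar:
  assumes fl: "flips n S" and v: "{v} \<in> S"
    and f: "\<exists>\<sigma>\<in>S. v \<notin> \<sigma> \<and> card \<sigma> = n" and f': "\<exists>\<sigma>\<in>S. v \<in> \<sigma> \<and> card \<sigma> = n"
  shows "ball_pair n (antistar v S) (vlink v S)"
proof -
  let ?D = "antistar v S"
  let ?E = "vlink v S"
  have S: "abstract_complex S" and cS: "\<And>\<sigma>. \<sigma> \<in> S \<Longrightarrow> card \<sigma> \<le> n" and F: "bd (kfaces S n) = {}"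
    and lS: "\<And>\<sigma>. \<sigma> \<in> S \<Longrightarrow> sph (n - card \<sigma>) (link S \<sigma>)"
    using flips_invariants[OF fl] by auto
  note S' = abstract_complexD[OF S]
  have sub: "?E \<subseteq> ?D" using S'(4) by (auto simp: vlink_def antistar_def)
  have fE: "finite \<sigma>" "v \<notin> \<sigma>" "insert v \<sigma> \<in> S" "\<sigma> \<in> S" if "\<sigma> \<in> ?E" for \<sigma>
    using that S'(3)[of "insert v \<sigma>"] S'(4)[of "insert v \<sigma>" \<sigma>] by (auto simp: vlink_def)
  have cE: "card \<sigma> < n" if "\<sigma> \<in> ?E" for \<sigma> using cS[OF fE(3)[OF that]] fE[OF that] by simp
  have lE: "link ?E \<sigma> = link S (insert v \<sigma>)" if "\<sigma> \<in> ?E" for \<sigma>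
    using fE[OF that] by (auto simp: link_def vlink_def)
  have "acyc (link ?D \<sigma>)" if \<sigma>: "\<sigma> \<in> ?E" for \<sigma>
  proof -
    let ?m = "n - Suc (card \<sigma>)"
    have m: "n - card \<sigma> = Suc ?m" using cE[OF \<sigma>] by simp
    have "link ?D \<sigma> = antistar v (link S \<sigma>)" using fE[OF \<sigma>] by (auto simp: link_def antistar_def)
    moreover have "acyc (antistar v (link S \<sigma>))"
    proof (rule acyc_antistar[where n = ?m])
      show "abstract_complex (link S \<sigma>)" by (rule abstract_complex_link[OF S fE(4)[OF \<sigma>]])
      show "{v} \<in> link S \<sigma>" using fE[OF \<sigma>] by (simp add: link_def)
      show "sph (Suc ?m) (link S \<sigma>)" using lS[OF fE(4)[OF \<sigma>]] m by simp
      have "vlink v (link S \<sigma>) = link S (insert v \<sigma>)" using fE[OF \<sigma>] by (auto simp: link_def vlink_def)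
      then show "sph ?m (vlink v (link S \<sigma>))" using lS[OF fE(3)[OF \<sigma>]] fE[OF \<sigma>] by simp
      show "card \<tau> \<le> Suc ?m" if "\<tau> \<in> link S \<sigma>" for \<tau>
      proof -
        have *: "\<tau> \<inter> \<sigma> = {}" "\<tau> \<union> \<sigma> \<in> S" using that by (auto simp: link_def)
        then have "finite (\<tau> \<union> \<sigma>)" using S'(3) by blast
        then have "card (\<tau> \<union> \<sigma>) = card \<tau> + card \<sigma>" using * by (intro card_Un_disjoint) auto
        then show ?thesis using cS[OF *(2)] m by simp
      qed
      show "bd (kfaces (link S \<sigma>) (Suc ?m)) = {}"
        using bd_kfaces_link[OF S fE(4)[OF \<sigma>] cS[OF fE(4)[OF \<sigma>]] F] m by simp
    qed
    ultimately show ?thesis by simp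
  qed
  moreover have "sph (n - 1 - card \<sigma>) (link ?E \<sigma>)" if \<sigma>: "\<sigma> \<in> ?E" for \<sigma>
    using lS[OF fE(3)[OF \<sigma>]] fE[OF \<sigma>] by (simp add: lE[OF \<sigma>])
  moreover have "sph (n - card \<sigma>) (link ?D \<sigma>)" if \<sigma>: "\<sigma> \<in> ?D - ?E" for \<sigma>
  proof -
    have "v \<notin> \<tau>" if "\<tau> \<union> \<sigma> \<in> S" for \<tau>
    proof
      assume "v \<in> \<tau>"
      then have "insert v \<sigma> \<in> S" using S'(4)[OF that, of "insert v \<sigma>"] by blast
      then show False using \<sigma> by (auto simp: vlink_def antistar_def)
    qed
    then have "link ?D \<sigma> = link S \<sigma>" using \<sigma> by (auto simp: link_def antistar_def)
    then show ?thesis using lS \<sigma> by (simp add: antistar_def)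
  qed
  moreover have "\<exists>\<sigma>\<in>?E. Suc (card \<sigma>) = n"
  proof -
    obtain \<sigma> where \<sigma>: "\<sigma> \<in> S" "v \<in> \<sigma>" "card \<sigma> = n" using f' by blast
    then have "Suc (card (\<sigma> - {v})) = n" using S'(3)[OF \<sigma>(1)] card.remove[of \<sigma> v] by metis
    then show ?thesis using \<sigma> by (intro bexI[of _ "\<sigma> - {v}"]) (auto simp: vlink_def insert_absorb)
  qed
  ultimately show ?thesis
    unfolding ball_pair_def using abstract_complex_antistar[OF S, of v] abstract_complex_vlink[OF S v] sub cS cE f
    by (auto simp: antistar_def)
qed

text \<open>If \<open>E\<close> is the boundary of the ball \<open>D\<close>, then \<open>suspend D D \<Delta>\<close> is the join of \<open>D\<close> with the
  simplex \<open>\<Delta>\<close> and \<open>suspend D E \<Delta>\<close> its boundary; \<open>suspend D {} \<Delta>\<close> is the join of \<open>D\<close> with the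
  boundary of \<open>\<Delta>\<close>.\<close>

definition suspend :: "'a set set \<Rightarrow> 'a set set \<Rightarrow> 'a set \<Rightarrow> 'a set set" where
  "suspend D E \<Delta> = {\<rho>. \<rho> - \<Delta> \<in> D \<and> (\<Delta> \<subseteq> \<rho> \<longrightarrow> \<rho> - \<Delta> \<in> E)}"

lemma abstract_complex_suspend:
  assumes D: "abstract_complex D" and E: "\<And>\<sigma> \<tau>. \<sigma> \<in> E \<Longrightarrow> \<tau> \<subseteq> \<sigma> \<Longrightarrow> \<tau> \<in> E" "\<Delta> = {} \<Longrightarrow> {} \<in> E"
    and \<Delta>: "finite \<Delta>"
  shows "abstract_complex (suspend D E \<Delta>)"
proof (rule abstract_complexI)
  note D' = abstract_complexD[OF D]
  have "suspend D E \<Delta> \<subseteq> (\<lambda>(\<sigma>, \<tau>). \<sigma> \<union> \<tau>) ` (D \<times> Pow \<Delta>)"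
  proof
    fix \<rho> assume "\<rho> \<in> suspend D E \<Delta>"
    then show "\<rho> \<in> (\<lambda>(\<sigma>, \<tau>). \<sigma> \<union> \<tau>) ` (D \<times> Pow \<Delta>)"
      by (intro image_eqI[of _ _ "(\<rho> - \<Delta>, \<rho> \<inter> \<Delta>)"]) (auto simp: suspend_def)
  qed
  then show "finite (suspend D E \<Delta>)" by (rule finite_subset) (use D'(1) \<Delta> in simp)
  show "{} \<in> suspend D E \<Delta>" using D'(2) E(2) by (auto simp: suspend_def)
  show "finite \<rho>" if "\<rho> \<in> suspend D E \<Delta>" for \<rho>
  proof -
    have "finite (\<rho> - \<Delta>)" using that D'(3) by (simp add: suspend_def)
    then show ?thesis using \<Delta> by simp
  qed
  show "\<tau> \<in> suspend D E \<Delta>" if "\<rho> \<in> suspend D E \<Delta>" "\<tau> \<subseteq> \<rho>" for \<rho> \<tau>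
  proof -
    have "\<tau> - \<Delta> \<subseteq> \<rho> - \<Delta>" using that by blast
    then show ?thesis using that D'(4)[of "\<rho> - \<Delta>" "\<tau> - \<Delta>"] E(1)[of "\<rho> - \<Delta>" "\<tau> - \<Delta>"] by (auto simp: suspend_def)
  qed
qed

lemma suspend_empty [simp]: "E \<subseteq> D \<Longrightarrow> suspend D E {} = E"
  by (auto simp: suspend_def)

lemma acyc_suspend_self:
  assumes D: "abstract_complex D" and \<Delta>: "finite \<Delta>" "\<Delta> \<noteq> {}"
  shows "acyc (suspend D D \<Delta>)"
proof -
  obtain w where w: "w \<in> \<Delta>" using \<Delta> by blast
  have "abstract_complex (suspend D D \<Delta>)"
    by (rule abstract_complex_suspend[OF D _ _ \<Delta>(1)]) (use abstract_complexD[OF D] in blast)+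
  then show ?thesis by (rule acyc_cone[of _ w]) (use w in \<open>auto simp: suspend_def insert_Diff_if\<close>)
qed

lemma vlink_suspend:
  assumes "w \<notin> \<Union>D" "w \<notin> \<Delta>"
  shows "vlink w (suspend D E (insert w \<Delta>)) = suspend D E \<Delta>"
proof -
  have "insert w \<tau> - insert w \<Delta> = \<tau> - \<Delta>" if "w \<notin> \<tau>" for \<tau> using that by blast
  moreover have "w \<notin> \<tau>" if "\<tau> - \<Delta> \<in> D" for \<tau> using that assms by blast
  moreover have "insert w \<Delta> \<subseteq> insert w \<tau> \<longleftrightarrow> \<Delta> \<subseteq> \<tau>" if "w \<notin> \<tau>" for \<tau> using assms(2) by blast
  ultimately show ?thesis by (auto simp: vlink_def suspend_def)
qed

lemma antistar_suspend:
  assumes "w \<notin> \<Union>D" "w \<notin> \<Delta>"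
  shows "antistar w (suspend D E (insert w \<Delta>)) = suspend D D \<Delta>"
proof -
  have "w \<notin> \<tau>" if "\<tau> - \<Delta> \<in> D" for \<tau> using that assms by blast
  moreover have "\<tau> - insert w \<Delta> = \<tau> - \<Delta>" if "w \<notin> \<tau>" for \<tau> using that by blast
  ultimately show ?thesis by (auto simp: antistar_def suspend_def)
qed

lemma sph_suspend_ball:
  assumes D: "abstract_complex D" "acyc D" and E: "abstract_complex E" "E \<subseteq> D" "sph n E"
    and \<Delta>: "finite \<Delta>" "\<Delta> \<inter> \<Union>D = {}"
  shows "sph (n + card \<Delta>) (suspend D E \<Delta>)"
  using \<Delta>
proof (induction \<Delta> rule: finite_induct)
  case (insert w \<Delta>)
  let ?X = "suspend D E (insert w \<Delta>)"
  have w: "w \<notin> \<Union>D" "w \<notin> \<Delta>" using insert by auto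
  have "abstract_complex ?X"
    using insert.hyps abstract_complexD(4)[OF E(1)] by (intro abstract_complex_suspend[OF D(1)]) auto
  moreover have "{w} \<in> ?X"
    using abstract_complexD(2)[OF D(1)] abstract_complexD(2)[OF E(1)] w by (auto simp: suspend_def)
  moreover have "acyc (antistar w ?X)"
    unfolding antistar_suspend[OF w] using acyc_suspend_self[OF D(1) insert.hyps(1)] D(2) by (cases "\<Delta> = {}") auto
  moreover have "sph (n + card \<Delta>) (vlink w ?X)"
    unfolding vlink_suspend[OF w] using insert by simp
  ultimately have "sph (Suc (n + card \<Delta>)) ?X" by (rule sph_of_vlink)
  then show ?case using insert by simp
qed (use E in simp)

lemma sph_suspend_sphere:
  assumes D: "abstract_complex D" "sph n D" and \<Delta>: "finite \<Delta>" "card \<Delta> = Suc k" "\<Delta> \<inter> \<Union>D = {}"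
  shows "sph (n + k) (suspend D {} \<Delta>)"
  using \<Delta>
proof (induction k arbitrary: \<Delta>)
  case 0
  then obtain w where "\<Delta> = {w}" by (auto simp: card_1_singleton_iff)
  moreover have "\<sigma> - {w} \<in> D \<and> w \<notin> \<sigma> \<longleftrightarrow> \<sigma> \<in> D" for \<sigma> using 0 calculation by auto
  ultimately have "suspend D {} \<Delta> = D" by (auto simp: suspend_def)
  then show ?case using D by simp
next
  case (Suc k)
  obtain w \<Delta>' where \<Delta>': "\<Delta> = insert w \<Delta>'" "w \<notin> \<Delta>'" "card \<Delta>' = Suc k"
    using card_eq_SucD[OF Suc.prems(2)] by blast
  have f: "finite \<Delta>'" "\<Delta>' \<noteq> {}" "w \<notin> \<Union>D" using Suc.prems \<Delta>' by auto
  have "abstract_complex (suspend D {} \<Delta>)"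
    using Suc.prems \<Delta>' by (intro abstract_complex_suspend[OF D(1)]) auto
  moreover have "{w} \<in> suspend D {} \<Delta>"
    using abstract_complexD(2)[OF D(1)] \<Delta>' f by (auto simp: suspend_def)
  moreover have "acyc (antistar w (suspend D {} \<Delta>))"
    unfolding \<Delta>'(1) antistar_suspend[OF f(3) \<Delta>'(2)] using acyc_suspend_self[OF D(1) f(1,2)] .
  moreover have "sph (n + k) (vlink w (suspend D {} \<Delta>))"
    unfolding \<Delta>'(1) vlink_suspend[OF f(3) \<Delta>'(2)] using Suc.IH[of \<Delta>'] Suc.prems \<Delta>' f by auto
  ultimately have "sph (Suc (n + k)) (suspend D {} \<Delta>)" by (rule sph_of_vlink)
  then show ?case by simp
qed

lemma link_suspend:
  assumes "\<Delta> \<inter> \<Union>D = {}"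
  shows "link (suspend D E \<Delta>) \<rho> = suspend (link D (\<rho> - \<Delta>)) (link E (\<rho> - \<Delta>)) (\<Delta> - \<rho>)"
proof -
  have "\<tau> \<in> link (suspend D E \<Delta>) \<rho> \<longleftrightarrow> \<tau> \<in> suspend (link D (\<rho> - \<Delta>)) (link E (\<rho> - \<Delta>)) (\<Delta> - \<rho>)" for \<tau>
  proof (cases "\<tau> \<inter> \<rho> = {}")
    case True
    then have eq: "(\<tau> \<union> \<rho>) - \<Delta> = (\<tau> - (\<Delta> - \<rho>)) \<union> (\<rho> - \<Delta>)" by blast
    have "\<Delta> \<subseteq> \<tau> \<union> \<rho> \<longleftrightarrow> \<Delta> - \<rho> \<subseteq> \<tau>" "(\<tau> - (\<Delta> - \<rho>)) \<inter> (\<rho> - \<Delta>) = {}" using True by blast+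
    then show ?thesis using True unfolding link_def suspend_def mem_Collect_eq eq by blast
  next
    case False
    have "\<tau> - (\<Delta> - \<rho>) \<notin> link D (\<rho> - \<Delta>)"
    proof
      assume *: "\<tau> - (\<Delta> - \<rho>) \<in> link D (\<rho> - \<Delta>)"
      obtain x where x: "x \<in> \<tau>" "x \<in> \<rho>" using False by blast
      have "\<tau> - (\<Delta> - \<rho>) \<subseteq> \<Union>D" using * by (auto simp: link_def)
      then have "x \<in> \<Union>D" using x by blast
      then have "x \<in> \<rho> - \<Delta>" using assms x by blast
      then show False using * x by (auto simp: link_def)
    qed
    then have "\<tau> \<notin> suspend (link D (\<rho> - \<Delta>)) (link E (\<rho> - \<Delta>)) (\<Delta> - \<rho>)" unfolding suspend_def by blast
    moreover have "\<tau> \<notin> link (suspend D E \<Delta>) \<rho>" using False unfolding link_def by blast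
    ultimately show ?thesis by blast
  qed
  then show ?thesis by blast
qed

lemma ball_pair_suspend:
  assumes bp: "ball_pair n D E" and \<Delta>: "finite \<Delta>" "\<Delta> \<noteq> {}" "\<Delta> \<inter> \<Union>D = {}"
  shows "ball_pair (n + card \<Delta>) (suspend D D \<Delta>) (suspend D E \<Delta>)"
proof -
  let ?B = "suspend D D \<Delta>"
  let ?X = "suspend D E \<Delta>"
  have D: "abstract_complex D" and E: "abstract_complex E" "E \<subseteq> D"
    and cD: "\<And>\<sigma>. \<sigma> \<in> D \<Longrightarrow> card \<sigma> \<le> n" and cE: "\<And>\<sigma>. \<sigma> \<in> E \<Longrightarrow> card \<sigma> < n"
    and lD: "\<And>\<sigma>. \<sigma> \<in> E \<Longrightarrow> acyc (link D \<sigma>)" and lE: "\<And>\<sigma>. \<sigma> \<in> E \<Longrightarrow> sph (n - 1 - card \<sigma>) (link E \<sigma>)"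
    and li: "\<And>\<sigma>. \<sigma> \<in> D - E \<Longrightarrow> sph (n - card \<sigma>) (link D \<sigma>)"
    and f: "\<exists>\<sigma>\<in>D. card \<sigma> = n"
    using bp by (auto simp: ball_pair_def)
  note D' = abstract_complexD[OF D] and E' = abstract_complexD[OF E(1)]
  have B: "abstract_complex ?B" by (rule abstract_complex_suspend[OF D _ _ \<Delta>(1)]) (use D' in blast)+
  have X: "abstract_complex ?X" by (rule abstract_complex_suspend[OF D _ _ \<Delta>(1)]) (use E' in blast)+
  have sub: "?X \<subseteq> ?B" by (auto simp: suspend_def)
  have cr: "card \<rho> = card (\<rho> - \<Delta>) + card (\<rho> \<inter> \<Delta>)" if "finite \<rho>" for \<rho>
    using that card_Int_Diff[of \<rho> \<Delta>] by simp
  have cd: "card (\<rho> \<inter> \<Delta>) + card (\<Delta> - \<rho>) = card \<Delta>" for \<rho>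
    using card_Int_Diff[OF \<Delta>(1), of \<rho>] by (simp add: Int_commute)
  have k0: "card (\<Delta> - \<rho>) = 0 \<longleftrightarrow> \<Delta> \<subseteq> \<rho>" for \<rho> using \<Delta>(1) by auto
  have cB: "card \<rho> \<le> n + card \<Delta>" if "\<rho> \<in> ?B" for \<rho>
    using cr[of \<rho>] cd[of \<rho>] cD[of "\<rho> - \<Delta>"] that abstract_complexD(3)[OF B that] by (simp add: suspend_def)
  have cX: "card \<rho> < n + card \<Delta>" if "\<rho> \<in> ?X" for \<rho>
  proof (cases "\<Delta> \<subseteq> \<rho>")
    case True
    then show ?thesis
      using cr[of \<rho>] cd[of \<rho>] cE[of "\<rho> - \<Delta>"] that abstract_complexD(3)[OF X that] by (simp add: suspend_def)
  next
    case False
    then have "card (\<Delta> - \<rho>) > 0" using k0[of \<rho>] by simp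
    then show ?thesis
      using cr[of \<rho>] cd[of \<rho>] cD[of "\<rho> - \<Delta>"] that abstract_complexD(3)[OF X that] by (simp add: suspend_def)
  qed
  obtain \<sigma>0 where \<sigma>0: "\<sigma>0 \<in> D" "card \<sigma>0 = n" using f by blast
  have s0: "\<sigma>0 \<inter> \<Delta> = {}" "finite \<sigma>0" using \<sigma>0 \<Delta>(3) D'(3) by auto
  obtain w where w: "w \<in> \<Delta>" using \<Delta> by blast
  have "\<sigma>0 \<union> \<Delta> \<in> ?B" using \<sigma>0 s0 by (simp add: suspend_def Un_Diff Diff_triv)
  moreover have "card (\<sigma>0 \<union> \<Delta>) = n + card \<Delta>" using \<sigma>0 s0 \<Delta> by (simp add: card_Un_disjoint)
  ultimately have fB: "\<exists>\<rho>\<in>?B. card \<rho> = n + card \<Delta>" by blast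
  have "\<sigma>0 \<union> (\<Delta> - {w}) - \<Delta> = \<sigma>0" using s0 by blast
  moreover have "\<not> \<Delta> \<subseteq> \<sigma>0 \<union> (\<Delta> - {w})" using s0 w by blast
  ultimately have "\<sigma>0 \<union> (\<Delta> - {w}) \<in> ?X" using \<sigma>0 by (simp add: suspend_def)
  moreover have "Suc (card (\<sigma>0 \<union> (\<Delta> - {w}))) = n + card \<Delta>"
  proof -
    have "card (\<sigma>0 \<union> (\<Delta> - {w})) = n + card (\<Delta> - {w})" using \<sigma>0 s0 \<Delta> by (subst card_Un_disjoint) auto
    moreover have "Suc (card (\<Delta> - {w})) = card \<Delta>" by (rule card.remove[OF \<Delta>(1) w, symmetric])
    ultimately show ?thesis by simp
  qed
  ultimately have fX: "\<exists>\<rho>\<in>?X. Suc (card \<rho>) = n + card \<Delta>" by blast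
  have "acyc (link ?B \<rho>) \<and> sph (n + card \<Delta> - 1 - card \<rho>) (link ?X \<rho>)" if \<rho>: "\<rho> \<in> ?X" for \<rho>
  proof
    let ?s = "\<rho> - \<Delta>"
    have sD: "?s \<in> D" using \<rho> by (simp add: suspend_def)
    have ld: "abstract_complex (link D ?s)" by (rule abstract_complex_link[OF D sD])
    have fr: "finite \<rho>" by (rule abstract_complexD(3)[OF X \<rho>])
    have disj: "(\<Delta> - \<rho>) \<inter> \<Union>(link D ?s) = {}" using \<Delta>(3) by (auto simp: link_def)
    show "acyc (link ?B \<rho>)"
    proof (cases "\<Delta> - \<rho> = {}")
      case True
      then have "?s \<in> E" using \<rho> by (simp add: suspend_def)
      then show ?thesis unfolding link_suspend[OF \<Delta>(3)] True using lD by simp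
    next
      case False
      then show ?thesis unfolding link_suspend[OF \<Delta>(3)] using \<Delta>(1) ld by (intro acyc_suspend_self) auto
    qed
    show "sph (n + card \<Delta> - 1 - card \<rho>) (link ?X \<rho>)"
    proof (cases "?s \<in> E")
      case True
      have "sph (n - 1 - card ?s + card (\<Delta> - \<rho>)) (link ?X \<rho>)"
        unfolding link_suspend[OF \<Delta>(3)]
      proof (rule sph_suspend_ball[OF ld lD[OF True] abstract_complex_link[OF E(1) True] _ lE[OF True] _ disj])
        show "link E ?s \<subseteq> link D ?s" using E(2) by (auto simp: link_def)
      qed (use \<Delta>(1) in simp)
      moreover have "n - 1 - card ?s + card (\<Delta> - \<rho>) = n + card \<Delta> - 1 - card \<rho>"
        using cr[OF fr] cd[of \<rho>] cE[OF True] by simp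
      ultimately show ?thesis by simp
    next
      case False
      then have e: "link E ?s = {}" using E'(4) by (auto simp: link_def)
      have "card (\<Delta> - \<rho>) \<noteq> 0" using False \<rho> k0[of \<rho>] by (auto simp: suspend_def)
      then obtain k where k: "card (\<Delta> - \<rho>) = Suc k" by (meson not0_implies_Suc)
      have "sph (n - card ?s + k) (link ?X \<rho>)"
        unfolding link_suspend[OF \<Delta>(3)] e
        by (rule sph_suspend_sphere[OF ld li _ k disj]) (use sD False \<Delta>(1) in auto)
      moreover have "n - card ?s + k = n + card \<Delta> - 1 - card \<rho>"
        using cr[OF fr] cd[of \<rho>] cD[OF sD] k by simp
      ultimately show ?thesis by simp
    qed
  qed
  moreover have "sph (n + card \<Delta> - card \<rho>) (link ?B \<rho>)" if \<rho>: "\<rho> \<in> ?B - ?X" for \<rho>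
  proof -
    let ?s = "\<rho> - \<Delta>"
    have *: "\<Delta> \<subseteq> \<rho>" "?s \<in> D - E" using \<rho> by (auto simp: suspend_def)
    then have e: "\<Delta> - \<rho> = {}" by blast
    have "link ?B \<rho> = link D ?s" unfolding link_suspend[OF \<Delta>(3)] e by simp
    moreover have "card \<rho> = card ?s + card \<Delta>"
      using cr[of \<rho>] abstract_complexD(3)[OF B, of \<rho>] \<rho> *(1) by (simp add: Int_absorb1)
    ultimately show ?thesis using li[OF *(2)] by simp
  qed
  ultimately show ?thesis unfolding ball_pair_def using B X sub cB cX fB fX by blast
qed


section \<open>Piecewise linear homeomorphisms\<close>

subsection \<open>Barycentric weights\<close>

definition supp :: "('v \<Rightarrow> real) \<Rightarrow> 'v set" where
  "supp c = {v. c v \<noteq> 0}"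

definition bary :: "('v::real_vector \<Rightarrow> real) \<Rightarrow> 'v" where
  "bary c = (\<Sum>v\<in>supp c. c v *\<^sub>R v)"

definition weights :: "'v set \<Rightarrow> ('v \<Rightarrow> real) set" where
  "weights \<sigma> = {c. (\<forall>v. 0 \<le> c v) \<and> supp c \<subseteq> \<sigma> \<and> sum c (supp c) = 1}"

definition complex_weights :: "'v set set \<Rightarrow> ('v \<Rightarrow> real) set" where
  "complex_weights K = {c. (\<forall>v. 0 \<le> c v) \<and> supp c \<in> K \<and> sum c (supp c) = 1}"

lemma sum_supp:
  assumes "finite \<sigma>" "supp c \<subseteq> \<sigma>"
  shows "sum c (supp c) = sum c \<sigma>" "bary c = (\<Sum>v\<in>\<sigma>. c v *\<^sub>R v)"
  unfolding bary_def using assms by (auto intro!: sum.mono_neutral_left simp: supp_def)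

lemma convex_hull_weights:
  assumes "finite \<sigma>" shows "convex hull \<sigma> = bary ` weights \<sigma>"
proof
  show "convex hull \<sigma> \<subseteq> bary ` weights \<sigma>"
  proof
    fix x assume "x \<in> convex hull \<sigma>"
    then obtain u where u: "\<forall>v\<in>\<sigma>. 0 \<le> u v" "sum u \<sigma> = 1" "(\<Sum>v\<in>\<sigma>. u v *\<^sub>R v) = x"
      unfolding convex_hull_finite[OF assms] by blast
    define c where "c v = (if v \<in> \<sigma> then u v else 0)" for v
    have s: "supp c \<subseteq> \<sigma>" by (auto simp: supp_def c_def)
    have "c \<in> weights \<sigma>" "bary c = x"
      using u s sum_supp[OF assms s] by (auto simp: weights_def c_def)
    then show "x \<in> bary ` weights \<sigma>" by blast
  qed
  show "bary ` weights \<sigma> \<subseteq> convex hull \<sigma>"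
  proof
    fix x assume "x \<in> bary ` weights \<sigma>"
    then obtain c where c: "c \<in> weights \<sigma>" "x = bary c" by blast
    then show "x \<in> convex hull \<sigma>"
      using sum_supp[OF assms, of c] unfolding convex_hull_finite[OF assms] by (auto simp: weights_def)
  qed
qed

lemma weights_unique:
  fixes \<sigma> :: "'v::real_vector set"
  assumes "finite \<sigma>" "\<not> affine_dependent \<sigma>" "c \<in> weights \<sigma>" "d \<in> weights \<sigma>" "bary c = bary d"
  shows "c = d"
proof (rule ccontr)
  assume "c \<noteq> d"
  then obtain v where v: "c v \<noteq> d v" by blast
  have s: "supp c \<subseteq> \<sigma>" "supp d \<subseteq> \<sigma>" using assms by (auto simp: weights_def)
  note c = sum_supp[OF assms(1) s(1)] and d = sum_supp[OF assms(1) s(2)]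
  have "v \<in> \<sigma>"
  proof (rule ccontr)
    assume "v \<notin> \<sigma>"
    then have "c v = 0" "d v = 0" using s by (auto simp: supp_def)
    then show False using v by simp
  qed
  moreover have "sum (\<lambda>x. c x - d x) \<sigma> = 0" using assms(3,4) c(1) d(1) by (simp add: weights_def sum_subtractf)
  moreover have "(\<Sum>x\<in>\<sigma>. (c x - d x) *\<^sub>R x) = 0"
    using assms(5) c(2) d(2) by (simp add: scaleR_diff_left sum_subtractf)
  ultimately have "affine_dependent \<sigma>"
    unfolding affine_dependent_explicit_finite[OF assms(1)] using v by (intro exI[of _ "\<lambda>x. c x - d x"]) auto
  then show False using assms(2) by blast
qed

lemma geometric_complexD:
  assumes "geometric_complex K"
  shows "abstract_complex K" "\<And>\<sigma>. \<sigma> \<in> K \<Longrightarrow> finite \<sigma>" "\<And>\<sigma>. \<sigma> \<in> K \<Longrightarrow> \<not> affine_dependent \<sigma>"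
    "\<And>\<sigma> \<tau>. \<sigma> \<in> K \<Longrightarrow> \<tau> \<in> K \<Longrightarrow> convex hull \<sigma> \<inter> convex hull \<tau> = convex hull (\<sigma> \<inter> \<tau>)"
    "\<And>\<sigma> \<tau>. \<sigma> \<in> K \<Longrightarrow> \<tau> \<subseteq> \<sigma> \<Longrightarrow> \<tau> \<in> K"
  using assms by (auto simp: geometric_complex_def abstract_complex_def)

lemma inj_on_bary:
  assumes K: "geometric_complex K" shows "inj_on bary (complex_weights K)"
proof (rule inj_onI)
  fix c d assume c: "c \<in> complex_weights K" and d: "d \<in> complex_weights K" and eq: "bary c = bary d"
  note K' = geometric_complexD[OF K]
  have s: "supp c \<in> K" "supp d \<in> K" using c d by (auto simp: complex_weights_def)
  have cw: "c \<in> weights (supp c)" "d \<in> weights (supp d)" using c d by (auto simp: complex_weights_def weights_def)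
  have "bary c \<in> convex hull supp c \<inter> convex hull supp d"
    using cw eq convex_hull_weights K'(2)[OF s(1)] K'(2)[OF s(2)] by (metis IntI imageI)
  then have "bary c \<in> convex hull (supp c \<inter> supp d)" using K'(4)[OF s] by simp
  moreover have "finite (supp c \<inter> supp d)" using K'(2)[OF s(1)] by simp
  ultimately obtain e where e: "e \<in> weights (supp c \<inter> supp d)" "bary c = bary e"
    using convex_hull_weights by blast
  then have "e \<in> weights (supp c)" "e \<in> weights (supp d)" by (auto simp: weights_def)
  then have "c = e" "d = e"
    using weights_unique[OF K'(2)[OF s(1)] K'(3)[OF s(1)] cw(1)] weights_unique[OF K'(2)[OF s(2)] K'(3)[OF s(2)] cw(2)] e(2) eq
    by auto
  then show "c = d" by simp
qed

lemma geometric_complexI: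
  assumes K: "abstract_complex K" and inj: "inj_on bary (complex_weights K)"
  shows "geometric_complex K"
proof -
  note K' = abstract_complexD[OF K]
  have w: "weights \<tau> \<subseteq> complex_weights K" if "\<tau> \<subseteq> \<sigma>" "\<sigma> \<in> K" for \<sigma> \<tau>
  proof
    fix c assume "c \<in> weights \<tau>"
    then show "c \<in> complex_weights K"
      using K'(4)[OF that(2), of "supp c"] that(1) by (auto simp: weights_def complex_weights_def)
  qed
  have int: "convex hull \<sigma> \<inter> convex hull \<tau> = convex hull (\<sigma> \<inter> \<tau>)"
    if s: "\<sigma> \<subseteq> \<sigma>'" "\<sigma>' \<in> K" "\<tau> \<subseteq> \<tau>'" "\<tau>' \<in> K" for \<sigma> \<tau> \<sigma>' \<tau>'
  proof
    have fin: "finite \<sigma>" "finite \<tau>" using s K'(3) finite_subset by metis+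
    show "convex hull (\<sigma> \<inter> \<tau>) \<subseteq> convex hull \<sigma> \<inter> convex hull \<tau>" by (simp add: hull_mono)
    show "convex hull \<sigma> \<inter> convex hull \<tau> \<subseteq> convex hull (\<sigma> \<inter> \<tau>)"
    proof
      fix x assume "x \<in> convex hull \<sigma> \<inter> convex hull \<tau>"
      then obtain c d where c: "c \<in> weights \<sigma>" "x = bary c" and d: "d \<in> weights \<tau>" "x = bary d"
        unfolding convex_hull_weights[OF fin(1)] convex_hull_weights[OF fin(2)] by blast
      then have "c = d" using w[OF s(1,2)] w[OF s(3,4)] inj by (auto dest: inj_onD)
      then have "c \<in> weights (\<sigma> \<inter> \<tau>)" using c d by (auto simp: weights_def)
      then show "x \<in> convex hull (\<sigma> \<inter> \<tau>)" using c(2) convex_hull_weights[of "\<sigma> \<inter> \<tau>"] fin by blast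
    qed
  qed
  have "\<not> affine_dependent \<sigma>" if "\<sigma> \<in> K" for \<sigma>
  proof
    assume dep: "affine_dependent \<sigma>"
    obtain M P where MP: "M \<inter> P = {}" "M \<union> P = \<sigma>" "convex hull M \<inter> convex hull P \<noteq> {}"
      using Radon_partition[OF K'(3)[OF \<open>\<sigma> \<in> K\<close>] dep] by blast
    then show False using int[of M \<sigma> P \<sigma>] \<open>\<sigma> \<in> K\<close> by auto
  qed
  then show ?thesis unfolding geometric_complex_def using K int by blast
qed

subsection \<open>Affine images of complexes\<close>

lemma affine_map_on_subset: "affine_map_on T f \<Longrightarrow> S \<subseteq> T \<Longrightarrow> affine_map_on S f"
  unfolding affine_map_on_def by blast

lemma affine_image_convex_hull:
  assumes f: "affine_map_on (convex hull \<sigma>) f"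
  shows "f ` (convex hull \<sigma>) = convex hull (f ` \<sigma>)"
proof
  have cv: "f ((1 - u) *\<^sub>R x + u *\<^sub>R y) = (1 - u) *\<^sub>R f x + u *\<^sub>R f y"
    "(1 - u) *\<^sub>R x + u *\<^sub>R y \<in> convex hull \<sigma>"
    if "x \<in> convex hull \<sigma>" "y \<in> convex hull \<sigma>" "0 \<le> u" "u \<le> 1" for x y u
    using f that convexD_alt[OF convex_convex_hull, of x \<sigma> y u] by (auto simp: affine_map_on_def)
  have "convex (f ` (convex hull \<sigma>))"
  proof (rule iffD2[OF convex_alt], intro ballI allI impI)
    fix p q u assume p: "p \<in> f ` (convex hull \<sigma>)" and q: "q \<in> f ` (convex hull \<sigma>)" and u: "(0::real) \<le> u \<and> u \<le> 1"
    obtain x y where xy: "x \<in> convex hull \<sigma>" "y \<in> convex hull \<sigma>" "p = f x" "q = f y" using p q by blast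
    show "(1 - u) *\<^sub>R p + u *\<^sub>R q \<in> f ` (convex hull \<sigma>)"
      by (rule image_eqI[OF _ cv(2)[OF xy(1,2), of u]]) (use cv(1)[OF xy(1,2), of u] xy u in auto)
  qed
  then show "convex hull (f ` \<sigma>) \<subseteq> f ` (convex hull \<sigma>)"
    by (intro hull_minimal) (auto intro: hull_inc)
  have "convex {x \<in> convex hull \<sigma>. f x \<in> convex hull (f ` \<sigma>)}"
  proof (rule iffD2[OF convex_alt], intro ballI allI impI)
    fix x y u assume "x \<in> {x \<in> convex hull \<sigma>. f x \<in> convex hull (f ` \<sigma>)}"
      "y \<in> {x \<in> convex hull \<sigma>. f x \<in> convex hull (f ` \<sigma>)}" "(0::real) \<le> u \<and> u \<le> 1"
    then show "(1 - u) *\<^sub>R x + u *\<^sub>R y \<in> {x \<in> convex hull \<sigma>. f x \<in> convex hull (f ` \<sigma>)}"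
      using cv[of x y u] convexD_alt[OF convex_convex_hull, of "f x" "f ` \<sigma>" "f y" u] by auto
  qed
  then have "convex hull \<sigma> \<subseteq> {x \<in> convex hull \<sigma>. f x \<in> convex hull (f ` \<sigma>)}"
    by (intro hull_minimal) (auto intro: hull_inc)
  then show "f ` (convex hull \<sigma>) \<subseteq> convex hull (f ` \<sigma>)" by blast
qed

lemma hull_subset_underlying_space: "\<sigma> \<in> K \<Longrightarrow> convex hull \<sigma> \<subseteq> underlying_space K"
  by (auto simp: underlying_space_def)

lemma geometric_complex_image:
  assumes K: "geometric_complex K" and inj: "inj_on f (underlying_space K)"
    and aff: "\<And>\<sigma>. \<sigma> \<in> K \<Longrightarrow> affine_map_on (convex hull \<sigma>) f"
  shows "geometric_complex ((`) f ` K)" "underlying_space ((`) f ` K) = f ` underlying_space K"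
proof -
  note K' = geometric_complexD[OF K]
  have hull: "convex hull (f ` \<sigma>) = f ` (convex hull \<sigma>)" if "\<sigma> \<in> K" for \<sigma>
    using affine_image_convex_hull[OF aff[OF that]] by simp
  show "underlying_space ((`) f ` K) = f ` underlying_space K"
    using hull by (auto simp: underlying_space_def)
  have abs: "abstract_complex ((`) f ` K)"
    unfolding abstract_complex_def
  proof (intro conjI ballI allI impI)
    show "finite ((`) f ` K)" using abstract_complexD(1)[OF K'(1)] by simp
    show "{} \<in> (`) f ` K" using abstract_complexD(2)[OF K'(1)] by force
    show "finite \<rho>" if "\<rho> \<in> (`) f ` K" for \<rho> using that K'(2) by auto
    show "\<tau> \<in> (`) f ` K" if "\<rho> \<in> (`) f ` K" "\<tau> \<subseteq> \<rho>" for \<rho> \<tau>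
    proof -
      obtain \<sigma> where \<sigma>: "\<sigma> \<in> K" "\<rho> = f ` \<sigma>" using \<open>\<rho> \<in> (`) f ` K\<close> by blast
      then obtain \<sigma>' where "\<sigma>' \<subseteq> \<sigma>" "\<tau> = f ` \<sigma>'" using \<open>\<tau> \<subseteq> \<rho>\<close> subset_image_iff[of \<tau> f \<sigma>] by blast
      then show ?thesis using K'(5)[OF \<sigma>(1)] by blast
    qed
  qed
  have int: "convex hull (f ` \<sigma>) \<inter> convex hull (f ` \<tau>) = convex hull (f ` (\<sigma> \<inter> \<tau>))"
    if s: "\<sigma> \<in> K" "\<tau> \<in> K" for \<sigma> \<tau>
  proof -
    have "\<sigma> \<inter> \<tau> \<in> K" using K'(5)[OF s(1)] by blast
    moreover have "f ` (convex hull \<sigma>) \<inter> f ` (convex hull \<tau>) = f ` (convex hull \<sigma> \<inter> convex hull \<tau>)"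
      by (rule inj_on_image_Int[OF inj, symmetric]) (use s in \<open>simp_all add: hull_subset_underlying_space\<close>)
    ultimately show ?thesis using s hull K'(4)[OF s] by simp
  qed
  have "\<not> affine_dependent (f ` \<sigma>)" if s: "\<sigma> \<in> K" for \<sigma>
  proof
    assume "affine_dependent (f ` \<sigma>)"
    then obtain M P where MP: "M \<inter> P = {}" "M \<union> P = f ` \<sigma>" "convex hull M \<inter> convex hull P \<noteq> {}"
      using Radon_partition[of "f ` \<sigma>"] K'(2)[OF s] by blast
    have "M \<subseteq> f ` \<sigma>" "P \<subseteq> f ` \<sigma>" using MP(2) by auto
    then obtain M' P' where MP': "M' \<subseteq> \<sigma>" "M = f ` M'" "P' \<subseteq> \<sigma>" "P = f ` P'"
      unfolding subset_image_iff by blast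
    then have "M' \<inter> P' = {}" using MP(1) by blast
    then have "convex hull M \<inter> convex hull P = {}"
      using int[OF K'(5)[OF s MP'(1)] K'(5)[OF s MP'(3)]] MP' by simp
    then show False using MP(3) by blast
  qed
  moreover have "f ` (\<sigma> \<inter> \<tau>) = f ` \<sigma> \<inter> f ` \<tau>" if "\<sigma> \<in> K" "\<tau> \<in> K" for \<sigma> \<tau>
    by (rule inj_on_image_Int[OF inj]) (use that hull_subset_underlying_space hull_subset[of \<sigma> convex] hull_subset[of \<tau> convex] in blast)+
  ultimately show "geometric_complex ((`) f ` K)"
    unfolding geometric_complex_def using abs int by auto
qed

subsection \<open>Subdividing edges\<close>

lemma is_subdivision_refl: "geometric_complex K \<Longrightarrow> is_subdivision K K"
  by (auto simp: is_subdivision_def)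

lemma is_subdivision_trans:
  assumes "is_subdivision K L" "is_subdivision L M" shows "is_subdivision K M"
  unfolding is_subdivision_def
proof (intro conjI ballI)
  show "geometric_complex K" "underlying_space K = underlying_space M"
    using assms by (auto simp: is_subdivision_def)
  fix \<sigma> assume "\<sigma> \<in> K"
  then obtain \<tau> where \<tau>: "\<tau> \<in> L" "convex hull \<sigma> \<subseteq> convex hull \<tau>" using assms(1) by (auto simp: is_subdivision_def)
  then obtain \<rho> where "\<rho> \<in> M" "convex hull \<tau> \<subseteq> convex hull \<rho>" using assms(2) by (auto simp: is_subdivision_def)
  then show "\<exists>\<tau>\<in>M. convex hull \<sigma> \<subseteq> convex hull \<tau>" using \<tau> by blast
qed

definition edge_subdivision :: "'v set set \<Rightarrow> 'v \<Rightarrow> 'v \<Rightarrow> 'v \<Rightarrow> 'v set set" where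
  "edge_subdivision K u v w = {\<sigma> \<in> K. \<not> {u, v} \<subseteq> \<sigma>} \<union> insert w ` {\<tau>. \<tau> \<union> {u, v} \<in> K \<and> \<not> {u, v} \<subseteq> \<tau>}"

lemma edge_subdivision_covers:
  fixes \<sigma> :: "'v::real_vector set"
  assumes \<sigma>: "finite \<sigma>" "u \<in> \<sigma>" "v \<in> \<sigma>" "u \<noteq> v" "w \<notin> \<sigma>"
    and s: "0 < s" "s < 1" "w = (1 - s) *\<^sub>R u + s *\<^sub>R v"
    and c: "c \<in> weights \<sigma>" "c u * s \<le> c v * (1 - s)"
  shows "bary c \<in> convex hull (insert w (\<sigma> - {u}))"
proof -
  define m where "m = c u / (1 - s)"
  have m: "(1 - s) * m = c u" using s by (simp add: m_def)
  let ?T = "insert w (\<sigma> - {u})"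
  define d where "d y = (if y = w then m else c y - (if y = v then s * m else 0))" for y
  have pos: "0 \<le> c y" for y using c(1) by (simp add: weights_def)
  have m0: "0 \<le> m" "s * m \<le> c v" using pos[of u] c(2) s by (simp_all add: m_def field_simps)
  have cs: "sum c \<sigma> = 1" "bary c = (\<Sum>y\<in>\<sigma>. c y *\<^sub>R y)"
    using c(1) sum_supp[OF \<sigma>(1), of c] by (auto simp: weights_def)
  have "0 \<le> d y" for y
    using pos[of y] m0 by (auto simp: d_def)
  moreover have "sum d ?T = 1"
  proof -
    have "sum d ?T = m + sum d (\<sigma> - {u})" using \<sigma> by (simp add: d_def)
    also have "sum d (\<sigma> - {u}) = (\<Sum>y\<in>\<sigma> - {u}. c y - (if y = v then s * m else 0))"
      using \<sigma>(5) by (intro sum.cong) (auto simp: d_def)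
    also have "\<dots> = sum c (\<sigma> - {u}) - s * m"
      using \<sigma> by (simp add: sum_subtractf)
    also have "sum c (\<sigma> - {u}) = 1 - c u" using \<sigma> cs by (simp add: sum_diff1)
    finally show ?thesis using m by (simp add: algebra_simps)
  qed
  moreover have "(\<Sum>y\<in>?T. d y *\<^sub>R y) = bary c"
  proof -
    have "(\<Sum>y\<in>?T. d y *\<^sub>R y) = m *\<^sub>R w + (\<Sum>y\<in>\<sigma> - {u}. d y *\<^sub>R y)" using \<sigma> by (simp add: d_def)
    also have "(\<Sum>y\<in>\<sigma> - {u}. d y *\<^sub>R y) = (\<Sum>y\<in>\<sigma> - {u}. c y *\<^sub>R y - (if y = v then (s * m) *\<^sub>R v else 0))"
      using \<sigma>(5) by (intro sum.cong) (auto simp: d_def scaleR_diff_left)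
    also have "\<dots> = (\<Sum>y\<in>\<sigma> - {u}. c y *\<^sub>R y) - (s * m) *\<^sub>R v"
      using \<sigma> by (simp add: sum_subtractf)
    also have "(\<Sum>y\<in>\<sigma> - {u}. c y *\<^sub>R y) = bary c - c u *\<^sub>R u" using \<sigma> cs by (simp add: sum_diff1)
    also have "m *\<^sub>R w = c u *\<^sub>R u + (s * m) *\<^sub>R v"
      unfolding s(3) m[symmetric] by (simp add: scaleR_add_right mult.commute)
    finally show ?thesis by simp
  qed
  ultimately show ?thesis
    using \<sigma>(1) by (subst convex_hull_finite) auto
qed

lemma is_subdivision_edge_subdivision:
  fixes K :: "'v::real_vector set set"
  assumes K: "geometric_complex K" and uv: "{u, v} \<in> K" "u \<noteq> v"
    and s: "0 < s" "s < 1" and w: "w = (1 - s) *\<^sub>R u + s *\<^sub>R v"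
  shows "is_subdivision (edge_subdivision K u v w) K"
proof -
  note K' = geometric_complexD[OF K]
  let ?L = "edge_subdivision K u v w"
  have wh: "w \<in> convex hull {u, v}"
    using s unfolding convex_hull_2 w by (intro CollectI exI[of _ "1 - s"] exI[of _ s]) auto
  have wuv: "w \<noteq> u" "w \<noteq> v"
  proof -
    have "w - u = s *\<^sub>R (v - u)" "w - v = (1 - s) *\<^sub>R (u - v)" unfolding w by (simp_all add: algebra_simps)
    then show "w \<noteq> u" "w \<noteq> v" using s uv(2) by auto
  qed
  have wK: "w \<notin> \<sigma>" if "\<sigma> \<in> K" for \<sigma>
  proof
    assume "w \<in> \<sigma>"
    then have "{w} \<in> K" using K'(5)[OF that] by blast
    then have "convex hull {w} \<inter> convex hull {u, v} = convex hull ({w} \<inter> {u, v})" using K'(4) uv(1) by blast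
    also have "{w} \<inter> {u, v} = {}" using wuv by blast
    finally show False using wh by simp
  qed
  have abs: "abstract_complex ?L"
    unfolding abstract_complex_def
  proof (intro conjI ballI allI impI)
    have "{\<tau>. \<tau> \<union> {u, v} \<in> K \<and> \<not> {u, v} \<subseteq> \<tau>} \<subseteq> K"
    proof
      fix \<tau> assume "\<tau> \<in> {\<tau>. \<tau> \<union> {u, v} \<in> K \<and> \<not> {u, v} \<subseteq> \<tau>}"
      then show "\<tau> \<in> K" using K'(5)[of "\<tau> \<union> {u, v}" \<tau>] by blast
    qed
    then show "finite ?L" unfolding edge_subdivision_def using abstract_complexD(1)[OF K'(1)] by (auto intro: finite_subset)
    show "{} \<in> ?L" using abstract_complexD(2)[OF K'(1)] by (simp add: edge_subdivision_def)
    show "finite \<sigma>" if "\<sigma> \<in> ?L" for \<sigma>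
    proof -
      have "finite \<tau>" if "\<tau> \<union> {u, v} \<in> K" for \<tau> using K'(2)[OF that] by simp
      then show ?thesis using that K'(2) by (auto simp: edge_subdivision_def)
    qed
    show "\<rho> \<in> ?L" if "\<sigma> \<in> ?L" "\<rho> \<subseteq> \<sigma>" for \<sigma> \<rho>
      using that(1) unfolding edge_subdivision_def
    proof
      assume "\<sigma> \<in> {\<sigma> \<in> K. \<not> {u, v} \<subseteq> \<sigma>}"
      then show "\<rho> \<in> {\<sigma> \<in> K. \<not> {u, v} \<subseteq> \<sigma>} \<union> insert w ` {\<tau>. \<tau> \<union> {u, v} \<in> K \<and> \<not> {u, v} \<subseteq> \<tau>}"
        using K'(5)[of \<sigma> \<rho>] that(2) by auto
    next
      assume "\<sigma> \<in> insert w ` {\<tau>. \<tau> \<union> {u, v} \<in> K \<and> \<not> {u, v} \<subseteq> \<tau>}"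
      then obtain \<tau> where \<tau>: "\<sigma> = insert w \<tau>" "\<tau> \<union> {u, v} \<in> K" "\<not> {u, v} \<subseteq> \<tau>" by blast
      have "\<rho> - {w} \<subseteq> \<tau>" using that(2) \<tau>(1) by blast
      then have "\<rho> - {w} \<subseteq> \<tau> \<union> {u, v}" "(\<rho> - {w}) \<union> {u, v} \<subseteq> \<tau> \<union> {u, v}" by blast+
      then have "\<rho> - {w} \<in> K" "(\<rho> - {w}) \<union> {u, v} \<in> K" using K'(5)[OF \<tau>(2)] by blast+
      moreover have "\<not> {u, v} \<subseteq> \<rho> - {w}" using \<tau>(3) \<open>\<rho> - {w} \<subseteq> \<tau>\<close> by blast
      moreover have "\<rho> = insert w (\<rho> - {w}) \<or> \<rho> = \<rho> - {w}" by blast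
      ultimately show "\<rho> \<in> {\<sigma> \<in> K. \<not> {u, v} \<subseteq> \<sigma>} \<union> insert w ` {\<tau>. \<tau> \<union> {u, v} \<in> K \<and> \<not> {u, v} \<subseteq> \<tau>}"
        by (metis (mono_tags, lifting) UnCI imageI mem_Collect_eq)
    qed
  qed
  \<comment> \<open>A point of the subdivision has weights in \<open>K\<close> obtained by spreading the weight of \<open>w\<close>
    over \<open>u\<close> and \<open>v\<close>; as one of \<open>u\<close>, \<open>v\<close> had weight 0 before, the weight of \<open>w\<close> can be recovered.\<close>
  define T where "T c x = (if x = w then 0 else c x) + (if x = u then (1 - s) * c w else 0) + (if x = v then s * c w else 0)"
    for c :: "'v \<Rightarrow> real" and x
  have T: "T c \<in> complex_weights K \<and> bary (T c) = bary c \<and> (c u = 0 \<or> c v = 0)" if c: "c \<in> complex_weights ?L" for c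
  proof -
    have pos: "0 \<le> c x" for x using c by (simp add: complex_weights_def)
    have sL: "supp c \<in> ?L" and sc: "sum c (supp c) = 1" using c by (auto simp: complex_weights_def)
    have fc: "finite (supp c)" using abstract_complexD(3)[OF abs sL] .
    let ?Z = "supp c \<union> {u, v, w}"
    have fZ: "finite ?Z" using fc by simp
    have "supp c \<subseteq> ?Z" by blast
    note cZ = sum_supp[OF fZ this]
    have Tpos: "0 \<le> T c x" for x using pos s by (simp add: T_def)
    have sT: "supp (T c) \<subseteq> ?Z" by (auto simp: supp_def T_def)
    have e: "T c x = (c x - (if x = w then c w else 0)) + (if x = u then (1 - s) * c w else 0) + (if x = v then s * c w else 0)" for x
      by (auto simp: T_def)
    have "sum (T c) ?Z = (sum c ?Z - c w) + (1 - s) * c w + s * c w"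
      unfolding e sum.distrib sum_subtractf using fZ by (simp add: sum.delta)
    also have "\<dots> = 1" using cZ(1) sc by (simp add: algebra_simps)
    finally have 1: "sum (T c) (supp (T c)) = 1" using sum_supp(1)[OF fZ sT] by simp
    have e': "T c x *\<^sub>R x = (c x *\<^sub>R x - (if x = w then c w *\<^sub>R w else 0)) + (if x = u then ((1 - s) * c w) *\<^sub>R u else 0)
        + (if x = v then (s * c w) *\<^sub>R v else 0)" for x
      by (auto simp: T_def scaleR_add_left)
    have "(\<Sum>x\<in>?Z. T c x *\<^sub>R x) = ((\<Sum>x\<in>?Z. c x *\<^sub>R x) - c w *\<^sub>R w) + ((1 - s) * c w) *\<^sub>R u + (s * c w) *\<^sub>R v"
      unfolding e' sum.distrib sum_subtractf using fZ by (simp add: sum.delta)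
    also have "\<dots> = (\<Sum>x\<in>?Z. c x *\<^sub>R x)" unfolding w by (simp add: scaleR_add_right mult.commute)
    finally have 2: "bary (T c) = bary c" using sum_supp(2)[OF fZ sT] cZ(2) by simp
    have 3: "c u = 0 \<or> c v = 0"
    proof (rule ccontr)
      assume "\<not> ?thesis"
      then have "{u, v} \<subseteq> supp c" by (auto simp: supp_def)
      then show False using sL wuv by (auto simp: edge_subdivision_def)
    qed
    have "supp (T c) \<in> K"
    proof (cases "c w = 0")
      case True
      then have "supp (T c) = supp c" by (auto simp: supp_def T_def)
      moreover have "w \<notin> supp c" using True by (simp add: supp_def)
      ultimately show ?thesis using sL by (auto simp: edge_subdivision_def)
    next
      case False
      then have "w \<in> supp c" by (simp add: supp_def)
      then obtain \<tau> where \<tau>: "supp c = insert w \<tau>" "\<tau> \<union> {u, v} \<in> K"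
        using sL wK by (auto simp: edge_subdivision_def)
      have "supp (T c) \<subseteq> \<tau> \<union> {u, v}"
      proof
        fix x assume "x \<in> supp (T c)"
        then show "x \<in> \<tau> \<union> {u, v}" using \<tau>(1) wuv by (auto simp: supp_def T_def split: if_splits)
      qed
      then show ?thesis using K'(5)[OF \<tau>(2)] by blast
    qed
    then show ?thesis using 1 2 3 Tpos by (simp add: complex_weights_def)
  qed
  have "inj_on bary (complex_weights ?L)"
  proof (rule inj_onI)
    fix c d assume c: "c \<in> complex_weights ?L" and d: "d \<in> complex_weights ?L" and eq: "bary c = bary d"
    have "T c = T d" by (rule inj_onD[OF inj_on_bary[OF K]]) (use T[OF c] T[OF d] eq in simp_all)
    then have eq: "T c x = T d x" for x by simp
    have rec: "b w = min (T b u / (1 - s)) (T b v / s)" if b: "b \<in> complex_weights ?L" for b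
    proof -
      have "0 \<le> b x" for x using b by (simp add: complex_weights_def)
      note pos = this[of u] this[of v]
      have "T b u = b u + (1 - s) * b w" "T b v = b v + s * b w" using wuv uv(2) by (auto simp: T_def)
      then have "T b u / (1 - s) = b u / (1 - s) + b w" "T b v / s = b v / s + b w"
        using s by (simp_all add: add_divide_distrib)
      moreover have "0 \<le> b u / (1 - s)" "0 \<le> b v / s" using pos s by simp_all
      ultimately show ?thesis using T[OF b] by auto
    qed
    have "c w = d w" using rec[OF c] rec[OF d] eq by simp
    then have "c x = d x" for x using eq[of x] by (cases "x = w") (auto simp: T_def split: if_splits)
    then show "c = d" by blast
  qed
  then have geo: "geometric_complex ?L" by (rule geometric_complexI[OF abs])
  have sub: "\<exists>\<tau>\<in>K. convex hull \<sigma> \<subseteq> convex hull \<tau>" if "\<sigma> \<in> ?L" for \<sigma>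
    using that unfolding edge_subdivision_def
  proof
    assume "\<sigma> \<in> insert w ` {\<tau>. \<tau> \<union> {u, v} \<in> K \<and> \<not> {u, v} \<subseteq> \<tau>}"
    then obtain \<tau> where \<tau>: "\<sigma> = insert w \<tau>" "\<tau> \<union> {u, v} \<in> K" by blast
    have "w \<in> convex hull (\<tau> \<union> {u, v})" using wh hull_mono[of "{u, v}" "\<tau> \<union> {u, v}" convex] by blast
    then have "\<sigma> \<subseteq> convex hull (\<tau> \<union> {u, v})" using \<tau>(1) hull_subset[of "\<tau> \<union> {u, v}" convex] by blast
    then show ?thesis using \<tau>(2) by (intro bexI[of _ "\<tau> \<union> {u, v}"]) (simp_all add: hull_minimal)
  qed blast
  have "underlying_space ?L = underlying_space K"
  proof
    show "underlying_space ?L \<subseteq> underlying_space K" using sub by (fastforce simp: underlying_space_def)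
    show "underlying_space K \<subseteq> underlying_space ?L"
    proof
      fix x assume "x \<in> underlying_space K"
      then obtain \<sigma> where \<sigma>: "\<sigma> \<in> K" "x \<in> convex hull \<sigma>" by (auto simp: underlying_space_def)
      show "x \<in> underlying_space ?L"
      proof (cases "{u, v} \<subseteq> \<sigma>")
        case False
        then have "\<sigma> \<in> ?L" using \<sigma> by (simp add: edge_subdivision_def)
        then show ?thesis using \<sigma> by (auto simp: underlying_space_def)
      next
        case True
        note f = K'(2)[OF \<sigma>(1)]
        obtain c where c: "c \<in> weights \<sigma>" "x = bary c" using \<sigma>(2) convex_hull_weights[OF f] by blast
        have mem: "insert w (\<sigma> - {y}) \<in> ?L" if "y \<in> {u, v}" for y
        proof -
          have "(\<sigma> - {y}) \<union> {u, v} = \<sigma>" "\<not> {u, v} \<subseteq> \<sigma> - {y}" using that True by auto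
          then show ?thesis
            unfolding edge_subdivision_def using \<sigma>(1) by (intro UnI2 imageI CollectI conjI) simp_all
        qed
        have w': "w = (1 - (1 - s)) *\<^sub>R v + (1 - s) *\<^sub>R u" using w by (simp add: add.commute)
        consider "c u * s \<le> c v * (1 - s)" | "c v * (1 - s) \<le> c u * (1 - (1 - s))" by (cases "c u * s \<le> c v * (1 - s)") auto
        then show ?thesis
        proof cases
          case 1
          then have "x \<in> convex hull (insert w (\<sigma> - {u}))"
            unfolding c(2) using True uv(2) wK[OF \<sigma>(1)] s w c(1) by (intro edge_subdivision_covers[OF f]) auto
          then show ?thesis using mem[of u] by (auto simp: underlying_space_def)
        next
          case 2
          have "x \<in> convex hull (insert w (\<sigma> - {v}))"
            unfolding c(2) by (rule edge_subdivision_covers[OF f _ _ _ wK[OF \<sigma>(1)] _ _ w' c(1) 2]) (use True uv(2) s in auto)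
          then show ?thesis using mem[of v] by (auto simp: underlying_space_def)
        qed
      qed
    qed
  qed
  then show ?thesis using geo sub by (simp add: is_subdivision_def)
qed

subsection \<open>Cutting a complex by hyperplanes\<close>

lemma psubset_of_Diff_singleton: "A \<subseteq> B - {e} \<Longrightarrow> e \<in> B \<Longrightarrow> A \<subset> B"
  by blast

lemma subdivision_cut:
  fixes K :: "'v::real_vector set set" and h :: "'v \<Rightarrow> real"
  assumes "geometric_complex K" and h: "linear h"
  shows "\<exists>L. is_subdivision L K \<and> (\<forall>\<sigma>\<in>L. (\<forall>x\<in>\<sigma>. 0 \<le> h x) \<or> (\<forall>x\<in>\<sigma>. h x \<le> 0))"
  using assms(1)
proof (induction "card {e \<in> K. \<exists>u v. e = {u, v} \<and> h u < 0 \<and> 0 < h v}" arbitrary: K rule: less_induct)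
  case less
  note K' = geometric_complexD[OF less.prems]
  let ?bad = "\<lambda>K. {e \<in> K. \<exists>u v. e = {u, v} \<and> h u < 0 \<and> 0 < h v}"
  show ?case
  proof (cases "?bad K = {}")
    case True
    have "(\<forall>x\<in>\<sigma>. 0 \<le> h x) \<or> (\<forall>x\<in>\<sigma>. h x \<le> 0)" if "\<sigma> \<in> K" for \<sigma>
    proof (rule ccontr)
      assume "\<not> ?thesis"
      then obtain x y where xy: "x \<in> \<sigma>" "y \<in> \<sigma>" "h x < 0" "0 < h y" by (auto simp: not_le)
      then have "{x, y} \<in> K" using K'(5)[OF that, of "{x, y}"] by simp
      then show False using True xy by blast
    qed
    then show ?thesis using is_subdivision_refl[OF less.prems] by blast
  next
    case False
    then obtain u v where uv: "{u, v} \<in> K" "h u < 0" "0 < h v" by blast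
    define s where "s = - h u / (h v - h u)"
    define w where "w = (1 - s) *\<^sub>R u + s *\<^sub>R v"
    have s: "0 < s" "s < 1" using uv by (auto simp: s_def field_simps)
    have "h w = (1 - s) * h u + s * h v"
      using h by (simp add: w_def linear_add linear_scale)
    also have "\<dots> = h u + s * (h v - h u)" by (simp add: algebra_simps)
    also have "\<dots> = 0" using uv by (simp add: s_def)
    finally have hw: "h w = 0" .
    let ?L = "edge_subdivision K u v w"
    have L: "is_subdivision ?L K"
      using is_subdivision_edge_subdivision[OF less.prems uv(1) _ s w_def] uv by force
    have "?bad ?L \<subseteq> ?bad K - {{u, v}}"
    proof
      fix e assume "e \<in> ?bad ?L"
      then obtain x y where e: "e = {x, y}" "h x < 0" "0 < h y" "e \<in> ?L" by blast
      then have "w \<notin> e" using hw by auto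
      then have "e \<in> K" "\<not> {u, v} \<subseteq> e" using e(4) by (auto simp: edge_subdivision_def)
      then show "e \<in> ?bad K - {{u, v}}" using e by blast
    qed
    moreover have "{u, v} \<in> ?bad K" using uv by blast
    ultimately have "?bad ?L \<subset> ?bad K" by (rule psubset_of_Diff_singleton)
    moreover have "finite (?bad K)" using abstract_complexD(1)[OF K'(1)] by simp
    ultimately have "card (?bad ?L) < card (?bad K)" by (intro psubset_card_mono)
    then obtain M where M: "is_subdivision M ?L" "\<forall>\<sigma>\<in>M. (\<forall>x\<in>\<sigma>. 0 \<le> h x) \<or> (\<forall>x\<in>\<sigma>. h x \<le> 0)"
      using less.hyps[of ?L] L by (auto simp: is_subdivision_def)
    then show ?thesis using is_subdivision_trans[OF M(1) L] by blast
  qed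
qed

lemma convex_hull_sign:
  assumes h: "linear (h :: 'v::real_vector \<Rightarrow> real)"
  shows "(\<forall>x\<in>\<sigma>. 0 \<le> h x) \<Longrightarrow> (\<forall>x\<in>convex hull \<sigma>. 0 \<le> h x)" "(\<forall>x\<in>\<sigma>. h x \<le> 0) \<Longrightarrow> (\<forall>x\<in>convex hull \<sigma>. h x \<le> 0)"
proof -
  have "convex (h -` {0..})" "convex (h -` {..0})" using h by (auto intro: convex_linear_vimage)
  then show "(\<forall>x\<in>\<sigma>. 0 \<le> h x) \<Longrightarrow> (\<forall>x\<in>convex hull \<sigma>. 0 \<le> h x)" "(\<forall>x\<in>\<sigma>. h x \<le> 0) \<Longrightarrow> (\<forall>x\<in>convex hull \<sigma>. h x \<le> 0)"
    using hull_minimal[of \<sigma> "h -` {0..}" convex] hull_minimal[of \<sigma> "h -` {..0}" convex] by auto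
qed

lemma subdivision_cut_many:
  fixes K :: "'v::real_vector set set"
  assumes K: "geometric_complex K" and "finite H" "\<And>h. h \<in> H \<Longrightarrow> linear h"
  shows "\<exists>L. is_subdivision L K \<and>
    (\<forall>h\<in>H. \<forall>\<sigma>\<in>L. (\<forall>x\<in>convex hull \<sigma>. 0 \<le> h x) \<or> (\<forall>x\<in>convex hull \<sigma>. h x \<le> (0::real)))"
  using assms(2,3)
proof (induction H rule: finite_induct)
  case empty
  then show ?case using is_subdivision_refl[OF K] by blast
next
  case (insert h H)
  then obtain L where L: "is_subdivision L K"
    "\<forall>h\<in>H. \<forall>\<sigma>\<in>L. (\<forall>x\<in>convex hull \<sigma>. 0 \<le> h x) \<or> (\<forall>x\<in>convex hull \<sigma>. h x \<le> 0)" by auto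
  then obtain M where M: "is_subdivision M L" "\<forall>\<sigma>\<in>M. (\<forall>x\<in>\<sigma>. 0 \<le> h x) \<or> (\<forall>x\<in>\<sigma>. h x \<le> 0)"
    using subdivision_cut[of L h] insert.prems by (auto simp: is_subdivision_def)
  have "(\<forall>x\<in>convex hull \<sigma>. 0 \<le> g x) \<or> (\<forall>x\<in>convex hull \<sigma>. g x \<le> 0)" if g: "g \<in> insert h H" and \<sigma>: "\<sigma> \<in> M" for g \<sigma>
  proof (cases "g = h")
    case True
    then show ?thesis using M(2) \<sigma> convex_hull_sign[of h \<sigma>] insert.prems by blast
  next
    case False
    then have "g \<in> H" using g by simp
    moreover obtain \<tau> where "\<tau> \<in> L" "convex hull \<sigma> \<subseteq> convex hull \<tau>" using M(1) \<sigma> by (auto simp: is_subdivision_def)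
    ultimately show ?thesis using L(2) by blast
  qed
  then show ?case using is_subdivision_trans[OF M(1) L(1)] by blast
qed

subsection \<open>Composing piecewise linear homeomorphisms\<close>

definition PL_equiv :: "'v::real_normed_vector set set \<Rightarrow> 'w::real_normed_vector set set \<Rightarrow> bool" where
  "PL_equiv K0 L0 \<longleftrightarrow> (\<exists>f g K. homeomorphism (underlying_space K0) (underlying_space L0) f g \<and>
     is_subdivision K K0 \<and> (\<forall>\<sigma>\<in>K. affine_map_on (convex hull \<sigma>) f) \<and> is_subdivision ((`) f ` K) L0)"

lemma PL_equivI:
  assumes "homeomorphism (underlying_space K0) (underlying_space L0) f g" "is_subdivision K K0"
    "\<And>\<sigma>. \<sigma> \<in> K \<Longrightarrow> affine_map_on (convex hull \<sigma>) f" "is_subdivision ((`) f ` K) L0"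
  shows "PL_equiv K0 L0"
  unfolding PL_equiv_def using assms by blast

lemma PL_equiv_refl: "geometric_complex K \<Longrightarrow> PL_equiv K K"
  unfolding PL_equiv_def
  by (intro exI[of _ id] exI[of _ K]) (auto simp: homeomorphism_def affine_map_on_def is_subdivision_refl)

lemma affine_map_on_inverse:
  assumes f: "affine_map_on (convex hull \<sigma>) f" and g: "\<And>x. x \<in> convex hull \<sigma> \<Longrightarrow> g (f x) = x"
  shows "affine_map_on (convex hull (f ` \<sigma>)) g"
  unfolding affine_map_on_def affine_image_convex_hull[OF f, symmetric]
proof (intro ballI)
  fix p q u assume "p \<in> f ` (convex hull \<sigma>)" "q \<in> f ` (convex hull \<sigma>)" and u: "u \<in> {0..1::real}"
  then obtain x y where xy: "x \<in> convex hull \<sigma>" "y \<in> convex hull \<sigma>" "p = f x" "q = f y" by blast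
  have "(1 - u) *\<^sub>R x + u *\<^sub>R y \<in> convex hull \<sigma>"
    using xy u by (intro convexD_alt[OF convex_convex_hull]) auto
  then have "g (f ((1 - u) *\<^sub>R x + u *\<^sub>R y)) = (1 - u) *\<^sub>R x + u *\<^sub>R y" by (rule g)
  moreover have "f ((1 - u) *\<^sub>R x + u *\<^sub>R y) = (1 - u) *\<^sub>R p + u *\<^sub>R q"
    using f xy u by (auto simp: affine_map_on_def)
  ultimately show "g ((1 - u) *\<^sub>R p + u *\<^sub>R q) = (1 - u) *\<^sub>R g p + u *\<^sub>R g q" using g xy by simp
qed

lemma affine_map_on_compose:
  assumes f: "affine_map_on S f" and S: "f ` S = T" and g: "affine_map_on T g"
  shows "affine_map_on S (g \<circ> f)"
  unfolding affine_map_on_def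
proof (intro ballI)
  fix x y u assume xy: "x \<in> S" "y \<in> S" and u: "u \<in> {0..1::real}"
  have "f ((1 - u) *\<^sub>R x + u *\<^sub>R y) = (1 - u) *\<^sub>R f x + u *\<^sub>R f y"
    using f xy u unfolding affine_map_on_def by blast
  moreover have "f x \<in> T" "f y \<in> T" using S xy by blast+
  ultimately show "(g \<circ> f) ((1 - u) *\<^sub>R x + u *\<^sub>R y) = (1 - u) *\<^sub>R (g \<circ> f) x + u *\<^sub>R (g \<circ> f) y"
    using g u unfolding affine_map_on_def by simp
qed

lemma PL_equiv_inverse_affine:
  assumes "homeomorphism (underlying_space K0) (underlying_space L0) f g" "is_subdivision K K0"
    "\<forall>\<sigma>\<in>K. affine_map_on (convex hull \<sigma>) f" "\<sigma> \<in> K"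
  shows "affine_map_on (convex hull (f ` \<sigma>)) g"
proof (rule affine_map_on_inverse)
  show "g (f x) = x" if "x \<in> convex hull \<sigma>" for x
  proof -
    have "x \<in> underlying_space K0"
      using that assms(2,4) hull_subset_underlying_space[of \<sigma> K] by (auto simp: is_subdivision_def)
    then show ?thesis using assms(1) by (simp add: homeomorphism_def)
  qed
qed (use assms in blast)

lemma PL_equiv_step:
  fixes K0 :: "'v::real_normed_vector set set" and L0 M0 :: "'w::real_normed_vector set set"
  assumes KL: "PL_equiv K0 L0" and hom: "homeomorphism (underlying_space L0) (underlying_space M0) \<phi> \<psi>"
    and H: "finite H" "\<And>h. h \<in> H \<Longrightarrow> linear h"
    and cell: "\<And>\<sigma> \<tau>. \<tau> \<in> L0 \<Longrightarrow> convex hull \<sigma> \<subseteq> convex hull \<tau> \<Longrightarrow>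
      (\<And>h. h \<in> H \<Longrightarrow> (\<forall>x\<in>convex hull \<sigma>. 0 \<le> h x) \<or> (\<forall>x\<in>convex hull \<sigma>. h x \<le> (0::real))) \<Longrightarrow>
      affine_map_on (convex hull \<sigma>) \<phi> \<and> (\<exists>\<rho>\<in>M0. \<phi> ` (convex hull \<sigma>) \<subseteq> convex hull \<rho>)"
  shows "PL_equiv K0 M0"
proof -
  obtain f g K where fg: "homeomorphism (underlying_space K0) (underlying_space L0) f g" and K: "is_subdivision K K0"
    and f: "\<forall>\<sigma>\<in>K. affine_map_on (convex hull \<sigma>) f" and fK: "is_subdivision ((`) f ` K) L0"
    using KL unfolding PL_equiv_def by blast
  obtain L where L: "is_subdivision L ((`) f ` K)"
    and sgn: "\<And>h \<sigma>. h \<in> H \<Longrightarrow> \<sigma> \<in> L \<Longrightarrow> (\<forall>x\<in>convex hull \<sigma>. 0 \<le> h x) \<or> (\<forall>x\<in>convex hull \<sigma>. h x \<le> 0)"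
    using subdivision_cut_many[of "(`) f ` K" H] fK H by (auto simp: is_subdivision_def)
  have L0: "is_subdivision L L0" using is_subdivision_trans[OF L fK] .
  have uL: "underlying_space L = underlying_space L0" and gL: "geometric_complex L" using L0 by (auto simp: is_subdivision_def)
  have hL: "convex hull \<sigma> \<subseteq> underlying_space L0" if "\<sigma> \<in> L" for \<sigma>
    using hull_subset_underlying_space[OF that] uL by simp
  have fgx: "f (g y) = y" "g y \<in> underlying_space K0" if "y \<in> underlying_space L0" for y
    using that fg by (auto simp: homeomorphism_def)
  have gfx: "g (f x) = x" if "x \<in> underlying_space K0" for x
    using that fg by (auto simp: homeomorphism_def)
  have cells: "affine_map_on (convex hull \<sigma>) \<phi> \<and> (\<exists>\<rho>\<in>M0. \<phi> ` (convex hull \<sigma>) \<subseteq> convex hull \<rho>)" if \<sigma>: "\<sigma> \<in> L" for \<sigma>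
  proof -
    have "\<exists>\<tau>\<in>L0. convex hull \<sigma> \<subseteq> convex hull \<tau>" using L0 \<sigma> by (simp add: is_subdivision_def)
    then obtain \<tau> where \<tau>: "\<tau> \<in> L0" "convex hull \<sigma> \<subseteq> convex hull \<tau>" by blast
    show ?thesis by (rule cell[OF \<tau>]) (rule sgn[OF _ \<sigma>])
  qed
  have ga: "affine_map_on (convex hull \<sigma>) g" and gsub: "\<exists>\<tau>\<in>K. convex hull (g ` \<sigma>) \<subseteq> convex hull \<tau>" if \<sigma>: "\<sigma> \<in> L" for \<sigma>
  proof -
    have "\<exists>\<tau>\<in>(`) f ` K. convex hull \<sigma> \<subseteq> convex hull \<tau>" using L \<sigma> by (simp add: is_subdivision_def)
    then obtain \<tau> where \<tau>: "\<tau> \<in> K" "convex hull \<sigma> \<subseteq> convex hull (f ` \<tau>)" by blast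
    show ga: "affine_map_on (convex hull \<sigma>) g"
      using PL_equiv_inverse_affine[OF fg K f \<tau>(1)] \<tau>(2) by (rule affine_map_on_subset)
    have "convex hull (g ` \<sigma>) = g ` (convex hull \<sigma>)" using affine_image_convex_hull[OF ga] by simp
    also have "\<dots> \<subseteq> g ` f ` (convex hull \<tau>)" using \<tau> f affine_image_convex_hull[of \<tau> f] by (metis image_mono)
    also have "\<dots> = convex hull \<tau>"
    proof -
      have "convex hull \<tau> \<subseteq> underlying_space K0"
        using K hull_subset_underlying_space[OF \<tau>(1)] by (simp add: is_subdivision_def)
      then show ?thesis using gfx by (force simp: image_image)
    qed
    finally show "\<exists>\<tau>\<in>K. convex hull (g ` \<sigma>) \<subseteq> convex hull \<tau>" using \<tau>(1) by blast
  qed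
  have "inj_on g (underlying_space L)" unfolding uL by (rule inj_on_inverseI[of _ f]) (rule fgx(1))
  note G = geometric_complex_image[OF gL this ga]
  have "inj_on \<phi> (underlying_space L)"
    unfolding uL by (rule inj_on_inverseI[of _ \<psi>]) (use hom in \<open>simp add: homeomorphism_def\<close>)
  note P = geometric_complex_image[OF gL this conjunct1[OF cells]]
  have gK: "is_subdivision ((`) g ` L) K0"
  proof (rule is_subdivision_trans[OF _ K])
    have "g ` underlying_space L0 = underlying_space K0" using fg by (auto simp: homeomorphism_def)
    then show "is_subdivision ((`) g ` L) K"
      using G K gsub uL by (auto simp: is_subdivision_def)
  qed
  have fgL: "f ` g ` \<sigma> = \<sigma>" if "\<sigma> \<in> L" for \<sigma>
  proof -
    have "\<sigma> \<subseteq> underlying_space L0" using hL[OF that] hull_subset[of \<sigma> convex] by blast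
    then show ?thesis using fgx(1) by (force simp: image_image)
  qed
  have e: "(\<phi> \<circ> f) ` g ` \<sigma> = \<phi> ` \<sigma>" if "\<sigma> \<in> L" for \<sigma> using fgL[OF that] by (metis image_comp)
  have "(`) (\<phi> \<circ> f) ` (`) g ` L = (\<lambda>\<sigma>. (\<phi> \<circ> f) ` g ` \<sigma>) ` L" by (rule image_image)
  also have "\<dots> = (`) \<phi> ` L" by (rule image_cong[OF refl]) (rule e)
  finally have im: "(`) (\<phi> \<circ> f) ` (`) g ` L = (`) \<phi> ` L" .
  have sM: "is_subdivision ((`) \<phi> ` L) M0"
    unfolding is_subdivision_def
  proof (intro conjI ballI)
    show "underlying_space ((`) \<phi> ` L) = underlying_space M0"
      using P(2) uL hom by (simp add: homeomorphism_def)
    show "\<exists>\<tau>\<in>M0. convex hull \<sigma>' \<subseteq> convex hull \<tau>" if \<sigma>': "\<sigma>' \<in> (`) \<phi> ` L" for \<sigma>'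
    proof -
      obtain \<sigma> where \<sigma>: "\<sigma> \<in> L" "\<sigma>' = \<phi> ` \<sigma>" using \<sigma>' by blast
      show ?thesis using cells[OF \<sigma>(1)] affine_image_convex_hull[of \<sigma> \<phi>] \<sigma>(2) by simp
    qed
  qed (rule P(1))
  have aff: "affine_map_on (convex hull \<sigma>') (\<phi> \<circ> f)" if \<sigma>': "\<sigma>' \<in> (`) g ` L" for \<sigma>'
  proof -
    obtain \<sigma> where \<sigma>: "\<sigma> \<in> L" "\<sigma>' = g ` \<sigma>" using \<sigma>' by blast
    have "affine_map_on (convex hull (g ` \<sigma>)) f"
      using ga[OF \<sigma>(1)] fgx(1) hL[OF \<sigma>(1)] by (intro affine_map_on_inverse) auto
    moreover have "f ` (convex hull (g ` \<sigma>)) = convex hull \<sigma>"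
      using affine_image_convex_hull[OF calculation] fgL[OF \<sigma>(1)] by simp
    moreover have "affine_map_on (convex hull \<sigma>) \<phi>" using cells[OF \<sigma>(1)] by blast
    ultimately show ?thesis
      unfolding \<sigma>(2) by (rule affine_map_on_compose)
  qed
  show ?thesis
    by (rule PL_equivI[OF homeomorphism_compose[OF fg hom] gK aff]) (simp_all only: im sM)
qed

subsection \<open>Realizations\<close>

abbreviation crd :: "('a \<Rightarrow>\<^sub>0 real) \<Rightarrow> 'a \<Rightarrow> real" where
  "crd \<equiv> Poly_Mapping.lookup"

abbreviation unit :: "'a \<Rightarrow> 'a \<Rightarrow>\<^sub>0 real" where
  "unit v \<equiv> Poly_Mapping.single v 1"

lemma lookup_scaleR [simp]: "crd (r *\<^sub>R x) i = r * crd x i"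
proof -
  have "finite {i. r *\<^sub>R crd x i \<noteq> 0}"
    by (rule finite_subset[OF _ finite_keys[of x]]) (auto simp: in_keys_iff)
  then show ?thesis by (simp add: scaleR_poly_mapping_def Abs_poly_mapping_inverse)
qed

lemma linear_crd: "linear (\<lambda>x. crd x v)"
  by (rule linearI) (simp_all add: lookup_add)

lemma continuous_on_crd: "continuous_on S (\<lambda>x. crd x v)"
proof -
  have "\<bar>crd x v - crd y v\<bar> \<le> dist x y" for x y
  proof (cases "v \<in> Poly_Mapping.keys x \<union> Poly_Mapping.keys y")
    case True
    have "dist (crd x v) (crd y v) \<le> (\<Sum>n\<in>Poly_Mapping.keys x \<union> Poly_Mapping.keys y. dist (crd x n) (crd y n))"
      using True finite_keys[of x] finite_keys[of y] by (intro member_le_sum) auto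
    then show ?thesis by (simp add: dist_poly_mapping_def dist_real_def)
  next
    case False
    then have "crd x v = 0" "crd y v = 0" by (auto simp: in_keys_iff)
    then show ?thesis by simp
  qed
  then show ?thesis
    unfolding continuous_on_iff by (metis dist_commute dist_real_def order.strict_trans1)
qed

lemma mem_hull_units_iff:
  assumes "finite \<rho>"
  shows "x \<in> convex hull (unit ` \<rho>) \<longleftrightarrow> (\<forall>v. 0 \<le> crd x v) \<and> (\<forall>v. v \<notin> \<rho> \<longrightarrow> crd x v = 0) \<and> sum (crd x) \<rho> = 1"
    (is "_ \<longleftrightarrow> ?P x")
proof
  have "convex {x. ?P x}"
    unfolding convex_def
    by (auto simp: lookup_add sum.distrib sum_distrib_left[symmetric])
  moreover have "unit ` \<rho> \<subseteq> {x. ?P x}"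
    using assms by (auto simp: lookup_single when_def)
  ultimately have "convex hull (unit ` \<rho>) \<subseteq> {x. ?P x}" by (intro hull_minimal)
  then show "x \<in> convex hull (unit ` \<rho>) \<Longrightarrow> ?P x" by blast
next
  assume P: "?P x"
  have "x = (\<Sum>v\<in>\<rho>. crd x v *\<^sub>R unit v)"
  proof (rule poly_mapping_eqI)
    fix k
    have "crd (\<Sum>v\<in>\<rho>. crd x v *\<^sub>R unit v) k = (\<Sum>v\<in>\<rho>. if v = k then crd x k else 0)"
      unfolding lookup_sum by (intro sum.cong) (auto simp: lookup_single when_def)
    then show "crd x k = crd (\<Sum>v\<in>\<rho>. crd x v *\<^sub>R unit v) k" using P assms by simp
  qed
  also have "\<dots> \<in> convex hull (unit ` \<rho>)"
    using P assms by (intro convex_sum) (auto intro: hull_inc)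
  finally show "x \<in> convex hull (unit ` \<rho>)" .
qed

lemma mem_realization_iff:
  assumes "abstract_complex X"
  shows "x \<in> underlying_space (realization X) \<longleftrightarrow>
    (\<exists>\<rho>\<in>X. (\<forall>v. 0 \<le> crd x v) \<and> (\<forall>v. v \<notin> \<rho> \<longrightarrow> crd x v = 0) \<and> sum (crd x) \<rho> = 1)"
  using mem_hull_units_iff abstract_complexD(3)[OF assms] by (auto simp: underlying_space_def realization_def)

lemma inj_unit: "inj unit"
  by (rule injI) (metis lookup_single_eq lookup_single_not_eq zero_neq_one)

lemma geometric_complex_realization:
  assumes X: "abstract_complex X" shows "geometric_complex (realization X)"
proof -
  note X' = abstract_complexD[OF X]
  have int: "convex hull (unit ` \<sigma>) \<inter> convex hull (unit ` \<tau>) = convex hull (unit ` (\<sigma> \<inter> \<tau>))"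
    if f: "finite \<sigma>" "finite \<tau>" for \<sigma> \<tau> :: "'a set"
  proof
    show "convex hull (unit ` (\<sigma> \<inter> \<tau>)) \<subseteq> convex hull (unit ` \<sigma>) \<inter> convex hull (unit ` \<tau>)"
      by (intro Int_greatest hull_mono) auto
    show "convex hull (unit ` \<sigma>) \<inter> convex hull (unit ` \<tau>) \<subseteq> convex hull (unit ` (\<sigma> \<inter> \<tau>))"
    proof
      fix x :: "'a \<Rightarrow>\<^sub>0 real" assume "x \<in> convex hull (unit ` \<sigma>) \<inter> convex hull (unit ` \<tau>)"
      then have s: "\<forall>v. 0 \<le> crd x v" "\<forall>v. v \<notin> \<sigma> \<longrightarrow> crd x v = 0" "sum (crd x) \<sigma> = 1" "\<forall>v. v \<notin> \<tau> \<longrightarrow> crd x v = 0"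
        using mem_hull_units_iff[OF f(1), of x] mem_hull_units_iff[OF f(2), of x] by auto
      have "sum (crd x) (\<sigma> \<inter> \<tau>) = sum (crd x) \<sigma>"
        using f s by (intro sum.mono_neutral_left) auto
      then show "x \<in> convex hull (unit ` (\<sigma> \<inter> \<tau>))"
        using s f by (subst mem_hull_units_iff) auto
    qed
  qed
  have abs: "abstract_complex (realization X)"
    unfolding abstract_complex_def
  proof (intro conjI ballI allI impI)
    show "finite (realization X)" using X'(1) by (simp add: realization_def)
    show "{} \<in> realization X" using X'(2) by (force simp: realization_def)
    show "finite \<rho>" if "\<rho> \<in> realization X" for \<rho> using that X'(3) by (auto simp: realization_def)
    show "\<tau> \<in> realization X" if r: "\<rho> \<in> realization X" "\<tau> \<subseteq> \<rho>" for \<rho> \<tau>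
    proof -
      obtain \<sigma> where \<sigma>: "\<sigma> \<in> X" "\<rho> = unit ` \<sigma>" using r(1) by (auto simp: realization_def)
      then obtain \<sigma>' where "\<sigma>' \<subseteq> \<sigma>" "\<tau> = unit ` \<sigma>'" using r(2) subset_image_iff[of \<tau> unit \<sigma>] by blast
      then show ?thesis using X'(4)[OF \<sigma>(1)] by (auto simp: realization_def)
    qed
  qed
  have "\<not> affine_dependent (unit ` \<sigma>)" if \<sigma>: "finite \<sigma>" for \<sigma> :: "'a set"
  proof
    assume dep: "affine_dependent (unit ` \<sigma>)"
    obtain M P where MP: "M \<inter> P = {}" "M \<union> P = unit ` \<sigma>" "convex hull M \<inter> convex hull P \<noteq> {}"
      using Radon_partition[OF _ dep] \<sigma> by blast
    have "M \<subseteq> unit ` \<sigma>" "P \<subseteq> unit ` \<sigma>" using MP(2) by auto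
    then obtain M' P' where MP': "M' \<subseteq> \<sigma>" "M = unit ` M'" "P' \<subseteq> \<sigma>" "P = unit ` P'"
      unfolding subset_image_iff by blast
    then have "M' \<inter> P' = {}" using MP(1) by blast
    moreover have "finite M'" "finite P'" using MP' \<sigma> finite_subset by blast+
    ultimately have "convex hull M \<inter> convex hull P = {}" using int[of M' P'] MP' by simp
    then show False using MP(3) by blast
  qed
  moreover have "unit ` (\<sigma> \<inter> \<tau>) = unit ` \<sigma> \<inter> unit ` \<tau>" for \<sigma> \<tau> :: "'a set"
    by (rule image_Int[OF inj_unit])
  ultimately show ?thesis
    unfolding geometric_complex_def realization_def using abs[unfolded realization_def] int X'(3)
    by (auto simp del: image_Int)
qed

subsection \<open>Exchanging faces\<close>

text \<open>A common generalization of bistellar moves and stellar subdivisions: the open star of \<open>\<alpha>\<close>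
  is replaced by the open star of \<open>\<beta>\<close>. The notion is symmetric.\<close>

definition exchange :: "'a set set \<Rightarrow> 'a set \<Rightarrow> 'a set \<Rightarrow> 'a set set \<Rightarrow> bool" where
  "exchange X \<alpha> \<beta> Y \<longleftrightarrow> abstract_complex X \<and> abstract_complex Y \<and> finite \<alpha> \<and> finite \<beta> \<and> \<alpha> \<noteq> {} \<and> \<beta> \<noteq> {} \<and>
     \<alpha> \<inter> \<beta> = {} \<and> \<beta> \<notin> X \<and> \<alpha> \<notin> Y \<and>
     (\<forall>\<rho>\<in>X. \<not> \<alpha> \<subseteq> \<rho> \<longrightarrow> \<rho> \<in> Y) \<and> (\<forall>\<rho>\<in>X. \<alpha> \<subseteq> \<rho> \<longrightarrow> (\<forall>a\<in>\<alpha>. \<rho> \<union> \<beta> - {a} \<in> Y)) \<and>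
     (\<forall>\<rho>\<in>Y. \<not> \<beta> \<subseteq> \<rho> \<longrightarrow> \<rho> \<in> X) \<and> (\<forall>\<rho>\<in>Y. \<beta> \<subseteq> \<rho> \<longrightarrow> (\<forall>b\<in>\<beta>. \<rho> \<union> \<alpha> - {b} \<in> X))"

lemma exchange_commute:
  assumes "exchange X \<alpha> \<beta> Y" shows "exchange Y \<beta> \<alpha> X"
  using assms unfolding exchange_def by (elim conjE) (intro conjI; simp add: Int_commute)

lemma exchangeD:
  assumes "exchange X \<alpha> \<beta> Y"
  shows "abstract_complex X" "abstract_complex Y" "finite \<alpha>" "finite \<beta>" "\<alpha> \<noteq> {}" "\<beta> \<noteq> {}" "\<alpha> \<inter> \<beta> = {}"
    "\<beta> \<notin> X" "\<alpha> \<notin> Y"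
  using assms unfolding exchange_def by simp_all

definition shift_dir :: "'a set \<Rightarrow> 'a set \<Rightarrow> 'a \<Rightarrow>\<^sub>0 real" where
  "shift_dir \<alpha> \<beta> = (\<Sum>b\<in>\<beta>. Poly_Mapping.single b (real (card \<alpha>) / real (card \<beta>))) - (\<Sum>a\<in>\<alpha>. unit a)"

text \<open>Moves mass from \<open>\<alpha>\<close> to \<open>\<beta>\<close> until a coordinate in \<open>\<alpha>\<close> vanishes.\<close>

definition mass_shift :: "'a set \<Rightarrow> 'a set \<Rightarrow> ('a \<Rightarrow>\<^sub>0 real) \<Rightarrow> ('a \<Rightarrow>\<^sub>0 real)" where
  "mass_shift \<alpha> \<beta> x = x + Min (crd x ` \<alpha>) *\<^sub>R shift_dir \<alpha> \<beta>"

lemma crd_shift_dir: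
  assumes "finite \<alpha>" "finite \<beta>"
  shows "crd (shift_dir \<alpha> \<beta>) v = (if v \<in> \<beta> then real (card \<alpha>) / real (card \<beta>) else 0) - (if v \<in> \<alpha> then 1 else 0)"
proof -
  have "(\<Sum>b\<in>\<beta>. crd (Poly_Mapping.single b c) v) = (if v \<in> \<beta> then c else 0)" if "finite \<beta>" for \<beta> and c :: real
  proof -
    have "(\<Sum>b\<in>\<beta>. crd (Poly_Mapping.single b c) v) = (\<Sum>b\<in>\<beta>. if b = v then c else 0)"
      by (intro sum.cong) (auto simp: lookup_single when_def)
    then show ?thesis using that by simp
  qed
  then show ?thesis using assms by (simp add: shift_dir_def lookup_minus lookup_sum)
qed

lemma Min_eq_at:
  assumes "finite \<alpha>" "a \<in> \<alpha>" "\<And>a'. a' \<in> \<alpha> \<Longrightarrow> f a \<le> (f a' :: real)"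
  shows "Min (f ` \<alpha>) = f a"
  using assms by (intro Min_eqI) auto

lemma mass_shift_mem:
  assumes e: "exchange X \<alpha> \<beta> Y" and \<rho>: "\<rho> \<in> X" and x: "x \<in> convex hull (unit ` \<rho>)"
    and a: "a \<in> \<alpha>" "\<And>a'. a' \<in> \<alpha> \<Longrightarrow> crd x a \<le> crd x a'"
  shows "mass_shift \<alpha> \<beta> x \<in> convex hull (unit ` (if \<alpha> \<subseteq> \<rho> then \<rho> \<union> \<beta> - {a} else \<rho>))"
proof -
  have fin: "finite \<alpha>" "finite \<beta>" "\<alpha> \<noteq> {}" "\<beta> \<noteq> {}" "\<alpha> \<inter> \<beta> = {}" "finite \<rho>"
    using exchangeD[OF e] abstract_complexD(3)[OF exchangeD(1)[OF e] \<rho>] by simp_all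
  have X: "\<forall>v. 0 \<le> crd x v" "\<forall>v. v \<notin> \<rho> \<longrightarrow> crd x v = 0" "sum (crd x) \<rho> = 1"
    using x mem_hull_units_iff[OF fin(6)] by auto
  define m where "m = crd x a"
  have M: "Min (crd x ` \<alpha>) = m" unfolding m_def by (rule Min_eq_at) (use fin a in auto)
  have c: "crd (mass_shift \<alpha> \<beta> x) v =
      crd x v + m * ((if v \<in> \<beta> then real (card \<alpha>) / real (card \<beta>) else 0) - (if v \<in> \<alpha> then 1 else 0))" for v
    unfolding mass_shift_def M by (simp add: lookup_add crd_shift_dir[OF fin(1,2)])
  show ?thesis
  proof (cases "\<alpha> \<subseteq> \<rho>")
    case False
    then obtain a' where "a' \<in> \<alpha>" "a' \<notin> \<rho>" by blast
    then have "m = 0" using X a(2)[of a'] unfolding m_def by (metis order_antisym)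
    then have "mass_shift \<alpha> \<beta> x = x" by (intro poly_mapping_eqI) (simp add: c)
    then show ?thesis using False x by simp
  next
    case True
    let ?\<rho> = "\<rho> \<union> \<beta> - {a}"
    have m0: "0 \<le> m" using X by (simp add: m_def)
    have mc: "m \<le> crd x v" if "v \<in> \<alpha>" for v using a(2)[OF that] by (simp add: m_def)
    have pos: "0 \<le> crd (mass_shift \<alpha> \<beta> x) v" for v
    proof (cases "v \<in> \<alpha>")
      case True
      then have "v \<notin> \<beta>" using fin(5) by blast
      then show ?thesis using True mc[OF True] by (simp add: c)
    next
      case False
      then show ?thesis using X m0 by (simp add: c)
    qed
    have za: "crd (mass_shift \<alpha> \<beta> x) a = 0"
    proof -
      have "a \<notin> \<beta>" using a(1) fin(5) by blast
      then show ?thesis using a(1) by (simp add: c m_def)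
    qed
    have zero: "crd (mass_shift \<alpha> \<beta> x) v = 0" if "v \<notin> ?\<rho>" for v
    proof (cases "v = a")
      case False
      then have "v \<notin> \<rho>" "v \<notin> \<beta>" "v \<notin> \<alpha>" using that True by auto
      then show ?thesis using X by (simp add: c)
    qed (use za in simp)
    have fr: "finite (\<rho> \<union> \<beta>)" using fin by simp
    have "sum (crd (mass_shift \<alpha> \<beta> x)) ?\<rho> = sum (crd (mass_shift \<alpha> \<beta> x)) (\<rho> \<union> \<beta>)"
      using zero fr by (intro sum.mono_neutral_left) auto
    also have "\<dots> = sum (crd x) (\<rho> \<union> \<beta>) + m * ((\<Sum>v\<in>\<rho> \<union> \<beta>. if v \<in> \<beta> then real (card \<alpha>) / real (card \<beta>) else 0)
        - (\<Sum>v\<in>\<rho> \<union> \<beta>. if v \<in> \<alpha> then 1 else 0))"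
      unfolding c sum.distrib sum_distrib_left[symmetric] sum_subtractf by simp
    also have "(\<Sum>v\<in>\<rho> \<union> \<beta>. if v \<in> \<beta> then real (card \<alpha>) / real (card \<beta>) else 0) = real (card \<alpha>)"
    proof -
      have "(\<rho> \<union> \<beta>) \<inter> \<beta> = \<beta>" by blast
      then show ?thesis using fr fin by (simp add: sum.If_cases)
    qed
    also have "(\<Sum>v\<in>\<rho> \<union> \<beta>. if v \<in> \<alpha> then 1 else 0) = real (card \<alpha>)"
    proof -
      have "(\<rho> \<union> \<beta>) \<inter> \<alpha> = \<alpha>" using True by blast
      then show ?thesis using fr fin by (simp add: sum.If_cases)
    qed
    also have "sum (crd x) (\<rho> \<union> \<beta>) = 1"
      using X fr by (subst sum.mono_neutral_right[of "\<rho> \<union> \<beta>" \<rho>]) auto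
    finally have "sum (crd (mass_shift \<alpha> \<beta> x)) ?\<rho> = 1" by simp
    then show ?thesis using True pos zero fr by (subst mem_hull_units_iff) auto
  qed
qed

lemma exchange_face:
  assumes "exchange X \<alpha> \<beta> Y" "\<rho> \<in> X" "a \<in> \<alpha>"
  shows "(if \<alpha> \<subseteq> \<rho> then \<rho> \<union> \<beta> - {a} else \<rho>) \<in> Y"
  using assms by (auto simp: exchange_def)

lemma ex_min:
  assumes "finite \<alpha>" "\<alpha> \<noteq> {}"
  shows "\<exists>a\<in>\<alpha>. \<forall>a'\<in>\<alpha>. (f a :: real) \<le> f a'"
proof -
  have "Min (f ` \<alpha>) \<in> f ` \<alpha>" using assms by (intro Min_in) auto
  then obtain a where "a \<in> \<alpha>" "Min (f ` \<alpha>) = f a" by auto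
  then show ?thesis using assms Min_le[of "f ` \<alpha>"] by (metis finite_imageI imageI)
qed

lemma mass_shift_space:
  assumes e: "exchange X \<alpha> \<beta> Y" and x: "x \<in> underlying_space (realization X)"
  shows "mass_shift \<alpha> \<beta> x \<in> underlying_space (realization Y)"
proof -
  obtain \<rho> where \<rho>: "\<rho> \<in> X" "x \<in> convex hull (unit ` \<rho>)"
    using x by (auto simp: underlying_space_def realization_def)
  obtain a where a: "a \<in> \<alpha>" "\<forall>a'\<in>\<alpha>. crd x a \<le> crd x a'"
    using ex_min[OF exchangeD(3)[OF e] exchangeD(5)[OF e], of "crd x"] by blast
  show ?thesis
    using mass_shift_mem[OF e \<rho> a(1)] a(2) exchange_face[OF e \<rho>(1) a(1)]
    unfolding underlying_space_def realization_def by blast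
qed

lemma mass_shift_inverse:
  assumes e: "exchange X \<alpha> \<beta> Y" and x: "x \<in> underlying_space (realization X)"
  shows "mass_shift \<beta> \<alpha> (mass_shift \<alpha> \<beta> x) = x"
proof -
  have fin: "finite \<alpha>" "finite \<beta>" "\<alpha> \<noteq> {}" "\<beta> \<noteq> {}" "\<alpha> \<inter> \<beta> = {}" and X: "abstract_complex X"
    using exchangeD[OF e] by simp_all
  obtain \<rho> where \<rho>: "\<rho> \<in> X" and p: "\<forall>v. 0 \<le> crd x v" "\<forall>v. v \<notin> \<rho> \<longrightarrow> crd x v = 0"
    using x mem_realization_iff[OF X] by blast
  have "\<not> \<beta> \<subseteq> \<rho>" using exchangeD(8)[OF e] abstract_complexD(4)[OF X \<rho>] by blast
  then obtain b where b: "b \<in> \<beta>" "crd x b = 0" using p by blast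
  define m where "m = Min (crd x ` \<alpha>)"
  define q where "q = real (card \<alpha>) / real (card \<beta>)"
  have qq: "q * (real (card \<beta>) / real (card \<alpha>)) = 1" using fin by (simp add: q_def)
  have c: "crd (mass_shift \<alpha> \<beta> x) v = crd x v + m * ((if v \<in> \<beta> then q else 0) - (if v \<in> \<alpha> then 1 else 0))" for v
    unfolding mass_shift_def by (simp add: lookup_add crd_shift_dir[OF fin(1,2)] m_def q_def)
  have cb: "crd (mass_shift \<alpha> \<beta> x) v = crd x v + m * q" if "v \<in> \<beta>" for v
  proof -
    have "v \<notin> \<alpha>" using that fin(5) by blast
    then show ?thesis using that by (simp add: c)
  qed
  have "Min (crd (mass_shift \<alpha> \<beta> x) ` \<beta>) = crd (mass_shift \<alpha> \<beta> x) b"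
    by (rule Min_eq_at) (use fin b p cb in auto)
  also have "\<dots> = m * q" using cb[OF b(1)] b(2) by simp
  finally have M: "Min (crd (mass_shift \<alpha> \<beta> x) ` \<beta>) = m * q" .
  define r where "r = real (card \<beta>) / real (card \<alpha>)"
  have mqr: "m * q * r = m" unfolding r_def by (simp only: mult.assoc qq mult_1_right)
  show ?thesis
  proof (rule poly_mapping_eqI)
    fix v
    have "crd (mass_shift \<beta> \<alpha> (mass_shift \<alpha> \<beta> x)) v =
        crd (mass_shift \<alpha> \<beta> x) v + m * q * ((if v \<in> \<alpha> then r else 0) - (if v \<in> \<beta> then 1 else 0))"
      unfolding mass_shift_def[of \<beta> \<alpha>] M by (simp add: lookup_add crd_shift_dir[OF fin(2,1)] r_def)
    moreover have "\<not> (v \<in> \<alpha> \<and> v \<in> \<beta>)" using fin(5) by blast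
    ultimately show "crd (mass_shift \<beta> \<alpha> (mass_shift \<alpha> \<beta> x)) v = crd x v"
      using mqr by (cases "v \<in> \<alpha>"; cases "v \<in> \<beta>"; simp add: c)
  qed
qed

lemma continuous_on_Min_image:
  assumes "finite \<alpha>" "\<alpha> \<noteq> {}" "\<And>a. a \<in> \<alpha> \<Longrightarrow> continuous_on S (\<lambda>x. f x a :: real)"
  shows "continuous_on S (\<lambda>x. Min (f x ` \<alpha>))"
  using assms
proof (induction \<alpha> rule: finite_ne_induct)
  case (insert a \<alpha>)
  then have "continuous_on S (\<lambda>x. min (f x a) (Min (f x ` \<alpha>)))" by (intro continuous_on_min) auto
  moreover have "Min (f x ` insert a \<alpha>) = min (f x a) (Min (f x ` \<alpha>))" for x
    using insert.hyps by simp
  ultimately show ?case by simp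
qed simp

lemma continuous_on_mass_shift:
  assumes "finite \<alpha>" "\<alpha> \<noteq> {}" shows "continuous_on S (mass_shift \<alpha> \<beta>)"
  unfolding mass_shift_def
  by (intro continuous_intros continuous_on_Min_image[OF assms] continuous_on_crd)

lemma homeomorphism_mass_shift:
  assumes e: "exchange X \<alpha> \<beta> Y"
  shows "homeomorphism (underlying_space (realization X)) (underlying_space (realization Y))
    (mass_shift \<alpha> \<beta>) (mass_shift \<beta> \<alpha>)"
proof -
  have e': "exchange Y \<beta> \<alpha> X" by (rule exchange_commute[OF e])
  have fin: "finite \<alpha>" "finite \<beta>" "\<alpha> \<noteq> {}" "\<beta> \<noteq> {}" using exchangeD[OF e] by simp_all
  note 1 = mass_shift_space[OF e] and 2 = mass_shift_space[OF e']
  note 3 = mass_shift_inverse[OF e] and 4 = mass_shift_inverse[OF e']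
  show ?thesis
  proof (rule homeomorphismI)
    show "continuous_on (underlying_space (realization X)) (mass_shift \<alpha> \<beta>)"
      "continuous_on (underlying_space (realization Y)) (mass_shift \<beta> \<alpha>)"
      using fin by (simp_all add: continuous_on_mass_shift)
  qed (use 1 2 3 4 in auto)
qed

lemma ex_least_of_total:
  assumes "finite A" "A \<noteq> {}" "\<And>a b. a \<in> A \<Longrightarrow> b \<in> A \<Longrightarrow> R a b \<or> R b a"
    "\<And>a b c. R a b \<Longrightarrow> R b c \<Longrightarrow> R a c"
  shows "\<exists>a\<in>A. \<forall>b\<in>A. R a b"
  using assms(1-3)
proof (induction A rule: finite_ne_induct)
  case (insert x A)
  then obtain a where a: "a \<in> A" "\<forall>b\<in>A. R a b" by auto
  have xx: "R x x" using insert.prems[of x x] by simp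
  have "R a x \<or> R x a" using insert.prems a by simp
  then show ?case
  proof
    assume "R a x"
    then show ?thesis using a by auto
  next
    assume "R x a"
    then show ?thesis using a xx assms(4) by blast
  qed
qed auto

theorem PL_equiv_exchange:
  fixes K0 :: "'v::real_normed_vector set set" and X Y :: "'a set set"
  assumes K: "PL_equiv K0 (realization X)" and e: "exchange X \<alpha> \<beta> Y"
  shows "PL_equiv K0 (realization Y)"
proof (rule PL_equiv_step[OF K homeomorphism_mass_shift[OF e]])
  let ?H = "(\<lambda>(a, a') x. crd x a - crd x a') ` (\<alpha> \<times> \<alpha>)"
  have fin: "finite \<alpha>" "\<alpha> \<noteq> {}" using exchangeD[OF e] by simp_all
  show "finite ?H" using fin by simp
  show "linear h" if "h \<in> ?H" for h
    using that by (auto intro!: linear_compose_sub linear_crd)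
  fix \<sigma> \<tau>
  assume \<tau>: "\<tau> \<in> realization X" "convex hull \<sigma> \<subseteq> convex hull \<tau>"
    and sgn: "\<And>h. h \<in> ?H \<Longrightarrow> (\<forall>x\<in>convex hull \<sigma>. 0 \<le> h x) \<or> (\<forall>x\<in>convex hull \<sigma>. h x \<le> 0)"
  obtain \<rho> where \<rho>: "\<rho> \<in> X" "\<tau> = unit ` \<rho>" using \<tau>(1) by (auto simp: realization_def)
  have tot: "(\<forall>x\<in>convex hull \<sigma>. crd x a \<le> crd x a') \<or> (\<forall>x\<in>convex hull \<sigma>. crd x a' \<le> crd x a)"
    if "a \<in> \<alpha>" "a' \<in> \<alpha>" for a a'
  proof -
    have "(\<lambda>x. crd x a - crd x a') \<in> ?H" using that by force
    from sgn[OF this] show ?thesis by auto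
  qed
  have "\<exists>a\<in>\<alpha>. \<forall>a'\<in>\<alpha>. \<forall>x\<in>convex hull \<sigma>. crd x a \<le> crd x a'"
    by (rule ex_least_of_total[OF fin tot]) (auto intro: order_trans)
  then obtain a where a: "a \<in> \<alpha>" "\<And>a' x. a' \<in> \<alpha> \<Longrightarrow> x \<in> convex hull \<sigma> \<Longrightarrow> crd x a \<le> crd x a'" by blast
  have \<phi>: "mass_shift \<alpha> \<beta> x = x + crd x a *\<^sub>R shift_dir \<alpha> \<beta>" if "x \<in> convex hull \<sigma>" for x
    unfolding mass_shift_def using Min_eq_at[of \<alpha> a "crd x"] fin(1) a that by simp
  have "affine_map_on (convex hull \<sigma>) (mass_shift \<alpha> \<beta>)"
    unfolding affine_map_on_def
  proof (intro ballI)
    fix x y u assume xy: "x \<in> convex hull \<sigma>" "y \<in> convex hull \<sigma>" and u: "u \<in> {0..1::real}"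
    have "(1 - u) *\<^sub>R x + u *\<^sub>R y \<in> convex hull \<sigma>"
      using xy u by (intro convexD_alt[OF convex_convex_hull]) auto
    then show "mass_shift \<alpha> \<beta> ((1 - u) *\<^sub>R x + u *\<^sub>R y) = (1 - u) *\<^sub>R mass_shift \<alpha> \<beta> x + u *\<^sub>R mass_shift \<alpha> \<beta> y"
      using xy by (simp add: \<phi> lookup_add scaleR_add_right scaleR_add_left add_ac)
  qed
  moreover have "mass_shift \<alpha> \<beta> ` (convex hull \<sigma>) \<subseteq> convex hull (unit ` (if \<alpha> \<subseteq> \<rho> then \<rho> \<union> \<beta> - {a} else \<rho>))"
    using mass_shift_mem[OF e \<rho>(1) _ a(1)] a(2) \<tau>(2) \<rho>(2) by blast
  moreover have "unit ` (if \<alpha> \<subseteq> \<rho> then \<rho> \<union> \<beta> - {a} else \<rho>) \<in> realization Y"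
    using exchange_face[OF e \<rho>(1) a(1)] unfolding realization_def by (rule imageI)
  ultimately show "affine_map_on (convex hull \<sigma>) (mass_shift \<alpha> \<beta>) \<and>
      (\<exists>\<rho>\<in>realization Y. mass_shift \<alpha> \<beta> ` (convex hull \<sigma>) \<subseteq> convex hull \<rho>)" by blast
qed

lemma PL_homeomorphic_of_PL_equiv:
  assumes "PL_equiv (realization X) (realization Y)" shows "PL_homeomorphic Y X"
proof -
  obtain f g K where fg: "homeomorphism (underlying_space (realization X)) (underlying_space (realization Y)) f g"
    and K: "is_subdivision K (realization X)" and f: "\<forall>\<sigma>\<in>K. affine_map_on (convex hull \<sigma>) f"
    and fK: "is_subdivision ((`) f ` K) (realization Y)"
    using assms unfolding PL_equiv_def by blast
  have "piecewise_linear_on (realization X) f" unfolding piecewise_linear_on_def using K f by blast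
  moreover have "piecewise_linear_on (realization Y) g"
    unfolding piecewise_linear_on_def using fK PL_equiv_inverse_affine[OF fg K f] by blast
  ultimately show ?thesis unfolding PL_homeomorphic_def using homeomorphism_sym fg by blast
qed


section \<open>Suspended spheres are combinatorial spheres\<close>

lemma exchange_suspend_antistar:
  assumes S: "abstract_complex S" and v: "{v} \<in> S" and \<Delta>: "finite \<Delta>" "\<Delta> \<noteq> {}" "\<Delta> \<inter> \<Union>S = {}"
  shows "exchange (suspend (antistar v S) (vlink v S) \<Delta>) \<Delta> {v} (suspend S {} \<Delta>)"
proof -
  let ?D = "antistar v S" and ?E = "vlink v S"
  note S' = abstract_complexD[OF S]
  have v\<Delta>: "v \<notin> \<Delta>" using v \<Delta>(3) by blast
  have E: "abstract_complex ?E" by (rule abstract_complex_vlink[OF S v])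
  have X: "abstract_complex (suspend ?D ?E \<Delta>)"
    by (rule abstract_complex_suspend[OF abstract_complex_antistar[OF S] _ _ \<Delta>(1)])
      (use abstract_complexD[OF E] in blast)+
  have Y: "abstract_complex (suspend S {} \<Delta>)"
    by (rule abstract_complex_suspend[OF S _ _ \<Delta>(1)]) (use \<Delta> in auto)
  have 1: "\<rho> \<in> suspend S {} \<Delta>" if "\<rho> \<in> suspend ?D ?E \<Delta>" "\<not> \<Delta> \<subseteq> \<rho>" for \<rho>
    using that by (simp add: suspend_def antistar_def)
  have 2: "\<rho> \<union> {v} - {a} \<in> suspend S {} \<Delta>" if "\<rho> \<in> suspend ?D ?E \<Delta>" "\<Delta> \<subseteq> \<rho>" "a \<in> \<Delta>" for \<rho> a
  proof -
    have "\<rho> \<union> {v} - {a} - \<Delta> = insert v (\<rho> - \<Delta>)" using that v\<Delta> by blast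
    moreover have "insert v (\<rho> - \<Delta>) \<in> S" using that by (simp add: suspend_def vlink_def)
    ultimately show ?thesis using that(3) by (auto simp: suspend_def)
  qed
  have 3: "\<rho> \<in> suspend ?D ?E \<Delta>" if "\<rho> \<in> suspend S {} \<Delta>" "\<not> {v} \<subseteq> \<rho>" for \<rho>
    using that by (auto simp: suspend_def antistar_def)
  have 4: "\<rho> \<union> \<Delta> - {v} \<in> suspend ?D ?E \<Delta>" if "\<rho> \<in> suspend S {} \<Delta>" "{v} \<subseteq> \<rho>" for \<rho>
  proof -
    have e: "\<rho> \<union> \<Delta> - {v} - \<Delta> = \<rho> - \<Delta> - {v}" by blast
    have s: "\<rho> - \<Delta> \<in> S" using that by (simp add: suspend_def)
    have "insert v (\<rho> - \<Delta> - {v}) = \<rho> - \<Delta>" using that v\<Delta> by blast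
    then have "\<rho> - \<Delta> - {v} \<in> ?E" using s by (simp add: vlink_def)
    moreover have "\<rho> - \<Delta> - {v} \<in> ?D" using S'(4)[OF s] by (auto simp: antistar_def)
    ultimately show ?thesis unfolding suspend_def mem_Collect_eq e by simp
  qed
  have "{v} \<notin> suspend ?D ?E \<Delta>" using v\<Delta> by (simp add: suspend_def antistar_def)
  moreover have "\<Delta> \<notin> suspend S {} \<Delta>" by (simp add: suspend_def)
  ultimately show ?thesis
    unfolding exchange_def using X Y \<Delta> v\<Delta> 1 2 3 4 by simp
qed

lemma exchange_suspend_flip:
  assumes S: "abstract_complex S" and c: "flip_cond S \<alpha> \<beta>" and \<Delta>: "finite \<Delta>" "\<Delta> \<noteq> {}" "\<Delta> \<inter> (\<alpha> \<union> \<beta>) = {}"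
  shows "exchange (suspend S {} \<Delta>) \<alpha> \<beta> (suspend (flip S \<alpha> \<beta>) {} \<Delta>)"
proof -
  have ab: "finite \<alpha>" "finite \<beta>" "\<alpha> \<noteq> {}" "\<beta> \<noteq> {}" "\<alpha> \<inter> \<beta> = {}" "\<beta> \<notin> S" using c by (auto simp: flip_cond_def)
  have star: "\<sigma> \<subseteq> \<alpha> \<union> \<beta>" if "\<sigma> \<in> S" "\<alpha> \<subseteq> \<sigma>" for \<sigma> using c that by (simp add: flip_cond_def)
  note mem = flip_cond_mem_iff[OF S c]
  have X: "abstract_complex (suspend S {} \<Delta>)"
    by (rule abstract_complex_suspend[OF S _ _ \<Delta>(1)]) (use \<Delta> in auto)
  have Y: "abstract_complex (suspend (flip S \<alpha> \<beta>) {} \<Delta>)"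
    by (rule abstract_complex_suspend[OF abstract_complex_flip[OF S c] _ _ \<Delta>(1)]) (use \<Delta> in auto)
  have sub\<alpha>: "\<alpha> \<subseteq> \<rho> - \<Delta> \<longleftrightarrow> \<alpha> \<subseteq> \<rho>" and sub\<beta>: "\<beta> \<subseteq> \<rho> - \<Delta> \<longleftrightarrow> \<beta> \<subseteq> \<rho>" for \<rho>
    using \<Delta>(3) by blast+
  have 1: "\<rho> \<in> suspend (flip S \<alpha> \<beta>) {} \<Delta>" if "\<rho> \<in> suspend S {} \<Delta>" "\<not> \<alpha> \<subseteq> \<rho>" for \<rho>
    using that sub\<alpha>[of \<rho>] by (simp add: suspend_def flip_mem_iff)
  have 2: "\<rho> \<union> \<beta> - {a} \<in> suspend (flip S \<alpha> \<beta>) {} \<Delta>" if "\<rho> \<in> suspend S {} \<Delta>" "\<alpha> \<subseteq> \<rho>" "a \<in> \<alpha>" for \<rho> a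
  proof -
    have r: "\<rho> - \<Delta> \<in> S" "\<not> \<Delta> \<subseteq> \<rho>" using that by (auto simp: suspend_def)
    then have "\<rho> - \<Delta> \<subseteq> \<alpha> \<union> \<beta>" using star[OF r(1)] sub\<alpha>[of \<rho>] that by blast
    then have "\<rho> \<union> \<beta> - {a} - \<Delta> \<subseteq> \<alpha> \<union> \<beta>" "\<not> \<alpha> \<subseteq> \<rho> \<union> \<beta> - {a} - \<Delta>" using that(3) by blast+
    moreover have "\<not> \<Delta> \<subseteq> \<rho> \<union> \<beta> - {a}" using r(2) \<Delta>(3) by blast
    ultimately show ?thesis by (simp add: suspend_def flip_mem_iff)
  qed
  have 3: "\<rho> \<in> suspend S {} \<Delta>" if "\<rho> \<in> suspend (flip S \<alpha> \<beta>) {} \<Delta>" "\<not> \<beta> \<subseteq> \<rho>" for \<rho>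
    using that mem[of "\<rho> - \<Delta>"] sub\<beta>[of \<rho>] by (auto simp: suspend_def flip_mem_iff)
  have 4: "\<rho> \<union> \<alpha> - {b} \<in> suspend S {} \<Delta>" if "\<rho> \<in> suspend (flip S \<alpha> \<beta>) {} \<Delta>" "\<beta> \<subseteq> \<rho>" "b \<in> \<beta>" for \<rho> b
  proof -
    have r: "\<rho> - \<Delta> \<in> flip S \<alpha> \<beta>" "\<not> \<Delta> \<subseteq> \<rho>" using that by (auto simp: suspend_def)
    have "\<rho> - \<Delta> \<notin> S"
    proof
      assume "\<rho> - \<Delta> \<in> S"
      then have "\<beta> \<in> S" using abstract_complexD(4)[OF S] sub\<beta>[of \<rho>] that(2) by blast
      then show False using ab by simp
    qed
    then have "\<rho> - \<Delta> \<subseteq> \<alpha> \<union> \<beta>" using r(1) by (simp add: flip_mem_iff)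
    then have s: "\<rho> \<union> \<alpha> - {b} - \<Delta> \<subseteq> \<alpha> \<union> \<beta>" "\<not> \<beta> \<subseteq> \<rho> \<union> \<alpha> - {b} - \<Delta>" using that(3) by blast+
    moreover have "\<not> \<Delta> \<subseteq> \<rho> \<union> \<alpha> - {b}" using r(2) \<Delta>(3) by blast
    ultimately show ?thesis using mem[OF s(1)] by (simp add: suspend_def)
  qed
  have "\<beta> - \<Delta> = \<beta>" "\<alpha> - \<Delta> = \<alpha>" using \<Delta>(3) by blast+
  then have "\<beta> \<notin> suspend S {} \<Delta>" "\<alpha> \<notin> suspend (flip S \<alpha> \<beta>) {} \<Delta>"
    using ab by (simp_all add: suspend_def flip_mem_iff)
  then show ?thesis
    unfolding exchange_def using X Y ab 1 2 3 4 by simp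
qed

lemma suspend_simplex_boundary:
  assumes a: "a \<in> A" and \<Delta>: "\<Delta> \<inter> A = {}"
  shows "suspend (antistar a {\<sigma>. \<sigma> \<subset> A}) (vlink a {\<sigma>. \<sigma> \<subset> A}) \<Delta> = {\<sigma>. \<sigma> \<subset> (A - {a}) \<union> \<Delta>}"
proof (intro Set.set_eqI)
  fix \<rho>
  have "\<rho> - \<Delta> \<in> antistar a {\<sigma>. \<sigma> \<subset> A} \<longleftrightarrow> \<rho> - \<Delta> \<subseteq> A - {a}"
    using a by (auto simp: antistar_def)
  moreover have "\<rho> - \<Delta> \<in> vlink a {\<sigma>. \<sigma> \<subset> A} \<longleftrightarrow> \<rho> - \<Delta> \<subset> A - {a}"
    using a by (auto simp: vlink_def)
  moreover have "\<rho> \<subset> (A - {a}) \<union> \<Delta> \<longleftrightarrow> \<rho> - \<Delta> \<subseteq> A - {a} \<and> (\<Delta> \<subseteq> \<rho> \<longrightarrow> \<rho> - \<Delta> \<subset> A - {a})"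
    using \<Delta> by blast
  ultimately show "\<rho> \<in> suspend (antistar a {\<sigma>. \<sigma> \<subset> A}) (vlink a {\<sigma>. \<sigma> \<subset> A}) \<Delta> \<longleftrightarrow> \<rho> \<in> {\<sigma>. \<sigma> \<subset> (A - {a}) \<union> \<Delta>}"
    by (simp add: suspend_def)
qed

definition suspends_to_sphere :: "nat \<Rightarrow> 'a set set \<Rightarrow> 'a set \<Rightarrow> bool" where
  "suspends_to_sphere n S \<Delta> \<longleftrightarrow> (\<exists>T :: 'a set. finite T \<and> card T = n + card \<Delta> \<and>
     PL_equiv (realization {\<sigma>. \<sigma> \<subset> T}) (realization (suspend S {} \<Delta>)))"

lemma flips_PL_equiv:
  fixes S :: "'a set set"
  assumes "flips n S" and n: "0 < n"
  shows "\<exists>V. finite V \<and> (\<forall>\<Delta>. finite \<Delta> \<and> \<Delta> \<noteq> {} \<and> \<Delta> \<inter> V = {} \<longrightarrow> suspends_to_sphere n S \<Delta>)"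
  using assms(1)
proof induction
  case (simplex A)
  have S: "abstract_complex {\<sigma>. \<sigma> \<subset> A}" using flips_invariants[OF flips.simplex[OF simplex]] by blast
  obtain a where a: "a \<in> A" using simplex by fastforce
  have "A \<noteq> {a}" using simplex n by auto
  then have va: "{a} \<in> {\<sigma>. \<sigma> \<subset> A}" using a by auto
  show ?case
  proof (rule exI[of _ A], intro conjI allI impI)
    fix \<Delta> :: "'a set" assume \<Delta>: "finite \<Delta> \<and> \<Delta> \<noteq> {} \<and> \<Delta> \<inter> A = {}"
    let ?T = "(A - {a}) \<union> \<Delta>"
    have fT: "finite ?T" "card ?T = n + card \<Delta>"
    proof -
      have "(A - {a}) \<inter> \<Delta> = {}" using \<Delta> by blast
      then show "card ?T = n + card \<Delta>" using \<Delta> simplex a by (simp add: card_Un_disjoint)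
    qed (use \<Delta> simplex in simp)
    have "\<Delta> \<inter> \<Union>{\<sigma>. \<sigma> \<subset> A} = {}" using \<Delta> by blast
    then have e: "exchange {\<sigma>. \<sigma> \<subset> ?T} \<Delta> {a} (suspend {\<sigma>. \<sigma> \<subset> A} {} \<Delta>)"
      using exchange_suspend_antistar[OF S va, of \<Delta>] suspend_simplex_boundary[OF a, of \<Delta>] \<Delta> by simp
    have "PL_equiv (realization {\<sigma>. \<sigma> \<subset> ?T}) (realization {\<sigma>. \<sigma> \<subset> ?T})"
      by (rule PL_equiv_refl[OF geometric_complex_realization[OF exchangeD(1)[OF e]]])
    then have "PL_equiv (realization {\<sigma>. \<sigma> \<subset> ?T}) (realization (suspend {\<sigma>. \<sigma> \<subset> A} {} \<Delta>))"
      using e by (rule PL_equiv_exchange)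
    then show "suspends_to_sphere n {\<sigma>. \<sigma> \<subset> A} \<Delta>"
      unfolding suspends_to_sphere_def using fT by (intro exI[of _ ?T] conjI)
  qed (use simplex in simp)
next
  case (flip S \<alpha> \<beta>)
  have S: "abstract_complex S" using flips_invariants[OF flip.hyps(1)] by blast
  obtain V where V: "finite V" "\<And>\<Delta>. finite \<Delta> \<Longrightarrow> \<Delta> \<noteq> {} \<Longrightarrow> \<Delta> \<inter> V = {} \<Longrightarrow> suspends_to_sphere n S \<Delta>"
    using flip.IH by blast
  show ?case
  proof (rule exI[of _ "V \<union> (\<alpha> \<union> \<beta>)"], intro conjI allI impI)
    show "finite (V \<union> (\<alpha> \<union> \<beta>))" using V(1) flip.hyps(2) by (simp add: flip_cond_def)
    fix \<Delta> :: "'a set" assume \<Delta>: "finite \<Delta> \<and> \<Delta> \<noteq> {} \<and> \<Delta> \<inter> (V \<union> (\<alpha> \<union> \<beta>)) = {}"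
    then have d: "finite \<Delta>" "\<Delta> \<noteq> {}" "\<Delta> \<inter> V = {}" "\<Delta> \<inter> (\<alpha> \<union> \<beta>) = {}" by auto
    obtain T :: "'a set" where T: "finite T" "card T = n + card \<Delta>"
      "PL_equiv (realization {\<sigma>. \<sigma> \<subset> T}) (realization (suspend S {} \<Delta>))"
      using V(2)[OF d(1,2,3)] unfolding suspends_to_sphere_def by blast
    have "PL_equiv (realization {\<sigma>. \<sigma> \<subset> T}) (realization (suspend (flip S \<alpha> \<beta>) {} \<Delta>))"
      by (rule PL_equiv_exchange[OF T(3) exchange_suspend_flip[OF S flip.hyps(2) d(1,2,4)]])
    then show "suspends_to_sphere n (flip S \<alpha> \<beta>) \<Delta>"
      unfolding suspends_to_sphere_def using T(1,2) by (intro exI[of _ T] conjI)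
  qed
qed

lemma combinatorial_sphere_suspend:
  fixes S :: "'a set set"
  assumes fl: "flips n S" and n: "0 < n" and v: "{v} \<in> S"
  shows "\<exists>V. finite V \<and> (\<forall>\<Delta>. finite \<Delta> \<and> \<Delta> \<noteq> {} \<and> \<Delta> \<inter> V = {} \<longrightarrow>
    combinatorial_sphere (int n + int (card \<Delta>) - 2) (suspend (antistar v S) (vlink v S) \<Delta>))"
proof -
  have S: "abstract_complex S" using flips_invariants[OF fl] by blast
  obtain V where V: "finite V" "\<And>\<Delta>. finite \<Delta> \<Longrightarrow> \<Delta> \<noteq> {} \<Longrightarrow> \<Delta> \<inter> V = {} \<Longrightarrow> suspends_to_sphere n S \<Delta>"
    using flips_PL_equiv[OF fl n] by blast
  show ?thesis
  proof (rule exI[of _ "V \<union> \<Union>S"], intro conjI allI impI)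
    show "finite (V \<union> \<Union>S)" using V(1) abstract_complexD(1,3)[OF S] by auto
    fix \<Delta> :: "'a set" assume "finite \<Delta> \<and> \<Delta> \<noteq> {} \<and> \<Delta> \<inter> (V \<union> \<Union>S) = {}"
    then have d: "finite \<Delta>" "\<Delta> \<noteq> {}" "\<Delta> \<inter> V = {}" "\<Delta> \<inter> \<Union>S = {}" by auto
    obtain T :: "'a set" where T: "finite T" "card T = n + card \<Delta>"
      "PL_equiv (realization {\<sigma>. \<sigma> \<subset> T}) (realization (suspend S {} \<Delta>))"
      using V(2)[OF d(1,2,3)] unfolding suspends_to_sphere_def by blast
    let ?X = "suspend (antistar v S) (vlink v S) \<Delta>"
    note e = exchange_suspend_antistar[OF S v d(1,2,4)]
    have "PL_equiv (realization {\<sigma>. \<sigma> \<subset> T}) (realization ?X)"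
      by (rule PL_equiv_exchange[OF T(3) exchange_commute[OF e]])
    then have "PL_homeomorphic ?X {\<sigma>. \<sigma> \<subset> T}" by (rule PL_homeomorphic_of_PL_equiv)
    moreover have "standard_sphere (int n + int (card \<Delta>) - 2) {\<sigma>. \<sigma> \<subset> T}"
      unfolding standard_sphere_def using T by (intro exI[of _ T]) (simp add: face_dim_def simplex_boundary_def)
    ultimately show "combinatorial_sphere (int n + int (card \<Delta>) - 2) ?X"
      unfolding combinatorial_sphere_def using exchangeD(1)[OF e] by blast
  qed
qed


section \<open>Spheres without bistellar moves of positive index\<close>

definition unflippable :: "'a set set \<Rightarrow> bool" where
  "unflippable S \<longleftrightarrow> 6 \<le> card (\<Union>S) \<and> (\<forall>x\<in>\<Union>S. \<forall>y\<in>\<Union>S. {x, y} \<in> S \<and>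
     (x \<noteq> y \<longrightarrow> 4 \<le> card {z. z \<notin> {x, y} \<and> {x, y, z} \<in> S}))"

lemma no_link_simplex_boundary:
  fixes S :: "'a set set"
  assumes S: "abstract_complex S" and u: "unflippable S" and v: "{v} \<in> S"
    and \<Delta>: "finite \<Delta>" "\<Delta> \<noteq> {}" "\<Delta> \<inter> \<Union>S = {}"
    and X: "X = suspend (antistar v S) (vlink v S) \<Delta>"
    and \<delta>: "\<delta> \<in> X" "\<delta> \<noteq> {}" and l: "link X \<delta> = {\<tau>. \<tau> \<subset> \<gamma>}"
    and \<gamma>: "\<gamma> \<notin> X" "finite \<gamma>" "2 \<le> card \<gamma>" "\<gamma> \<inter> \<delta> = {}" "card \<gamma> + card \<delta> = card \<Delta> + 4"
  shows False
proof -
  let ?D = "antistar v S" and ?E = "vlink v S" and ?V = "\<Union>S"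
  note S' = abstract_complexD[OF S]
  have fV: "finite ?V" using S'(1,3) by auto
  have V6: "6 \<le> card ?V" and nb: "\<And>x y. x \<in> ?V \<Longrightarrow> y \<in> ?V \<Longrightarrow> {x, y} \<in> S"
    and deg: "\<And>x y. x \<in> ?V \<Longrightarrow> y \<in> ?V \<Longrightarrow> x \<noteq> y \<Longrightarrow> 4 \<le> card {z. z \<notin> {x, y} \<and> {x, y, z} \<in> S}"
    using u by (auto simp: unflippable_def)
  have vV: "v \<in> ?V" and v\<Delta>: "v \<notin> \<Delta>" using v \<Delta>(3) by blast+
  have Xc: "abstract_complex X" unfolding X using exchangeD(1)[OF exchange_suspend_antistar[OF S v \<Delta>]] .
  have fd: "finite \<delta>" using abstract_complexD(3)[OF Xc \<delta>(1)] .
  have memX: "\<rho> \<in> X \<longleftrightarrow> \<rho> - \<Delta> \<in> ?D \<and> (\<Delta> \<subseteq> \<rho> \<longrightarrow> \<rho> - \<Delta> \<in> ?E)" for \<rho> unfolding X by (simp add: suspend_def)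
  have proper: "\<tau> \<union> \<delta> \<in> X" "\<tau> \<in> X" if "\<tau> \<subset> \<gamma>" for \<tau>
  proof -
    have "\<tau> \<in> link X \<delta>" using l that by blast
    then show "\<tau> \<union> \<delta> \<in> X" by (simp add: link_def)
    then show "\<tau> \<in> X" using abstract_complexD(4)[OF Xc] by blast
  qed
  have in\<gamma>: "z \<in> \<gamma>" if "insert z \<delta> \<in> X" "z \<notin> \<delta>" for z
  proof -
    have "{z} \<in> link X \<delta>" using that by (simp add: link_def)
    then show ?thesis using l by auto
  qed
  have DV: "\<sigma> \<subseteq> ?V - {v}" if "\<sigma> \<in> ?D" for \<sigma> using that by (auto simp: antistar_def)
  have XV: "\<rho> - \<Delta> \<subseteq> ?V - {v}" if "\<rho> \<in> X" for \<rho> using that memX DV by blast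
  have small: "\<sigma> \<in> S" if "\<sigma> \<subseteq> ?V" "finite \<sigma>" "card \<sigma> \<le> 2" for \<sigma>
  proof -
    have "card \<sigma> = 0 \<or> card \<sigma> = 1 \<or> card \<sigma> = 2" using that(3) by linarith
    then show ?thesis
    proof (elim disjE)
      assume "card \<sigma> = 1"
      then obtain x where "\<sigma> = {x}" by (auto simp: card_1_singleton_iff)
      then show ?thesis using nb[of x x] that(1) by simp
    next
      assume "card \<sigma> = 2"
      then obtain x y where "\<sigma> = {x, y}" by (auto simp: card_2_iff)
      then show ?thesis using nb[of x y] that(1) by simp
    qed (use that S'(2) in simp)
  qed
  have smallD: "\<sigma> \<in> ?D" if "\<sigma> \<subseteq> ?V - {v}" "finite \<sigma>" "card \<sigma> \<le> 2" for \<sigma>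
    using that small[of \<sigma>] by (auto simp: antistar_def)
  have smallE: "\<sigma> \<in> ?E" if "\<sigma> \<subseteq> ?V - {v}" "finite \<sigma>" "card \<sigma> \<le> 1" for \<sigma>
  proof -
    have "insert v \<sigma> \<in> S" using that vV by (intro small) (auto simp: card_insert_if)
    then show ?thesis using that by (auto simp: vlink_def)
  qed
  have g1V: "\<gamma> - \<Delta> \<subseteq> ?V - {v}"
  proof
    fix x assume x: "x \<in> \<gamma> - \<Delta>"
    have "{x} \<noteq> \<gamma>" using \<gamma>(3) by auto
    then have "{x} \<subset> \<gamma>" using x by blast
    then show "x \<in> ?V - {v}" using XV[OF proper(2)] x by blast
  qed
  have fg: "finite (\<gamma> - \<Delta>)" using \<gamma>(2) by simp
  have cdel: "card \<delta> = card (\<delta> - \<Delta>) + card (\<delta> \<inter> \<Delta>)"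
    using fd card_Int_Diff[of \<delta> \<Delta>] by simp
  have sD: "\<delta> - \<Delta> \<in> ?D" using \<delta>(1) memX by blast
  have sV: "\<delta> - \<Delta> \<subseteq> ?V - {v}" "finite (\<delta> - \<Delta>)" using DV[OF sD] fd by auto
  have cardle: "card A \<le> 3" if "A \<subseteq> B" "finite B" "card B \<le> 3" for A B :: "'a set"
    using card_mono[OF that(2,1)] that(3) by simp
  have cV: "5 \<le> card (?V - {v})" using V6 vV fV by simp
  show False
  proof (cases "\<gamma> - \<Delta> \<in> ?D")
    case False
    have g3: "3 \<le> card (\<gamma> - \<Delta>)" using smallD[OF g1V fg] False by linarith
    have "\<gamma> - \<Delta> = \<gamma>"
    proof (rule ccontr)
      assume "\<gamma> - \<Delta> \<noteq> \<gamma>"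
      then have "\<gamma> - \<Delta> \<subset> \<gamma>" by blast
      then have "\<gamma> - \<Delta> \<in> X" by (rule proper(2))
      then have "\<gamma> - \<Delta> - \<Delta> \<in> ?D" using memX by blast
      then show False using False by simp
    qed
    then have g\<Delta>: "\<gamma> \<inter> \<Delta> = {}" and g3: "3 \<le> card \<gamma>" using g3 by auto
    show False
    proof (cases "\<Delta> \<subseteq> \<delta>")
      case True
      then have sE: "\<delta> - \<Delta> \<in> ?E" using \<delta>(1) memX by blast
      have "\<delta> \<inter> \<Delta> = \<Delta>" using True by blast
      then have c4: "card \<gamma> + card (\<delta> - \<Delta>) = 4" using cdel \<gamma>(5) by simp
      have ext: "z \<in> \<gamma>" if z: "insert v (insert z (\<delta> - \<Delta>)) \<in> S" "z \<noteq> v" "z \<notin> \<delta>" for z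
      proof (rule in\<gamma>)
        have "z \<notin> \<Delta>" using z \<Delta>(3) by blast
        then have e: "insert z \<delta> - \<Delta> = insert z (\<delta> - \<Delta>)" by blast
        have "insert z (\<delta> - \<Delta>) \<in> ?E" using z sE by (auto simp: vlink_def)
        moreover have "insert z (\<delta> - \<Delta>) \<in> S" using S'(4)[OF z(1)] by blast
        ultimately show "insert z \<delta> \<in> X" unfolding memX e by (auto simp: antistar_def vlink_def)
      qed (rule z(3))
      have "card (\<delta> - \<Delta>) = 0 \<or> card (\<delta> - \<Delta>) = 1" using c4 g3 by linarith
      then show False
      proof
        assume c: "card (\<delta> - \<Delta>) = 0"
        then have e: "\<delta> - \<Delta> = {}" using sV(2) by simp
        have "?V - {v} \<subseteq> \<gamma>"
        proof
          fix z assume z: "z \<in> ?V - {v}"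
          then have "z \<notin> \<delta>" using e \<Delta>(3) by blast
          moreover have "insert v (insert z (\<delta> - \<Delta>)) \<in> S" unfolding e using nb[of v z] z vV by simp
          ultimately show "z \<in> \<gamma>" using ext[of z] z by blast
        qed
        then have "card (?V - {v}) \<le> card \<gamma>" by (rule card_mono[OF \<gamma>(2)])
        then show False using cV c4 c by simp
      next
        assume c: "card (\<delta> - \<Delta>) = 1"
        then obtain x where x: "\<delta> - \<Delta> = {x}" by (auto simp: card_1_singleton_iff)
        have xV: "x \<in> ?V" "x \<noteq> v" using sV x by auto
        have "{z. z \<notin> {v, x} \<and> {v, x, z} \<in> S} \<subseteq> \<gamma>"
        proof
          fix z assume "z \<in> {z. z \<notin> {v, x} \<and> {v, x, z} \<in> S}"
          then have z: "z \<noteq> v" "z \<noteq> x" "{v, x, z} \<in> S" by auto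
          have "z \<in> ?V" using z(3) by blast
          then have "z \<notin> \<delta>" using x z \<Delta>(3) by blast
          moreover have "insert v (insert z (\<delta> - \<Delta>)) \<in> S" unfolding x using z(3) by (simp add: insert_commute)
          ultimately show "z \<in> \<gamma>" using ext[of z] z by blast
        qed
        then have "card {z. z \<notin> {v, x} \<and> {v, x, z} \<in> S} \<le> 3" by (rule cardle[OF _ \<gamma>(2)]) (use c4 c in simp)
        then show False using deg[OF vV xV(1)] xV(2) by simp
      qed
    next
      case nd: False
      then obtain w where w: "w \<in> \<Delta>" "w \<notin> \<delta>" by blast
      have key: "\<Delta> \<subseteq> insert w' \<delta> \<and> \<delta> - \<Delta> \<notin> ?E" if w': "w' \<in> \<Delta>" "w' \<notin> \<delta>" for w'
      proof -
        have "w' \<notin> \<gamma>" using w' g\<Delta> by blast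
        then have "insert w' \<delta> \<notin> X" using in\<gamma> w'(2) by blast
        moreover have "insert w' \<delta> - \<Delta> = \<delta> - \<Delta>" using w'(1) by blast
        ultimately show ?thesis using memX[of "insert w' \<delta>"] sD by auto
      qed
      have "\<delta> \<inter> \<Delta> = \<Delta> - {w}" using key[OF w] w by blast
      then have "Suc (card (\<delta> \<inter> \<Delta>)) = card \<Delta>" using card.remove[OF \<Delta>(1) w(1)] by simp
      then have c5: "card \<gamma> + card (\<delta> - \<Delta>) = 5" using cdel \<gamma>(5) by simp
      have "2 \<le> card (\<delta> - \<Delta>)" using smallE[OF sV] key[OF w] by linarith
      then have c: "card (\<delta> - \<Delta>) = 2" "card \<gamma> = 3" using c5 g3 by auto
      then obtain x y where xy: "\<delta> - \<Delta> = {x, y}" "x \<noteq> y" by (auto simp: card_2_iff)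
      have xyV: "x \<in> ?V" "y \<in> ?V" "x \<noteq> v" "y \<noteq> v" using sV xy by auto
      have "{z. z \<notin> {x, y} \<and> {x, y, z} \<in> S} \<subseteq> \<gamma>"
      proof
        fix z assume "z \<in> {z. z \<notin> {x, y} \<and> {x, y, z} \<in> S}"
        then have z: "z \<noteq> x" "z \<noteq> y" "{x, y, z} \<in> S" by auto
        have zV: "z \<in> ?V" using z(3) by blast
        have zv: "z \<noteq> v"
        proof
          assume "z = v"
          then have "\<delta> - \<Delta> \<in> ?E" using z xy xyV by (simp add: vlink_def insert_commute)
          then show False using key[OF w] by blast
        qed
        have z\<Delta>: "z \<notin> \<Delta>" using zV \<Delta>(3) by blast
        then have "z \<notin> \<delta>" using xy z by blast
        moreover have "insert z \<delta> \<in> X"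
        proof -
          have e: "insert z \<delta> - \<Delta> = {x, y, z}" using z\<Delta> xy(1) by blast
          have "\<not> \<Delta> \<subseteq> insert z \<delta>" using w z\<Delta> by blast
          moreover have "{x, y, z} \<in> ?D" using z zv xyV by (simp add: antistar_def)
          ultimately show ?thesis unfolding memX e by simp
        qed
        ultimately show "z \<in> \<gamma>" by (rule in\<gamma>[rotated])
      qed
      then have "card {z. z \<notin> {x, y} \<and> {x, y, z} \<in> S} \<le> 3" by (rule cardle[OF _ \<gamma>(2)]) (use c in simp)
      then show False using deg[OF xyV(1,2) xy(2)] by simp
    qed
  next
    case True
    have gD: "\<Delta> \<subseteq> \<gamma>" "\<gamma> - \<Delta> \<notin> ?E" using True \<gamma>(1) memX[of \<gamma>] by auto
    have g2: "2 \<le> card (\<gamma> - \<Delta>)" using smallE[OF g1V fg] gD(2) by linarith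
    have d\<Delta>: "\<delta> \<inter> \<Delta> = {}" "\<delta> - \<Delta> = \<delta>" using gD(1) \<gamma>(4) by auto
    have "card \<gamma> = card (\<gamma> - \<Delta>) + card \<Delta>"
      using card_Int_Diff[OF \<gamma>(2), of \<Delta>] gD(1) by (simp add: Int_absorb1)
    then have c4: "card (\<gamma> - \<Delta>) + card \<delta> = 4" using \<gamma>(5) by simp
    have ext: "z \<in> \<gamma> - \<Delta>" if z: "insert z \<delta> \<in> S" "z \<noteq> v" "z \<notin> \<delta>" for z
    proof -
      have z\<Delta>: "z \<notin> \<Delta>" using z(1) \<Delta>(3) by blast
      have e: "insert z \<delta> - \<Delta> = insert z \<delta>" using z\<Delta> d\<Delta> by blast
      have "insert z \<delta> \<in> ?D" using z sD d\<Delta> by (simp add: antistar_def)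
      moreover have "\<not> \<Delta> \<subseteq> insert z \<delta>" using \<Delta>(2) z\<Delta> d\<Delta> by blast
      ultimately have "insert z \<delta> \<in> X" unfolding memX e by simp
      then show ?thesis using in\<gamma>[of z] z\<Delta> z(3) by blast
    qed
    have "card \<delta> \<noteq> 0" using fd \<delta>(2) by simp
    then have "card \<delta> = 1 \<or> card \<delta> = 2" using c4 g2 by linarith
    then show False
    proof
      assume c: "card \<delta> = 1"
      then obtain x where x: "\<delta> = {x}" by (auto simp: card_1_singleton_iff)
      have xV: "x \<in> ?V" using sV x d\<Delta> by auto
      have "?V - {v} - {x} \<subseteq> \<gamma> - \<Delta>"
      proof
        fix z assume z: "z \<in> ?V - {v} - {x}"
        then have "insert z \<delta> \<in> S" unfolding x using nb[of z x] xV by simp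
        then show "z \<in> \<gamma> - \<Delta>" using ext[of z] z x by blast
      qed
      then have "card (?V - {v} - {x}) \<le> 3" by (rule cardle[OF _ fg]) (use c4 c in simp)
      moreover have "x \<in> ?V - {v}" using sV x d\<Delta> by auto
      ultimately show False using cV fV by simp
    next
      assume c: "card \<delta> = 2"
      then obtain x y where xy: "\<delta> = {x, y}" "x \<noteq> y" by (auto simp: card_2_iff)
      have xyV: "x \<in> ?V" "y \<in> ?V" using sV xy d\<Delta> by auto
      have "{z. z \<notin> {x, y} \<and> {x, y, z} \<in> S} \<subseteq> insert v (\<gamma> - \<Delta>)"
      proof
        fix z assume "z \<in> {z. z \<notin> {x, y} \<and> {x, y, z} \<in> S}"
        then have z: "z \<noteq> x" "z \<noteq> y" "insert z \<delta> \<in> S" using xy by (auto simp: insert_commute)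
        then show "z \<in> insert v (\<gamma> - \<Delta>)" using ext[of z] xy by blast
      qed
      then have "card {z. z \<notin> {x, y} \<and> {x, y, z} \<in> S} \<le> 3"
        by (rule cardle) (use fg c4 c in \<open>simp_all add: card_insert_if\<close>)
      then show False using deg[OF xyV xy(2)] by simp
    qed
  qed
qed

lemma bistellar_move_result:
  assumes m: "bistellar_move d Y \<alpha> \<beta> X"
  shows "\<beta> \<in> X" "\<alpha> \<notin> X" "link X \<beta> = {\<tau>. \<tau> \<subset> \<alpha>}"
proof -
  have ab: "\<alpha> \<noteq> {}" "\<beta> \<noteq> {}" "\<alpha> \<inter> \<beta> = {}" and Y: "abstract_complex Y"
    and ind: "induced_subcomplex Y (\<alpha> \<union> \<beta>) = join (full_simplex \<alpha>) (simplex_boundary \<beta>)"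
    and X: "X = (Y - join (full_simplex \<alpha>) (simplex_boundary \<beta>)) \<union> join (simplex_boundary \<alpha>) (full_simplex \<beta>)"
    using m by (auto simp: bistellar_move_def)
  have j: "\<sigma> \<in> join (full_simplex \<alpha>) (simplex_boundary \<beta>) \<longleftrightarrow> \<sigma> \<subseteq> \<alpha> \<union> \<beta> \<and> \<not> \<beta> \<subseteq> \<sigma>" for \<sigma>
  proof
    assume "\<sigma> \<subseteq> \<alpha> \<union> \<beta> \<and> \<not> \<beta> \<subseteq> \<sigma>"
    then have "\<sigma> = (\<sigma> \<inter> \<alpha>) \<union> (\<sigma> \<inter> \<beta>)" "\<sigma> \<inter> \<alpha> \<subseteq> \<alpha>" "\<sigma> \<inter> \<beta> \<subset> \<beta>" by auto
    then show "\<sigma> \<in> join (full_simplex \<alpha>) (simplex_boundary \<beta>)"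
      unfolding join_def full_simplex_def simplex_boundary_def by blast
  qed (use ab in \<open>auto simp: join_def full_simplex_def simplex_boundary_def\<close>)
  have j': "\<sigma> \<in> join (simplex_boundary \<alpha>) (full_simplex \<beta>) \<longleftrightarrow> \<sigma> \<subseteq> \<alpha> \<union> \<beta> \<and> \<not> \<alpha> \<subseteq> \<sigma>" for \<sigma>
  proof
    assume "\<sigma> \<subseteq> \<alpha> \<union> \<beta> \<and> \<not> \<alpha> \<subseteq> \<sigma>"
    then have "\<sigma> = (\<sigma> \<inter> \<alpha>) \<union> (\<sigma> \<inter> \<beta>)" "\<sigma> \<inter> \<alpha> \<subset> \<alpha>" "\<sigma> \<inter> \<beta> \<subseteq> \<beta>" by auto
    then show "\<sigma> \<in> join (simplex_boundary \<alpha>) (full_simplex \<beta>)"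
      unfolding join_def full_simplex_def simplex_boundary_def by blast
  qed (use ab in \<open>auto simp: join_def full_simplex_def simplex_boundary_def\<close>)
  have Xm: "\<sigma> \<in> X \<longleftrightarrow> (\<sigma> \<in> Y \<and> \<not> (\<sigma> \<subseteq> \<alpha> \<union> \<beta> \<and> \<not> \<beta> \<subseteq> \<sigma>)) \<or> (\<sigma> \<subseteq> \<alpha> \<union> \<beta> \<and> \<not> \<alpha> \<subseteq> \<sigma>)" for \<sigma>
    unfolding X by (simp add: j j')
  have "\<beta> \<notin> Y"
  proof
    assume "\<beta> \<in> Y"
    then have "\<beta> \<in> induced_subcomplex Y (\<alpha> \<union> \<beta>)" by (simp add: induced_subcomplex_def)
    then show False unfolding ind j by simp
  qed
  then have nY: "\<tau> \<union> \<beta> \<notin> Y" for \<tau> using abstract_complexD(4)[OF Y] by blast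
  have "\<not> \<alpha> \<subseteq> \<beta>" and "\<not> \<beta> \<subseteq> \<alpha>" using ab by blast+
  then show "\<beta> \<in> X" "\<alpha> \<notin> X" unfolding Xm by auto
  have a: "\<tau> \<in> link X \<beta> \<longleftrightarrow> \<tau> \<inter> \<beta> = {} \<and> \<tau> \<subseteq> \<alpha> \<union> \<beta> \<and> \<not> \<alpha> \<subseteq> \<tau> \<union> \<beta>" for \<tau>
    unfolding link_def mem_Collect_eq Xm using nY[of \<tau>] by auto
  have b: "\<tau> \<inter> \<beta> = {} \<and> \<tau> \<subseteq> \<alpha> \<union> \<beta> \<and> \<not> \<alpha> \<subseteq> \<tau> \<union> \<beta> \<longleftrightarrow> \<tau> \<subset> \<alpha>" for \<tau>
    using ab(3) by blast
  show "link X \<beta> = {\<tau>. \<tau> \<subset> \<alpha>}"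
  proof (rule Set.set_eqI)
    show "\<tau> \<in> link X \<beta> \<longleftrightarrow> \<tau> \<in> {\<tau>. \<tau> \<subset> \<alpha>}" for \<tau> unfolding a[of \<tau>] mem_Collect_eq by (rule b)
  qed
qed

lemma not_stellated_suspend:
  fixes S :: "'a set set"
  assumes S: "abstract_complex S" and u: "unflippable S" and v: "{v} \<in> S"
    and \<Delta>: "finite \<Delta>" "\<Delta> \<noteq> {}" "\<Delta> \<inter> \<Union>S = {}" and d: "d = int (card \<Delta>) + 2" and ld: "l \<le> d"
  shows "\<not> stellated l d (suspend (antistar v S) (vlink v S) \<Delta>)"
proof
  define X where "X = suspend (antistar v S) (vlink v S) \<Delta>"
  assume "stellated l d (suspend (antistar v S) (vlink v S) \<Delta>)"
  then have "stellated l d X" by (simp add: X_def)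
  then show False
  proof cases
    case sphere
    then obtain A where A: "finite A" "face_dim A = d + 1" "X = simplex_boundary A"
      by (auto simp: standard_sphere_def)
    have cA: "card A = card \<Delta> + 4" using A(2) d by (simp add: face_dim_def)
    have fV: "finite (\<Union>S)" using abstract_complexD(1,3)[OF S] by auto
    have nb: "{x, y} \<in> S" if "x \<in> \<Union>S" "y \<in> \<Union>S" for x y using u that by (auto simp: unflippable_def)
    have vV: "v \<in> \<Union>S" using v by blast
    have "(\<Union>S - {v}) \<union> \<Delta> \<subseteq> A"
    proof
      fix x assume x: "x \<in> (\<Union>S - {v}) \<union> \<Delta>"
      have "{x} \<in> X"
      proof (cases "x \<in> \<Delta>")
        case True
        then have e: "{x} - \<Delta> = {}" by blast
        have "{} \<in> antistar v S" "{} \<in> vlink v S"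
          using v abstract_complexD(2)[OF S] by (auto simp: antistar_def vlink_def)
        then show ?thesis unfolding X_def suspend_def mem_Collect_eq e by simp
      next
        case False
        then have e: "{x} - \<Delta> = {x}" "\<not> \<Delta> \<subseteq> {x}" using \<Delta>(2) by auto
        have "{x} \<in> antistar v S" using x False nb[of x x] by (auto simp: antistar_def)
        then show ?thesis unfolding X_def suspend_def mem_Collect_eq e(1) using e(2) by simp
      qed
      then show "x \<in> A" unfolding A(3) simplex_boundary_def by blast
    qed
    then have "card ((\<Union>S - {v}) \<union> \<Delta>) \<le> card A" by (rule card_mono[OF A(1)])
    moreover have "card ((\<Union>S - {v}) \<union> \<Delta>) = card (\<Union>S - {v}) + card \<Delta>"
      using fV \<Delta> by (intro card_Un_disjoint) auto
    moreover have "6 \<le> card (\<Union>S)" using u by (rule unflippable_def[THEN iffD1, THEN conjunct1])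
    then have "5 \<le> card (\<Union>S - {v})" unfolding card_Diff_singleton[OF vV] by linarith
    ultimately show False using cA by simp
  next
    case (move Y \<alpha> \<beta>)
    note r = bistellar_move_result[OF move(2)]
    have ab: "finite \<alpha>" "finite \<beta>" "\<beta> \<noteq> {}" "\<alpha> \<inter> \<beta> = {}" "face_dim \<alpha> + face_dim \<beta> = d"
      using move(2) by (auto simp: bistellar_move_def)
    have "card \<alpha> + card \<beta> = card \<Delta> + 4" using ab(5) d by (simp add: face_dim_def)
    moreover have "2 \<le> card \<alpha>" using move(3) ab(5) ld by (simp add: face_dim_def)
    ultimately show False
      using no_link_simplex_boundary[OF S u v \<Delta> X_def r(1) ab(3) r(3,2) ab(1)] ab(4) by blast
  qed
qed

lemma stacked_sphere_suspend:
  fixes S :: "'a::linorder set set"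
  assumes fl: "flips 4 S" and u: "unflippable S" and v: "{v} \<in> S"
    and f: "\<exists>\<sigma>\<in>S. v \<notin> \<sigma> \<and> card \<sigma> = 4" and f': "\<exists>\<sigma>\<in>S. v \<in> \<sigma> \<and> card \<sigma> = 4"
    and \<Delta>: "finite \<Delta>" "\<Delta> \<noteq> {}" "\<Delta> \<inter> \<Union>S = {}" and d: "d = int (card \<Delta>) + 2" and k: "2 \<le> k"
  shows "stacked_sphere k d (suspend (antistar v S) (vlink v S) \<Delta>)"
proof -
  let ?D = "antistar v S" and ?E = "vlink v S"
  let ?B = "suspend ?D ?D \<Delta>" and ?X = "suspend ?D ?E \<Delta>"
  have "\<Delta> \<inter> \<Union>?D = {}" using \<Delta>(3) by (auto simp: antistar_def)
  then have bp: "ball_pair (4 + card \<Delta>) ?B ?X"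
    using ball_pair_suspend[OF ball_pair_antistar[OF fl v f f'] \<Delta>(1,2)] by blast
  note hb = ball_pair_homology_ball[OF bp]
  have S: "abstract_complex S" using flips_invariants[OF fl] by blast
  have "\<rho> \<in> ?X" if \<rho>: "\<rho> \<in> ?B" "face_dim \<rho> \<le> d - k" for \<rho>
  proof (rule ccontr)
    assume "\<rho> \<notin> ?X"
    then have *: "\<Delta> \<subseteq> \<rho>" "\<rho> - \<Delta> \<in> ?D" "\<rho> - \<Delta> \<notin> ?E" using \<rho>(1) by (auto simp: suspend_def)
    have fr: "finite (\<rho> - \<Delta>)" using *(2) abstract_complexD(3)[OF S] by (simp add: antistar_def)
    have "card \<rho> = card (\<rho> - \<Delta>) + card \<Delta>"
      using fr \<Delta>(1) *(1) card_Int_Diff[of \<rho> \<Delta>] by (simp add: Int_absorb1)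
    moreover have "2 \<le> card (\<rho> - \<Delta>)"
    proof (rule ccontr)
      assume "\<not> 2 \<le> card (\<rho> - \<Delta>)"
      then have "card (\<rho> - \<Delta>) = 0 \<or> card (\<rho> - \<Delta>) = 1" by linarith
      then have "insert v (\<rho> - \<Delta>) \<in> S"
      proof
        assume "card (\<rho> - \<Delta>) = 1"
        then obtain x where x: "\<rho> - \<Delta> = {x}" by (auto simp: card_1_singleton_iff)
        have "x \<in> \<Union>S" "v \<in> \<Union>S" using *(2) v unfolding x antistar_def by auto
        then show ?thesis unfolding x using u unfolding unflippable_def by blast
      next
        assume "card (\<rho> - \<Delta>) = 0"
        then have e: "\<rho> - \<Delta> = {}" using fr by simp
        show ?thesis unfolding e using v by simp
      qed
      then show False using *(2,3) by (auto simp: antistar_def vlink_def)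
    qed
    ultimately show False using \<rho>(2) d k by (simp add: face_dim_def)
  qed
  then have "stacked_ball F2 k d ?B"
    unfolding stacked_ball_def hb(2) using hb(1) d by (simp add: add.commute)
  then show ?thesis
    unfolding stacked_sphere_def using field_F2 hb(2) by (intro exI[of _ F2] exI[of _ ?B]) simp
qed

theorem stacked_not_stellated:
  fixes S :: "nat set set"
  assumes fl: "flips 4 S" and u: "unflippable S" and v: "{v} \<in> S"
    and f: "\<exists>\<sigma>\<in>S. v \<notin> \<sigma> \<and> card \<sigma> = 4" and f': "\<exists>\<sigma>\<in>S. v \<in> \<sigma> \<and> card \<sigma> = 4"
    and kl: "2 \<le> k" "l \<le> d" "3 \<le> d"
  shows "\<exists>X :: nat set set. combinatorial_sphere d X \<and> stacked_sphere k d X \<and> \<not> stellated l d X"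
proof -
  have S: "abstract_complex S" using flips_invariants[OF fl] by blast
  obtain V where V: "finite V" "\<And>\<Delta>. finite \<Delta> \<Longrightarrow> \<Delta> \<noteq> {} \<Longrightarrow> \<Delta> \<inter> V = {} \<Longrightarrow>
    combinatorial_sphere (int 4 + int (card \<Delta>) - 2) (suspend (antistar v S) (vlink v S) \<Delta>)"
    using combinatorial_sphere_suspend[OF fl _ v] by auto
  have "finite (V \<union> \<Union>S)" using V(1) abstract_complexD(1,3)[OF S] by auto
  then obtain m where m: "\<And>x. x \<in> V \<union> \<Union>S \<Longrightarrow> x < m" by (meson finite_nat_set_iff_bounded)
  define \<Delta> where "\<Delta> = {m..<m + nat (d - 2)}"
  have \<Delta>: "finite \<Delta>" "\<Delta> \<noteq> {}" and d: "d = int (card \<Delta>) + 2" using kl(3) by (auto simp: \<Delta>_def)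
  have disj: "\<Delta> \<inter> V = {}" "\<Delta> \<inter> \<Union>S = {}" using m by (force simp: \<Delta>_def)+
  have "combinatorial_sphere d (suspend (antistar v S) (vlink v S) \<Delta>)"
    using V(2)[OF \<Delta> disj(1)] d by (simp add: add.commute)
  moreover have "stacked_sphere k d (suspend (antistar v S) (vlink v S) \<Delta>)"
    by (rule stacked_sphere_suspend[OF fl u v f f' \<Delta> disj(2) d kl(1)])
  moreover have "\<not> stellated l d (suspend (antistar v S) (vlink v S) \<Delta>)"
    by (rule not_stellated_suspend[OF S u v \<Delta> disj(2) d kl(2)])
  ultimately show ?thesis by blast
qed


section \<open>A sphere with 15 vertices\<close>

text \<open>Complexes are represented by the lists of their facets.\<close>

definition subset_list :: "nat list \<Rightarrow> nat list \<Rightarrow> bool" where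
  "subset_list A F \<longleftrightarrow> list_all (\<lambda>x. List.member F x) A"

definition faces :: "nat list list \<Rightarrow> nat set set" where
  "faces fs = {\<sigma>. \<exists>F\<in>set fs. \<sigma> \<subseteq> set F}"

definition move_ok :: "nat \<Rightarrow> nat list list \<Rightarrow> nat list \<Rightarrow> nat list \<Rightarrow> bool" where
  "move_ok n fs A B \<longleftrightarrow> A \<noteq> [] \<and> B \<noteq> [] \<and> distinct (A @ B) \<and> length (A @ B) = Suc n \<and>
     list_all (\<lambda>F. \<not> subset_list B F) fs \<and>
     (let star = filter (subset_list A) fs in list_all (\<lambda>F. subset_list F (A @ B)) star \<and>
       list_all (\<lambda>b. list_ex (subset_list (removeAll b (A @ B))) star) B)"

definition do_move :: "nat list list \<Rightarrow> nat list \<Rightarrow> nat list \<Rightarrow> nat list list" where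
  "do_move fs A B = filter (\<lambda>F. \<not> subset_list A F) fs @ map (\<lambda>a. removeAll a (A @ B)) A"

fun run_moves :: "nat \<Rightarrow> nat list list \<Rightarrow> (nat list \<times> nat list) list \<Rightarrow> nat list list option" where
  "run_moves n fs [] = Some fs"
| "run_moves n fs ((A, B) # ms) = (if move_ok n fs A B then run_moves n (do_move fs A B) ms else None)"

lemma subset_list_iff [simp]: "subset_list A F \<longleftrightarrow> set A \<subseteq> set F"
  by (auto simp: subset_list_def list_all_iff)

lemma flip_faces:
  assumes S: "abstract_complex (faces fs)" and ok: "move_ok n fs A B"
  shows "flip_cond (faces fs) (set A) (set B)" "card (set A) + card (set B) = Suc n"
    "flip (faces fs) (set A) (set B) = faces (do_move fs A B)"
proof -
  have dist: "distinct A" "distinct B" "set A \<inter> set B = {}" and len: "length A + length B = Suc n"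
    and ne: "A \<noteq> []" "B \<noteq> []"
    and notB: "\<And>F. F \<in> set fs \<Longrightarrow> \<not> set B \<subseteq> set F"
    and star: "\<And>F. F \<in> set fs \<Longrightarrow> set A \<subseteq> set F \<Longrightarrow> set F \<subseteq> set A \<union> set B"
    using ok by (auto simp: move_ok_def Let_def list_all_iff)
  have ridge: "\<exists>F\<in>set fs. set A \<union> set B - {b} \<subseteq> set F" if b: "b \<in> set B" for b
  proof -
    have "list_all (\<lambda>b. list_ex (subset_list (removeAll b (A @ B))) (filter (subset_list A) fs)) B"
      using ok by (simp add: move_ok_def Let_def del: removeAll_append)
    then have "list_ex (subset_list (removeAll b (A @ B))) (filter (subset_list A) fs)"
      using b unfolding list_all_iff by blast
    then obtain F where "F \<in> set fs" "set (removeAll b (A @ B)) \<subseteq> set F"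
      unfolding list_ex_iff set_filter subset_list_iff by blast
    then show ?thesis by (intro bexI[of _ F]) auto
  qed
  show "card (set A) + card (set B) = Suc n" using dist len by (simp add: distinct_card)
  show c: "flip_cond (faces fs) (set A) (set B)"
    unfolding flip_cond_def
  proof (intro conjI ballI impI)
    show "set B \<notin> faces fs" using notB by (auto simp: faces_def)
    show "set A \<union> set B - {b} \<in> faces fs" if "b \<in> set B" for b
      using ridge[OF that] by (simp add: faces_def)
    show "\<sigma> \<subseteq> set A \<union> set B" if s: "\<sigma> \<in> faces fs" "set A \<subseteq> \<sigma>" for \<sigma>
    proof -
      obtain F where F: "F \<in> set fs" "\<sigma> \<subseteq> set F" using s(1) by (auto simp: faces_def)
      then have "set F \<subseteq> set A \<union> set B" using star s(2) by blast
      then show ?thesis using F(2) by blast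
    qed
  qed (use dist ne in simp_all)
  show "flip (faces fs) (set A) (set B) = faces (do_move fs A B)"
  proof (intro Set.set_eqI iffI)
    fix \<sigma> assume "\<sigma> \<in> flip (faces fs) (set A) (set B)"
    then have s: "\<not> set A \<subseteq> \<sigma>" "\<sigma> \<in> faces fs \<or> \<sigma> \<subseteq> set A \<union> set B" by (simp_all add: flip_mem_iff)
    show "\<sigma> \<in> faces (do_move fs A B)"
    proof (cases "\<sigma> \<subseteq> set A \<union> set B")
      case True
      obtain a where a: "a \<in> set A" "a \<notin> \<sigma>" using s(1) by blast
      then have "\<sigma> \<subseteq> set (removeAll a (A @ B))" using True by auto
      moreover have "removeAll a (A @ B) \<in> set (do_move fs A B)"
        using a(1) unfolding do_move_def by (simp del: removeAll_append)
      ultimately show ?thesis unfolding faces_def by blast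
    next
      case False
      then obtain F where F: "F \<in> set fs" "\<sigma> \<subseteq> set F" using s(2) by (auto simp: faces_def)
      then have "\<not> set A \<subseteq> set F" using star[OF F(1)] False by blast
      then have "F \<in> set (do_move fs A B)" using F(1) by (simp add: do_move_def)
      then show ?thesis using F(2) unfolding faces_def by blast
    qed
  next
    fix \<sigma> assume "\<sigma> \<in> faces (do_move fs A B)"
    then obtain F where F: "F \<in> set (do_move fs A B)" "\<sigma> \<subseteq> set F" by (auto simp: faces_def)
    then consider "F \<in> set fs" "\<not> set A \<subseteq> set F" | a where "a \<in> set A" "F = removeAll a (A @ B)"
      unfolding do_move_def by auto
    then show "\<sigma> \<in> flip (faces fs) (set A) (set B)"
    proof cases
      case 1
      then have "\<sigma> \<in> faces fs" "\<not> set A \<subseteq> \<sigma>" using F(2) by (auto simp: faces_def)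
      then show ?thesis by (simp add: flip_mem_iff)
    next
      case 2
      then have "set F = set A \<union> set B - {a}" by auto
      then have "\<sigma> \<subseteq> set A \<union> set B" "a \<notin> \<sigma>" using F(2) by auto
      then show ?thesis using 2(1) by (auto simp: flip_mem_iff)
    qed
  qed
qed

lemma flips_run_moves:
  assumes "flips n (faces fs)" "run_moves n fs ms = Some gs"
  shows "flips n (faces gs)"
  using assms
proof (induction n fs ms rule: run_moves.induct)
  case (2 n fs A B ms)
  have ok: "move_ok n fs A B" using "2.prems"(2) by (simp split: if_splits)
  have "abstract_complex (faces fs)" using flips_invariants[OF "2.prems"(1)] by blast
  note f = flip_faces[OF this ok]
  have "flips n (faces (do_move fs A B))" using flips.flip[OF "2.prems"(1) f(1,2)] unfolding f(3) .
  then show ?case using "2.IH"[OF ok] "2.prems"(2) ok by simp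
qed simp

lemma flips_simplex_facets:
  assumes "distinct A" "length A = Suc n" "0 < n"
  shows "flips n (faces (map (\<lambda>a. removeAll a A) A))"
proof -
  have "faces (map (\<lambda>a. removeAll a A) A) = {\<sigma>. \<sigma> \<subset> set A}"
    by (auto simp: faces_def)
  then show ?thesis using assms flips.simplex[of "set A" n] by (simp add: distinct_card)
qed

definition edge_link :: "nat list list \<Rightarrow> nat \<Rightarrow> nat \<Rightarrow> nat list" where
  "edge_link fs x y = remdups (filter (\<lambda>z. z \<noteq> x \<and> z \<noteq> y) (concat (filter (\<lambda>F. List.member F y) fs)))"

definition unflippable_facets :: "nat list \<Rightarrow> nat list list \<Rightarrow> bool" where
  "unflippable_facets vs fs \<longleftrightarrow> distinct vs \<and> 6 \<le> length vs \<and> list_all (\<lambda>F. subset_list F vs) fs \<and>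
     list_all (\<lambda>x. let st = filter (\<lambda>F. List.member F x) fs in
       list_all (\<lambda>y. x = y \<or> 4 \<le> length (edge_link st x y)) vs) vs"

lemma unflippable_faces:
  assumes "unflippable_facets vs fs" shows "unflippable (faces fs)"
proof -
  have vs: "distinct vs" "6 \<le> length vs" "\<And>F. F \<in> set fs \<Longrightarrow> set F \<subseteq> set vs"
    and deg: "\<And>x y. x \<in> set vs \<Longrightarrow> y \<in> set vs \<Longrightarrow> x \<noteq> y \<Longrightarrow> 4 \<le> length (edge_link (filter (\<lambda>F. List.member F x) fs) x y)"
    using assms by (auto simp: unflippable_facets_def list_all_iff Let_def)
  have "length (edge_link (filter (\<lambda>F. List.member F x) fs) x y) = card {z. z \<notin> {x, y} \<and> {x, y, z} \<in> faces fs}" for x y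
    unfolding edge_link_def length_remdups_card_conv by (rule arg_cong[where f = card]) (auto simp: faces_def)
  then have deg': "4 \<le> card {z. z \<notin> {x, y} \<and> {x, y, z} \<in> faces fs}" if "x \<in> set vs" "y \<in> set vs" "x \<noteq> y" for x y
    using deg[OF that] by simp
  have down: "\<tau> \<in> faces fs" if "\<sigma> \<in> faces fs" "\<tau> \<subseteq> \<sigma>" for \<sigma> \<tau>
    using that by (auto simp: faces_def)
  have edge: "{x, y} \<in> faces fs" if xy: "x \<in> set vs" "y \<in> set vs" "x \<noteq> y" for x y
  proof -
    have "{z. z \<notin> {x, y} \<and> {x, y, z} \<in> faces fs} \<noteq> {}" using deg'[OF xy] by (metis card.empty not_numeral_le_zero)
    then obtain z where "{x, y, z} \<in> faces fs" by blast
    then show ?thesis by (rule down) blast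
  qed
  have pair: "{x, y} \<in> faces fs" if xy: "x \<in> set vs" "y \<in> set vs" for x y
  proof (cases "x = y")
    case True
    have "card (set vs) \<noteq> card {x}" using vs(1,2) by (simp add: distinct_card)
    then have "set vs \<noteq> {x}" by metis
    then obtain y' where "y' \<in> set vs" "y' \<noteq> x" using xy(1) by blast
    then show ?thesis using down[OF edge[OF xy(1)], of y' "{x, y}"] True by auto
  qed (rule edge[OF xy])
  have "\<Union>(faces fs) = set vs"
  proof
    show "\<Union>(faces fs) \<subseteq> set vs" using vs(3) by (auto simp: faces_def)
    show "set vs \<subseteq> \<Union>(faces fs)" using pair by blast
  qed
  then show ?thesis
    unfolding unflippable_def using vs(1,2) pair deg' by (simp add: distinct_card)
qed

text \<open>The sphere was found by simulated annealing over the 3-spheres with a symmetry of order 3,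
  minimizing the number of missing edges and of edges of degree 3; simplifying it by random
  bistellar moves gave these moves in reverse order.\<close>

definition sphere_moves :: "(nat list \<times> nat list) list" where
  "sphere_moves =
   [([0,5,11,13], [9]), ([0,5,9,13], [15]), ([0,5,9,11], [7]), ([0,5,9], [7,15]), 
    ([0,5,13], [3,15]), ([0,5,11], [3,7]), ([0,5], [3,7,15]), ([5,7,9], [11,15]), 
    ([11,15], [5,7,9]), ([5,7,9,11], [2]), ([0,9,11,13], [12]), ([0,9,11], [7,12]), 
    ([3,5,11], [7,13]), ([5,9,11], [2,13]), ([7,9,11], [2,12]), ([7,13], [3,5,11]), 
    ([9,11], [2,12,13]), ([3,5,11,13], [14]), ([3,11,13], [0,14]), ([2,7,9,12], [4]), 
    ([3,5,11], [7,14]), ([2,4,7,12], [10]), ([2,9,12], [4,13]), ([5,7,11,14], [8]), 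
    ([5,11,14], [8,13]), ([11,13,14], [0,8]), ([2,7,12], [10,11]), ([2,4,12], [10,13]), 
    ([0,12,13], [9,11]), ([9,12,13], [4,11]), ([2,11,13], [5,12]), ([2,4,13], [9,10]), 
    ([4,9,11,13], [1]), ([7,11,12], [0,10]), ([11,12,13], [4,5]), ([7,10,11], [0,2]), 
    ([0,7,11], [2,3]), ([4,9,13], [1,10]), ([4,7,10,12], [6]), ([4,11,13], [1,5]), 
    ([0,2,11], [3,10]), ([2,7,10], [0,4]), ([0,8], [11,13,14]), ([4,10,12], [6,13]), 
    ([0,3,11], [10,14]), ([1,4,13], [5,10]), ([5,11,13], [1,8]), ([0,3,7], [2,15]), 
    ([4,7,10], [0,6]), ([4,10,13], [5,6]), ([2,15], [0,3,7]), ([5,8,11], [1,7]), ([1,5,13], [8,10]), 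
    ([5,7,11], [1,2]), ([6,10,12], [7,13]), ([6,12], [4,7,13]), ([0,2,10], [3,4]), 
    ([3,10,11], [2,14]), ([1,5,10], [4,8]), ([4,6,10], [0,5]), ([4,5,10], [0,8]), 
    ([2,3,10], [4,14]), ([4,5,8], [0,1]), ([2,7,11], [1,3]), ([0,4,5], [1,6]), ([1,4,5], [6,11]), 
    ([1,5,11], [2,6]), ([0,4,10], [3,8]), ([1,2,11], [3,6]), ([2,3,11], [6,14]), ([4,9,11], [1,12]), 
    ([2,4,10], [9,14]), ([0,3,4], [2,8]), ([4,9,10], [1,14]), ([1,4,9], [12,14]), ([2,4,14], [3,9]), 
    ([2,3,4], [8,9]), ([4,9,14], [3,12]), ([2,3,14], [6,9]), ([2,3,9], [6,8]), ([3,9,14], [6,12]), 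
    ([3,6,9], [8,12]), ([3,9], [4,8,12]), ([5,13,15], [3,9]), ([13,15], [0,3,9]), ([0,15], [3,7,9]), 
    ([15], [3,5,7,9])]"

definition check_sphere :: bool where
  "check_sphere = (case run_moves 4 (map (\<lambda>a. removeAll a [0,3,5,11,13]) [0,3,5,11,13]) sphere_moves of
     None \<Rightarrow> False
   | Some fs \<Rightarrow> unflippable_facets [0..<15] fs \<and>
       list_ex (\<lambda>F. \<not> List.member F 0 \<and> distinct F \<and> length F = 4) fs \<and>
       list_ex (\<lambda>F. List.member F 0 \<and> distinct F \<and> length F = 4) fs)"

lemma check_sphere: check_sphere
  by code_simp

theorem mainTheorem15:
  fixes k l d :: int
  assumes "2 \<le> k" and "k \<le> l" and "l \<le> d" and "d \<ge> 3"
  shows "\<exists>X :: nat set set.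
           combinatorial_sphere d X \<and> stacked_sphere k d X \<and> \<not> stellated l d X"
proof -
  let ?A = "[0, 3, 5, 11, 13] :: nat list"
  obtain fs where fs: "run_moves 4 (map (\<lambda>a. removeAll a ?A) ?A) sphere_moves = Some fs"
    "unflippable_facets [0..<15] fs"
    "list_ex (\<lambda>F. \<not> List.member F 0 \<and> distinct F \<and> length F = 4) fs"
    "list_ex (\<lambda>F. List.member F 0 \<and> distinct F \<and> length F = 4) fs"
    using check_sphere unfolding check_sphere_def by (auto split: option.splits)
  have "flips 4 (faces (map (\<lambda>a. removeAll a ?A) ?A))"
    by (rule flips_simplex_facets) simp_all
  then have fl: "flips 4 (faces fs)" using fs(1) by (rule flips_run_moves)
  have u: "unflippable (faces fs)" by (rule unflippable_faces[OF fs(2)])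
  obtain F where F: "F \<in> set fs" "0 \<notin> set F" "distinct F" "length F = 4"
    using fs(3) by (auto simp: list_ex_iff)
  obtain G where G: "G \<in> set fs" "0 \<in> set G" "distinct G" "length G = 4"
    using fs(4) by (auto simp: list_ex_iff)
  have FG: "set F \<in> faces fs" "set G \<in> faces fs" using F G by (auto simp: faces_def)
  show ?thesis
  proof (rule stacked_not_stellated[OF fl u])
    show "{0} \<in> faces fs" using G by (auto simp: faces_def)
    show "\<exists>\<sigma>\<in>faces fs. 0 \<notin> \<sigma> \<and> card \<sigma> = 4"
      using FG F by (intro bexI[of _ "set F"]) (simp_all add: distinct_card)
    show "\<exists>\<sigma>\<in>faces fs. 0 \<in> \<sigma> \<and> card \<sigma> = 4"
      using FG G by (intro bexI[of _ "set G"]) (simp_all add: distinct_card)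
  qed (use assms in simp_all)
qed

end
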